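(* Fix $R\ge1$. In the setting and notation of the context (Banach lattice $\mathcal X$ with weights $\gamma$, logarithmic gradient $b$ built from $A$, $F_k^0$, $G_k$; coercivity functionals $L_k(x_k)=(F_k^0(x_k),x_k)_H$), let $\mathcal J=\{\mathcal J_{k,j}\}_{k,j\in\mathbb Z}$ be an infinite symmetric matrix with entries $\mathcal J_{k,j}=\mathcal J_{j,k}\ge0$ such that $|||\mathcal J|||:=\sup_{k}\sum_{j}\mathcal J_{k,j}\gamma_{k-j}^R<\infty$. Suppose there are constants $\mathcal K_0,\mathcal K_1,\mathcal K_2,\mathcal K_3,\mathcal M_1,\mathcal M_2>0$ and $\mathcal L_0,\mathcal L_1,\mathcal L_2,\mathcal L_3,\mathcal N_1,\mathcal N_2\ge0$ such that uniformly for all $x\in\mathcal X$ and $i=(k,n)\in\mathbb Z\times\mathbb N$: ($\mathbb F_0$) $|\partial_nF_k^0(x_k)|_{B^*}\le\mathcal K_0(|F_k^0(x_k)|_{B^*}+|x_k|_B^R)+\mathcal L_0$; ($\mathbb G_1$) $|(G_k(x),\varphi_n)_H|+|(\partial_iG_k(x),\varphi_n)_H|\le\mathcal M_1\sum_{j}\mathcal J_{k,j}|x_j|_B^R+\mathcal N_1$; ($\mathbb G_2$) $|G_k(x)|_{B^*}+|(G_k(x),x_k)_H|+|(\partial_iG_k(x),x_k)_H|\le\mathcal M_2\sum_{j}\mathcal J_{k,j}|x_j|_B^R+\mathcal N_2$; ($\mathbb L_1$) $|(F_k^0(x_k),\varphi_n)_H|+|(\partial_nF_k^0(x_k),\varphi_n)_H|\le\mathcal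 K_1L_k(x_k)+\mathcal L_1$; ($\mathbb L_2$) $|(\partial_nF_k^0(x_k),x_k)_H|\le\mathcal K_2L_k(x_k)+\mathcal L_2$; ($\mathbb L_3$) $|x_k|_B^R\le\mathcal K_3L_k(x_k)+\mathcal L_3$. Suppose that $\Xi_0:=\mathcal K_1\mathrm{Tr}_HA^{-1}<1$, that $$\Theta_0:=|||\mathcal J|||\cdot\mathcal K_3\,\frac{\mathcal M_2+\mathcal M_1\mathrm{Tr}_HA^{-1}}{1-\mathcal K_1\mathrm{Tr}_HA^{-1}}<1,$$ and that for some given $Q\ge1$ $$\Xi_{2Q-1}:=\mathrm{Tr}_HA^{-1}\,\mathcal K_1[1+(2Q-1)\mathcal K_2]<1 .$$ Assume furthermore that $\mathrm{Tr}_HA^{\alpha-1}<\infty$ for some $\alpha\ge0$. Then every $\mu\in\mathcal M^b(\mathcal X)$ satisfies $$\mu\big(\mathcal X\cap l^2(\mathbb Z\to H^\alpha;\gamma^{-1})\big)=1$$ and, moreover, $$\sup_{\mu\in\mathcal M^b(\mathcal X)}\sup_{k\in\mathbb Z}\int_{\mathcal X}|x_k|_{H^\alpha}^{Q+1}\,d\mu(x)<\infty .$$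
   Context: Single-site spaces. $H$ is a separable real Hilbert space with inner product $(\cdot,\cdot)_H$; $X\subset B\subset H\subset B^*$ are dense continuous embeddings, where $X$ is a locally convex (e.g. Banach) space, $B$ a reflexive Banach space, $B^*$ its dual, the duality between $B$ and $B^*$ being given by (the extension of) $(\cdot,\cdot)_H$; the norms $|\cdot|_B$, $|\cdot|_{B^*}$ are differentiable outside zero. $A$ is a positive self-adjoint operator in $H$ with discrete spectrum $\{\lambda_n\}_{n\in\mathbb N}$ and complete orthonormal system of eigenvectors $A\varphi_n=\lambda_n\varphi_n$, $\mathrm{Tr}_HA^{-1}=\sum_n\lambda_n^{-1}<\infty$. All $\varphi_n\in X$, $\{\varphi_n\}$ is a Schauder basis of $B$, and there are finite constants $\kappa,\varsigma$ with $\sup_n|\varphi_n|_B\le\kappa$ and $|\mathbb P_Kx|_B\le\varsigma|x|_B$ for $x\in B$, $K\in\mathbb N$, where $\mathbb P_Kx=\sum_{n\le K}(x,\varphi_n)_H\varphi_n$. For $\alpha\ge0$, $H^\alpha=\{x\in H:|x|_{H^\alpha}^2=\sum_n\lambda_n^\alpha(x,\varphi_n)_H^2<\infty\}$, $H^0=H$. Lattice. $\mathbb Z$ denotes a countable index set with an abelian group structure (e.g. $\mathbb Z^d$). $\gamma=\{\gamma_k\}_{k\in\mathbb Z}$ is a weight system with $\gamma_k\ge1$, $\sum_k\gamma_k^{-1}\le1$, and $\gamma_{k-j}=\gamma_{j-k}\le\gamma_k\gamma_j$ for all $k,j$. For a normed space $Y$, $l^2(\mathbb Z\to Y;\gamma^{-1})=\{x\in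 Y^{\mathbb Z}:\sum_k\gamma_k^{-1}|x_k|_Y^2<\infty\}$; $\mathcal B=l^2(\mathbb Z\to B;\gamma^{-1})$. $\mathcal X=\mathcal B\cap X^{\mathbb Z}$, a locally convex Polish space with metric $\rho_{\mathcal X}(x,x')=\big[\sum_k\gamma_k^{-1}\big(|x_k-x_k'|_B^2+\frac{|x_k-x_k'|_X^2}{1+|x_k-x_k'|_X^2}\big)\big]^{1/2}$. For $i=(k,n)\in\mathbb Z\times\mathbb N$, $h_i=(\delta_{k,j}\varphi_n)_{j\in\mathbb Z}$, and $\partial_i=\partial_{(k,n)}$ is the partial derivative along $h_i$; $\partial_n$ is the partial derivative along $\varphi_n$ on $X$. Logarithmic gradient. For each $k\in\mathbb Z$, $F_k^0:X\to B^*$ and $G_k:\mathcal X\to B^*$ are (nonlinear) mappings which are continuous and locally bounded together with their partial derivatives in all directions $\varphi_n$, respectively $h_{(k,n)}$, $n\in\mathbb N$. Put $F_k(x)=F_k^0(x_k)+G_k(x)$ and $b_{(k,n)}(x)=-(A\varphi_n,x_k)_H-(F_k(x),\varphi_n)_H$, $x\in\mathcal X$. $C^1_b(\mathcal X;h)$ is the set of $f:\mathcal X\to\mathbb R$ continuous and bounded together with $\partial_hf$. $\mathcal M^b(\mathcal X)$ is the family of all Borel probability measures $\mu$ on $\mathcal X$ such that for every $i=(k,n)$ $$\int_{\mathcal X}\partial_{(k,n)}f\,d\mu=-\int_{\mathcal X}f\,b_{(k,n)}\,d\mu$$ for all $f\in C_b^1(\mathcal X;h_i)$ with $\sup_{x\in\mathcal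 X}|f(x)|(1+|x_k|_{B^*}+|F_k(x)|_{B^*})<\infty$. The coercivity functionals are $L_k:X\to\mathbb R$, $L_k(x_k)=(F_k^0(x_k),x_k)_H$. *)

theory Defs
  imports "HOL-Probability.Probability"
begin

text \<open>
  The inclusions \<open>X \<subseteq> B \<subseteq> H \<subseteq> B*\<close> are rendered by types \<open>'x\<close>, \<open>'b\<close>, \<open>'h\<close> and injective continuous
  linear maps \<open>jX :: 'x \<Rightarrow> 'b\<close> and \<open>jB :: 'b \<Rightarrow>\<^sub>L 'h\<close>; the dual of \<open>'b\<close> is \<open>'b \<Rightarrow>\<^sub>L real\<close> with the
  operator norm, and \<open>H\<close> is mapped into it by \<open>h \<mapsto> (x \<mapsto> (h, x)\<^sub>H)\<close>. Thus for \<open>\<xi>\<close> in the dual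
  and \<open>x\<close> in \<open>B\<close>, the pairing extending the inner product of \<open>H\<close> is \<open>blinfun_apply \<xi> x\<close>.
\<close>

definition h_to_dual :: "('b::real_normed_vector \<Rightarrow>\<^sub>L 'h::real_inner) \<Rightarrow> 'h \<Rightarrow> ('b \<Rightarrow>\<^sub>L real)" where
  "h_to_dual jB h = blinfun_inner_right h o\<^sub>L jB"

definition reflexive_space :: "'b::real_normed_vector itself \<Rightarrow> bool" where
  "reflexive_space _ \<longleftrightarrow>
     (\<forall>\<Phi> :: ('b \<Rightarrow>\<^sub>L real) \<Rightarrow>\<^sub>L real. \<exists>x. \<forall>\<xi>. blinfun_apply \<Phi> \<xi> = blinfun_apply \<xi> x)"

definition schauder_basis :: "(nat \<Rightarrow> 'b::real_normed_vector) \<Rightarrow> bool" where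
  "schauder_basis e \<longleftrightarrow> (\<forall>x. \<exists>!a. (\<lambda>n. a n *\<^sub>R e n) sums x)"

text \<open>
  A locally convex space metrized by its translation invariant distance \<open>|x - y|\<close>, where
  \<open>|x|\<close> is \<open>dist x 0\<close>. Every real normed space is an instance.
\<close>

definition locally_convex_metric :: "'x::{real_vector, metric_space} itself \<Rightarrow> bool" where
  "locally_convex_metric _ \<longleftrightarrow>
     (\<forall>x y z :: 'x. dist (x + z) (y + z) = dist x y) \<and>
     continuous_on UNIV (\<lambda>(a, x :: 'x). a *\<^sub>R x) \<and>
     (\<forall>U :: 'x set. open U \<and> 0 \<in> U \<longrightarrow> (\<exists>V. open V \<and> convex V \<and> 0 \<in> V \<and> V \<subseteq> U))"

text \<open>
  Possibly unbounded operators are given by a domain \<open>D\<close> and a function, of which only the values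
  on \<open>D\<close> matter. The last clause says that the domain of the adjoint is contained in \<open>D\<close>.
\<close>

definition self_adjoint_op :: "'h::real_inner set \<Rightarrow> ('h \<Rightarrow> 'h) \<Rightarrow> bool" where
  "self_adjoint_op D A \<longleftrightarrow>
     subspace D \<and> closure D = UNIV \<and>
     (\<forall>x\<in>D. \<forall>y\<in>D. A (x + y) = A x + A y) \<and>
     (\<forall>c. \<forall>x\<in>D. A (c *\<^sub>R x) = c *\<^sub>R A x) \<and>
     (\<forall>x\<in>D. \<forall>y\<in>D. A x \<bullet> y = x \<bullet> A y) \<and>
     (\<forall>y. (\<exists>z. \<forall>x\<in>D. A x \<bullet> y = x \<bullet> z) \<longrightarrow> y \<in> D)"

definition positive_op :: "'h::real_inner set \<Rightarrow> ('h \<Rightarrow> 'h) \<Rightarrow> bool" where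
  "positive_op D A \<longleftrightarrow> (\<forall>x\<in>D. x \<noteq> 0 \<longrightarrow> A x \<bullet> x > 0)"

definition tr_inv :: "(nat \<Rightarrow> real) \<Rightarrow> real" where
  "tr_inv lam = (\<Sum>n. inverse (lam n))"

text \<open>
  The eigenvectors are given as elements \<open>\<phi> n\<close> of \<open>X\<close>. Eigenvalues are listed with multiplicity, so
  discreteness of the spectrum means that every bounded range contains finitely many indices.
\<close>

locale single_site =
  fixes jX :: "'x::{real_vector, polish_space} \<Rightarrow> 'b::banach"
    and jB :: "'b \<Rightarrow>\<^sub>L 'h::{real_inner, polish_space}"
    and D :: "'h set" and A :: "'h \<Rightarrow> 'h"
    and lam :: "nat \<Rightarrow> real" and \<phi> :: "nat \<Rightarrow> 'x"
  assumes X_lc: "locally_convex_metric TYPE('x)"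
    and jX: "linear jX" "continuous_on UNIV jX" "inj jX" "closure (range jX) = UNIV"
    and jB: "inj (blinfun_apply jB)" "closure (range (blinfun_apply jB)) = UNIV"
    and H_dual: "inj (h_to_dual jB)" "closure (range (h_to_dual jB)) = UNIV"
    and B_reflexive: "reflexive_space TYPE('b)"
    and norm_B_diff: "\<And>x :: 'b. x \<noteq> 0 \<Longrightarrow> norm differentiable (at x)"
    and norm_dual_diff: "\<And>\<xi> :: 'b \<Rightarrow>\<^sub>L real. \<xi> \<noteq> 0 \<Longrightarrow> norm differentiable (at \<xi>)"
    and A_self_adjoint: "self_adjoint_op D A"
    and A_positive: "positive_op D A"
    and eigen: "\<And>n. jB (jX (\<phi> n)) \<in> D" "\<And>n. A (jB (jX (\<phi> n))) = lam n *\<^sub>R jB (jX (\<phi> n))"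
    and orthonormal: "\<And>m n. jB (jX (\<phi> m)) \<bullet> jB (jX (\<phi> n)) = (if m = n then 1 else 0)"
    and complete: "closure (span (range (\<lambda>n. jB (jX (\<phi> n))))) = UNIV"
    and discrete: "\<And>c. finite {n. lam n \<le> c}"
    and trace: "summable (\<lambda>n. inverse (lam n))"
    and basis: "schauder_basis (\<lambda>n. jX (\<phi> n))"
    and \<phi>_bounded: "\<exists>\<kappa>. \<forall>n. norm (jX (\<phi> n)) \<le> \<kappa>"
    and proj_bounded: "\<exists>\<sigma>. \<forall>K x. norm (\<Sum>n<K. (jB x \<bullet> jB (jX (\<phi> n))) *\<^sub>R jX (\<phi> n)) \<le> \<sigma> * norm x"

text \<open>Squared norm of \<open>H\<^sup>\<alpha>\<close>, infinite outside \<open>H\<^sup>\<alpha>\<close>.\<close>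

definition Hnorm2 ::
    "('x \<Rightarrow> 'b::real_normed_vector) \<Rightarrow> ('b \<Rightarrow>\<^sub>L 'h::real_inner) \<Rightarrow> (nat \<Rightarrow> real) \<Rightarrow> (nat \<Rightarrow> 'x) \<Rightarrow>
     real \<Rightarrow> 'h \<Rightarrow> ennreal" where
  "Hnorm2 jX jB lam \<phi> \<alpha> x = (\<Sum>n. ennreal (lam n powr \<alpha> * (x \<bullet> jB (jX (\<phi> n)))\<^sup>2))"

definition ennreal_powr :: "ennreal \<Rightarrow> real \<Rightarrow> ennreal" where
  "ennreal_powr x p = (if x = \<infinity> then \<infinity> else ennreal (enn2real x powr p))"

definition weight_system :: "('z::{countable, ab_group_add} \<Rightarrow> real) \<Rightarrow> bool" where
  "weight_system \<gamma> \<longleftrightarrow>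
     (\<forall>k. \<gamma> k \<ge> 1) \<and>
     (\<lambda>k. inverse (\<gamma> k)) summable_on UNIV \<and> (\<Sum>\<^sub>\<infinity>k. inverse (\<gamma> k)) \<le> 1 \<and>
     (\<forall>k j. \<gamma> (k - j) = \<gamma> (j - k) \<and> \<gamma> (k - j) \<le> \<gamma> k * \<gamma> j)"

definition J_norm :: "('z::ab_group_add \<Rightarrow> real) \<Rightarrow> real \<Rightarrow> ('z \<Rightarrow> 'z \<Rightarrow> real) \<Rightarrow> ennreal" where
  "J_norm \<gamma> R J = (SUP k. \<Sum>\<^sub>\<infinity>j. ennreal (J k j * \<gamma> (k - j) powr R))"

text \<open>
  The configuration space \<open>\<X> = l\<^sup>2(\<int> \<rightarrow> B; \<gamma>\<^sup>-\<^sup>1) \<inter> X\<^sup>\<int>\<close>. For weights and interactions as in the theorem,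
  \<open>|x\<^sub>j|\<^sub>B\<^sup>R \<le> C \<gamma>\<^sub>j\<^sup>R\<close> on it, hence \<open>\<Sum>j. J\<^sub>k\<^sub>j |x\<^sub>j|\<^sub>B\<^sup>R\<close> converges.
\<close>

definition conf :: "('z \<Rightarrow> real) \<Rightarrow> ('x \<Rightarrow> 'b::real_normed_vector) \<Rightarrow> ('z \<Rightarrow> 'x) set" where
  "conf \<gamma> jX = {x. (\<lambda>k. inverse (\<gamma> k) * (norm (jX (x k)))\<^sup>2) summable_on UNIV}"

definition conf_dist ::
    "('z \<Rightarrow> real) \<Rightarrow> ('x::metric_space \<Rightarrow> 'b::real_normed_vector) \<Rightarrow> ('z \<Rightarrow> 'x) \<Rightarrow> ('z \<Rightarrow> 'x) \<Rightarrow> real" where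
  "conf_dist \<gamma> jX x y =
     sqrt (\<Sum>\<^sub>\<infinity>k. inverse (\<gamma> k) *
        ((norm (jX (x k) - jX (y k)))\<^sup>2 + (dist (x k) (y k))\<^sup>2 / (1 + (dist (x k) (y k))\<^sup>2)))"

lemma Metric_space_conf:
  fixes jX :: "'x::metric_space \<Rightarrow> 'b::real_normed_vector"
  assumes w: "weight_system \<gamma>"
  shows "Metric_space (conf \<gamma> jX) (conf_dist \<gamma> jX)"
proof -
  define p where "p k = sqrt (inverse (\<gamma> k))" for k
  define g :: "real \<Rightarrow> real" where "g t = t / sqrt (1 + t\<^sup>2)" for t
  define N where "N x y = sqrt ((norm (jX x - jX y))\<^sup>2 + (g (dist x y))\<^sup>2)" for x y
  have \<gamma>: "\<gamma> k \<ge> 1" for k using w by (auto simp: weight_system_def)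
  have \<gamma>0: "inverse (\<gamma> k) > 0" for k using \<gamma>[of k] by (smt (verit) positive_imp_inverse_positive)
  have p2: "(p k)\<^sup>2 = inverse (\<gamma> k)" "p k > 0" for k using \<gamma>0[of k] by (auto simp: p_def)
  have g2: "(g t)\<^sup>2 = t\<^sup>2 / (1 + t\<^sup>2)" for t
    by (simp add: g_def power_divide add_nonneg_nonneg)
  have g_le1: "(g t)\<^sup>2 \<le> 1" for t by (simp add: g2 divide_le_eq_1 add_pos_nonneg)
  have g0: "g t \<ge> 0" if "t \<ge> 0" for t using that by (simp add: g_def)
  have g_mono: "g s \<le> g t" if "0 \<le> s" "s \<le> t" for s t
  proof (rule power2_le_imp_le)
    have "s\<^sup>2 \<le> t\<^sup>2" using that by (simp add: power_mono)
    moreover have "1 + s\<^sup>2 > 0" "1 + t\<^sup>2 > 0" by (simp_all add: add_pos_nonneg)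
    ultimately show "(g s)\<^sup>2 \<le> (g t)\<^sup>2" unfolding g2 by (simp add: field_simps)
  qed (use that g0 in auto)
  have g_sub: "g (s + t) \<le> g s + g t" if "s \<ge> 0" "t \<ge> 0" for s t
  proof -
    have "s / sqrt (1 + (s+t)\<^sup>2) \<le> g s" "t / sqrt (1 + (s+t)\<^sup>2) \<le> g t"
      unfolding g_def using that by (auto intro!: divide_left_mono mult_pos_pos add_pos_nonneg power_mono)
    then show ?thesis by (simp add: g_def add_divide_distrib)
  qed
  have N0: "N x y \<ge> 0" for x y by (simp add: N_def)
  have N2: "(N x y)\<^sup>2 = (norm (jX x - jX y))\<^sup>2 + (g (dist x y))\<^sup>2" for x y by (simp add: N_def)
  have N_tri: "N x z \<le> N x y + N y z" for x y z
  proof -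
    have "norm (jX x - jX z) \<le> norm (jX x - jX y) + norm (jX y - jX z)"
      by (metis dist_norm dist_triangle)
    moreover have "g (dist x z) \<le> g (dist x y) + g (dist y z)"
      using g_mono[of "dist x z" "dist x y + dist y z"] g_sub[of "dist x y" "dist y z"]
      by (smt (verit) dist_triangle zero_le_dist)
    ultimately have "N x z \<le> sqrt ((norm (jX x - jX y) + norm (jX y - jX z))\<^sup>2 + (g (dist x y) + g (dist y z))\<^sup>2)"
      unfolding N_def using g0 by (intro real_sqrt_le_mono add_mono power_mono) auto
    also have "\<dots> \<le> N x y + N y z"
      unfolding N_def by (rule real_sqrt_sum_squares_triangle_ineq)
    finally show ?thesis .
  qed
  have d: "conf_dist \<gamma> jX x y = sqrt (\<Sum>\<^sub>\<infinity>k. (p k * N (x k) (y k))\<^sup>2)" for x y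
    by (simp add: conf_dist_def power_mult_distrib p2 N2 g2)
  have summ: "(\<lambda>k. (p k * N (x k) (y k))\<^sup>2) summable_on UNIV" if "x \<in> conf \<gamma> jX" "y \<in> conf \<gamma> jX" for x y
  proof (rule summable_on_comparison_test)
    show "(\<lambda>k. 2 * (inverse (\<gamma> k) * (norm (jX (x k)))\<^sup>2) + 2 * (inverse (\<gamma> k) * (norm (jX (y k)))\<^sup>2)
        + inverse (\<gamma> k)) summable_on UNIV"
      using that w by (intro summable_on_add summable_on_cmult_right) (auto simp: conf_def weight_system_def)
    fix k
    have "(norm (jX (x k) - jX (y k)))\<^sup>2 \<le> (norm (jX (x k)) + norm (jX (y k)))\<^sup>2"
      by (intro power_mono norm_triangle_ineq4) auto
    also have "\<dots> \<le> 2 * (norm (jX (x k)))\<^sup>2 + 2 * (norm (jX (y k)))\<^sup>2"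
      using sum_squares_bound[of "norm (jX (x k))" "norm (jX (y k))"] by (simp add: power2_sum)
    finally have "(N (x k) (y k))\<^sup>2 \<le> 2 * (norm (jX (x k)))\<^sup>2 + 2 * (norm (jX (y k)))\<^sup>2 + 1"
      using g_le1[of "dist (x k) (y k)"] by (simp add: N2)
    from mult_left_mono[OF this, of "inverse (\<gamma> k)"]
    show "(p k * N (x k) (y k))\<^sup>2 \<le> 2 * (inverse (\<gamma> k) * (norm (jX (x k)))\<^sup>2)
        + 2 * (inverse (\<gamma> k) * (norm (jX (y k)))\<^sup>2) + inverse (\<gamma> k)"
      using \<gamma>0[of k] by (simp add: power_mult_distrib p2 algebra_simps)
  qed auto
  show ?thesis
  proof
    fix x y :: "'a \<Rightarrow> 'x"
    show "0 \<le> conf_dist \<gamma> jX x y" by (simp add: d infsum_nonneg)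
    show "conf_dist \<gamma> jX x y = conf_dist \<gamma> jX y x"
      by (simp add: conf_dist_def dist_commute norm_minus_commute)
    assume xy: "x \<in> conf \<gamma> jX" "y \<in> conf \<gamma> jX"
    show "conf_dist \<gamma> jX x y = 0 \<longleftrightarrow> x = y"
    proof
      assume "conf_dist \<gamma> jX x y = 0"
      then have "(\<Sum>\<^sub>\<infinity>k. (p k * N (x k) (y k))\<^sup>2) \<le> 0" by (simp add: d)
      then have "(p k * N (x k) (y k))\<^sup>2 = 0" for k
        by (rule nonneg_infsum_le_0D[OF _ summ[OF xy]]) auto
      then have "(N (x k) (y k))\<^sup>2 = 0" for k using p2(2)[of k] by (metis mult_eq_0_iff less_irrefl power_eq_0_iff zero_power2)
      then have "(g (dist (x k) (y k)))\<^sup>2 \<le> 0" for k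
        unfolding N2 by (smt (verit) zero_le_power2)
      then have "(dist (x k) (y k))\<^sup>2 / (1 + (dist (x k) (y k))\<^sup>2) = 0" for k
        unfolding g2 by (smt (verit) divide_nonneg_nonneg zero_le_power2)
      then have "dist (x k) (y k) = 0" for k
        by (smt (verit, ccfv_SIG) divide_eq_0_iff power2_eq_square mult_eq_0_iff zero_le_power2)
      then show "x = y" by auto
    next
      assume "x = y" then show "conf_dist \<gamma> jX x y = 0" by (simp add: conf_dist_def)
    qed
    fix z assume z: "z \<in> conf \<gamma> jX"
    let ?r = "conf_dist \<gamma> jX x y + conf_dist \<gamma> jX y z"
    have fin: "L2_set (\<lambda>k. p k * N (x k) (y k)) F \<le> conf_dist \<gamma> jX x y"
      if "finite F" "x \<in> conf \<gamma> jX" "y \<in> conf \<gamma> jX" for F x y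
      unfolding d L2_set_def
      by (intro real_sqrt_le_mono finite_sum_le_infsum summ that) auto
    have "(\<Sum>k\<in>F. (p k * N (x k) (z k))\<^sup>2) \<le> ?r\<^sup>2" if F: "finite F" for F
    proof -
      have "L2_set (\<lambda>k. p k * N (x k) (z k)) F \<le> L2_set (\<lambda>k. p k * N (x k) (y k) + p k * N (y k) (z k)) F"
        using N_tri N0 p2(2) by (intro L2_set_mono) (auto simp: distrib_left[symmetric] less_imp_le intro!: mult_left_mono)
      also have "\<dots> \<le> ?r"
        using L2_set_triangle_ineq[of "\<lambda>k. p k * N (x k) (y k)" "\<lambda>k. p k * N (y k) (z k)" F]
          fin[OF F xy] fin[OF F xy(2) z] by linarith
      finally have "(L2_set (\<lambda>k. p k * N (x k) (z k)) F)\<^sup>2 \<le> ?r\<^sup>2"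
        by (intro power_mono) (auto simp: L2_set_nonneg)
      then show ?thesis by (simp add: L2_set_def sum_nonneg)
    qed
    then have "(\<Sum>\<^sub>\<infinity>k. (p k * N (x k) (z k))\<^sup>2) \<le> ?r\<^sup>2"
      by (intro infsum_le_finite_sums summ xy z) auto
    then have "conf_dist \<gamma> jX x z \<le> sqrt (?r\<^sup>2)" unfolding d[of x z] by (rule real_sqrt_le_mono)
    also have "\<dots> = ?r" by (simp add: d infsum_nonneg)
    finally show "conf_dist \<gamma> jX x z \<le> ?r" .
  qed
qed

definition conf_top :: "('z \<Rightarrow> real) \<Rightarrow> ('x::metric_space \<Rightarrow> 'b::real_normed_vector) \<Rightarrow> ('z \<Rightarrow> 'x) topology" where
  "conf_top \<gamma> jX = Metric_space.mtopology (conf \<gamma> jX) (conf_dist \<gamma> jX)"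

definition conf_borel :: "('z \<Rightarrow> real) \<Rightarrow> ('x::metric_space \<Rightarrow> 'b::real_normed_vector) \<Rightarrow> ('z \<Rightarrow> 'x) measure" where
  "conf_borel \<gamma> jX = sigma (conf \<gamma> jX) {U. openin (conf_top \<gamma> jX) U}"

definition conf_H ::
    "('z \<Rightarrow> real) \<Rightarrow> ('x::metric_space \<Rightarrow> 'b::real_normed_vector) \<Rightarrow> ('b \<Rightarrow>\<^sub>L 'h::real_inner) \<Rightarrow>
     (nat \<Rightarrow> real) \<Rightarrow> (nat \<Rightarrow> 'x) \<Rightarrow> real \<Rightarrow> ('z \<Rightarrow> 'x) set" where
  "conf_H \<gamma> jX jB lam \<phi> \<alpha> =
     {x. (\<Sum>\<^sub>\<infinity>k. ennreal (inverse (\<gamma> k)) * Hnorm2 jX jB lam \<phi> \<alpha> (jB (jX (x k)))) < \<infinity>}"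

definition site_line :: "('x::real_vector \<Rightarrow> 'c) \<Rightarrow> 'x \<Rightarrow> 'x \<Rightarrow> real \<Rightarrow> 'c" where
  "site_line f v x = (\<lambda>t. f (x + t *\<^sub>R v))"

definition conf_line :: "(('z \<Rightarrow> 'x::real_vector) \<Rightarrow> 'c) \<Rightarrow> ('z \<Rightarrow> 'x) \<Rightarrow> ('z \<Rightarrow> 'x) \<Rightarrow> real \<Rightarrow> 'c" where
  "conf_line f h x = (\<lambda>t. f (\<lambda>j. x j + t *\<^sub>R h j))"

definition site_pd :: "('x::real_vector \<Rightarrow> 'c::real_normed_vector) \<Rightarrow> 'x \<Rightarrow> 'x \<Rightarrow> 'c" where
  "site_pd f v x = vector_derivative (site_line f v x) (at 0)"

definition conf_pd ::
    "(('z \<Rightarrow> 'x::real_vector) \<Rightarrow> 'c::real_normed_vector) \<Rightarrow> ('z \<Rightarrow> 'x) \<Rightarrow> ('z \<Rightarrow> 'x) \<Rightarrow> 'c" where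
  "conf_pd f h x = vector_derivative (conf_line f h x) (at 0)"

definition hdir :: "(nat \<Rightarrow> 'x::zero) \<Rightarrow> 'z \<Rightarrow> nat \<Rightarrow> 'z \<Rightarrow> 'x" where
  "hdir \<phi> k n = (\<lambda>j. if j = k then \<phi> n else 0)"

definition cont_loc_bdd :: "'a topology \<Rightarrow> ('a \<Rightarrow> 'c::real_normed_vector) \<Rightarrow> bool" where
  "cont_loc_bdd T f \<longleftrightarrow>
     continuous_map T euclidean f \<and>
     (\<forall>x \<in> topspace T. \<exists>U. openin T U \<and> x \<in> U \<and> bounded (f ` U))"

definition site_C1 :: "(nat \<Rightarrow> 'x) \<Rightarrow> ('x::{real_vector, metric_space} \<Rightarrow> 'c::real_normed_vector) \<Rightarrow> bool" where
  "site_C1 \<phi> f \<longleftrightarrow>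
     cont_loc_bdd euclidean f \<and>
     (\<forall>n. (\<forall>x. site_line f (\<phi> n) x differentiable (at 0)) \<and> cont_loc_bdd euclidean (site_pd f (\<phi> n)))"

text \<open>
  The map indexed by the site \<open>k\<close> is only differentiated along the \<open>h\<close>-directions of that site.
\<close>

definition conf_C1 ::
    "('z \<Rightarrow> real) \<Rightarrow> ('x::{real_vector, metric_space} \<Rightarrow> 'b::real_normed_vector) \<Rightarrow> (nat \<Rightarrow> 'x) \<Rightarrow> 'z \<Rightarrow>
     (('z \<Rightarrow> 'x) \<Rightarrow> 'c::real_normed_vector) \<Rightarrow> bool" where
  "conf_C1 \<gamma> jX \<phi> k f \<longleftrightarrow>
     cont_loc_bdd (conf_top \<gamma> jX) f \<and>
     (\<forall>n. (\<forall>x \<in> conf \<gamma> jX. conf_line f (hdir \<phi> k n) x differentiable (at 0)) \<and>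
          cont_loc_bdd (conf_top \<gamma> jX) (conf_pd f (hdir \<phi> k n)))"

definition C1b ::
    "('z \<Rightarrow> real) \<Rightarrow> ('x::{real_vector, metric_space} \<Rightarrow> 'b::real_normed_vector) \<Rightarrow> ('z \<Rightarrow> 'x) \<Rightarrow>
     (('z \<Rightarrow> 'x) \<Rightarrow> real) set" where
  "C1b \<gamma> jX h = {f.
     continuous_map (conf_top \<gamma> jX) euclidean f \<and> bounded (f ` conf \<gamma> jX) \<and>
     (\<forall>x \<in> conf \<gamma> jX. conf_line f h x differentiable (at 0)) \<and>
     continuous_map (conf_top \<gamma> jX) euclidean (conf_pd f h) \<and> bounded (conf_pd f h ` conf \<gamma> jX)}"

definition Fmap ::
    "('z \<Rightarrow> 'x \<Rightarrow> ('b::real_normed_vector \<Rightarrow>\<^sub>L real)) \<Rightarrow> ('z \<Rightarrow> ('z \<Rightarrow> 'x) \<Rightarrow> ('b \<Rightarrow>\<^sub>L real)) \<Rightarrow>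
     'z \<Rightarrow> ('z \<Rightarrow> 'x) \<Rightarrow> ('b \<Rightarrow>\<^sub>L real)" where
  "Fmap F0 G k x = F0 k (x k) + G k x"

definition log_grad ::
    "('x \<Rightarrow> 'b::real_normed_vector) \<Rightarrow> ('b \<Rightarrow>\<^sub>L 'h::real_inner) \<Rightarrow> ('h \<Rightarrow> 'h) \<Rightarrow> (nat \<Rightarrow> 'x) \<Rightarrow>
     ('z \<Rightarrow> 'x \<Rightarrow> ('b \<Rightarrow>\<^sub>L real)) \<Rightarrow> ('z \<Rightarrow> ('z \<Rightarrow> 'x) \<Rightarrow> ('b \<Rightarrow>\<^sub>L real)) \<Rightarrow>
     'z \<Rightarrow> nat \<Rightarrow> ('z \<Rightarrow> 'x) \<Rightarrow> real" where
  "log_grad jX jB A \<phi> F0 G k n x =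
     - (A (jB (jX (\<phi> n))) \<bullet> jB (jX (x k))) - Fmap F0 G k x (jX (\<phi> n))"

definition Mb ::
    "('z \<Rightarrow> real) \<Rightarrow> ('x::{real_vector, metric_space} \<Rightarrow> 'b::real_normed_vector) \<Rightarrow>
     ('b \<Rightarrow>\<^sub>L 'h::real_inner) \<Rightarrow> ('h \<Rightarrow> 'h) \<Rightarrow> (nat \<Rightarrow> 'x) \<Rightarrow>
     ('z \<Rightarrow> 'x \<Rightarrow> ('b \<Rightarrow>\<^sub>L real)) \<Rightarrow> ('z \<Rightarrow> ('z \<Rightarrow> 'x) \<Rightarrow> ('b \<Rightarrow>\<^sub>L real)) \<Rightarrow> ('z \<Rightarrow> 'x) measure set" where
  "Mb \<gamma> jX jB A \<phi> F0 G = {\<mu>.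
     prob_space \<mu> \<and> space \<mu> = conf \<gamma> jX \<and> sets \<mu> = sets (conf_borel \<gamma> jX) \<and>
     (\<forall>k n. \<forall>f \<in> C1b \<gamma> jX (hdir \<phi> k n).
        bdd_above ((\<lambda>x. \<bar>f x\<bar> * (1 + norm (h_to_dual jB (jB (jX (x k)))) + norm (Fmap F0 G k x))) ` conf \<gamma> jX) \<longrightarrow>
        (\<integral>x. conf_pd f (hdir \<phi> k n) x \<partial>\<mu>) = - (\<integral>x. f x * log_grad jX jB A \<phi> F0 G k n x \<partial>\<mu>))}"

definition Lfun :: "('x \<Rightarrow> 'b::real_normed_vector) \<Rightarrow> ('z \<Rightarrow> 'x \<Rightarrow> ('b \<Rightarrow>\<^sub>L real)) \<Rightarrow> 'z \<Rightarrow> 'x \<Rightarrow> real" where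
  "Lfun jX F0 k y = F0 k y (jX y)"

end

theory Submission
  imports Defs
begin

text \<open>
  For a positive cutoff \<open>g\<close>, integrate by parts with the test functions
  \<open>\<lambda>\<^sub>n\<^sup>-\<^sup>1 (F\<^sub>k, \<phi>\<^sub>n) g\<close> and sum over \<open>n\<close>. This gives
  \<open>\<integral> (F\<^sub>k, x\<^sub>k) g + \<Sum>\<^sub>n \<lambda>\<^sub>n\<^sup>-\<^sup>1 \<integral> (F\<^sub>k, \<phi>\<^sub>n)\<^sup>2 g\<close> on one side. On the other side, the terms
  \<open>(F\<^sub>k, \<phi>\<^sub>n) \<partial>\<^sub>n g\<close> with \<open>|\<partial>\<^sub>n g| \<le> K g\<close> are absorbed by the squares at the cost of a constant, and so
  \<open>(1 - \<K>\<^sub>1 Tr) \<integral> L\<^sub>k g \<le> (\<M>\<^sub>2 + \<M>\<^sub>1 Tr) \<integral> \<Sum>\<^sub>j J\<^sub>k\<^sub>j |x\<^sub>j|\<^sup>R g + const \<integral> g\<close>.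
  Since powers of \<open>L\<^sub>k\<close> are admissible factors of \<open>g\<close>, this controls all moments of \<open>L\<^sub>k\<close> at once:
  for an increasing \<open>\<psi> = \<Psi>'\<close>, convexity gives
  \<open>L\<^sub>j \<psi>(L\<^sub>k) \<le> L\<^sub>k \<psi>(L\<^sub>k) + \<Psi>(L\<^sub>j) - \<Psi>(L\<^sub>k)\<close>, so the interaction contributes no more than for the first
  moment, and the inequality can be iterated over the lattice with the weights \<open>\<gamma>\<^sup>-\<^sup>R\<close>.
  Finally the test functions \<open>(x\<^sub>k, \<phi>\<^sub>n)\<^sup>2\<^sup>N\<^sup>-\<^sup>1 g\<close> bound the moments of \<open>\<lambda>\<^sub>n (x\<^sub>k, \<phi>\<^sub>n)\<^sup>2\<close> uniformly in \<open>n\<close>, and Jensen's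
  inequality with the weights \<open>\<lambda>\<^sub>n\<^sup>\<alpha>\<^sup>-\<^sup>1\<close> gives those of the norm of \<open>H\<^sup>\<alpha>\<close>.
\<close>

subsection \<open>The squared norm of a smooth Banach space\<close>

text \<open>A test function must stay bounded after multiplication with |x_k| and |F_k|, while the
  moments to be estimated are not known to be finite. All estimates are therefore made under cutoffs
  whose logarithmic derivatives are bounded independently of the cutoff parameter. The constants
  then survive the removal of the cutoffs, and as they contain no datum of the measure they are
  uniform over all measures. The differentiability of the norms enters here: it makes the squared
  norms of \<open>F0 k (x k)\<close> and \<open>jX (x k)\<close> admissible ingredients of a cutoff.
  Of the three factors, \<open>gU\<close> depends on the site k and is removed first. The comparison
  of L_j with L_k needs a factor common to all sites, so it is made with \<open>gW\<close>, a
  function of the l^2 norm alone, which is kept together with the truncated power \<open>psi\<close>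
  throughout the iteration. Both have a second use: under them the sequence to be iterated grows at
  most like \<gamma>_k^R, and without such an a priori bound the linear inequality over the lattice
  would have no consequence.\<close>

lemma sqnorm_differentiable:
  fixes \<xi> :: "'a::real_normed_vector"
  assumes "\<And>x :: 'a. x \<noteq> 0 \<Longrightarrow> norm differentiable (at x)"
  shows "(\<lambda>x. (norm x)\<^sup>2) differentiable (at \<xi>)"
proof (cases "\<xi> = 0")
  case True
  \<comment> \<open>At the origin the norm itself need not be differentiable, but its square is
    o(|x|).\<close>
  have "((\<lambda>x :: 'a. (norm x)\<^sup>2) has_derivative (\<lambda>_. 0)) (at 0)"
    unfolding has_derivative_at
  proof (intro conjI)
    have "((\<lambda>y :: 'a. norm y) \<longlongrightarrow> 0) (at 0)"
      by (intro tendsto_norm_zero) (rule tendsto_ident_at)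
    then show "((\<lambda>h :: 'a. norm ((norm (0 + h))\<^sup>2 - (norm (0 :: 'a))\<^sup>2 - 0) / norm h) \<longlongrightarrow> 0) (at 0)"
      by (rule Lim_transform_eventually) (auto simp: eventually_at_filter power2_eq_square)
  qed auto
  then show ?thesis using True by (auto simp: differentiable_def)
next
  case False
  then show ?thesis using assms by (intro differentiable_power) auto
qed

definition dsq :: "'a::real_normed_vector \<Rightarrow> 'a \<Rightarrow> real" where
  "dsq \<xi> = frechet_derivative (\<lambda>x. (norm x)\<^sup>2) (at \<xi>)"

context
  assumes norm_diff: "\<And>x :: 'a::real_normed_vector. x \<noteq> 0 \<Longrightarrow> norm differentiable (at x)"
begin

lemma has_derivative_sqnorm: "((\<lambda>x. (norm x)\<^sup>2) has_derivative dsq \<xi>) (at (\<xi> :: 'a))"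
  unfolding dsq_def using sqnorm_differentiable[OF norm_diff] by (simp add: frechet_derivative_works)

lemma dsq_linear: "linear (dsq (\<xi> :: 'a))"
  using has_derivative_sqnorm has_derivative_bounded_linear bounded_linear.linear by blast

lemma vector_derivative_sqnorm:
  fixes f :: "real \<Rightarrow> 'a"
  assumes "(f has_vector_derivative v) (at s)"
  shows "((\<lambda>t. (norm (f t))\<^sup>2) has_real_derivative dsq (f s) v) (at s)"
proof -
  have "((\<lambda>t. (norm (f t))\<^sup>2) has_derivative (\<lambda>t. dsq (f s) (t *\<^sub>R v))) (at s)"
    using has_derivative_compose[OF assms[unfolded has_vector_derivative_def] has_derivative_sqnorm] .
  then show ?thesis
    by (simp add: has_field_derivative_def linear_cmul[OF dsq_linear] mult_commute_abs)
qed

text \<open>The squared norm is convex, so it lies above its tangents. Convexity is taken from the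
  triangle inequality: a steeper derivative would push the function above its chord near
  \<open>s = 0\<close>.\<close>

lemma dsq_le_diff: "dsq \<xi> (v :: 'a) \<le> (norm (\<xi> + v))\<^sup>2 - (norm \<xi>)\<^sup>2"
proof (rule ccontr)
  assume *: "\<not> ?thesis"
  let ?h = "\<lambda>s :: real. (norm \<xi>)\<^sup>2 + s * ((norm (\<xi> + v))\<^sup>2 - (norm \<xi>)\<^sup>2) - (norm (\<xi> + s *\<^sub>R v))\<^sup>2"
  have "((\<lambda>s :: real. \<xi> + s *\<^sub>R v) has_vector_derivative v) (at 0)"
    by (auto intro!: derivative_eq_intros)
  from vector_derivative_sqnorm[OF this]
  have "((\<lambda>s. (norm (\<xi> + s *\<^sub>R v))\<^sup>2) has_real_derivative dsq \<xi> v) (at 0)" by simp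
  moreover have "((\<lambda>s :: real. (norm \<xi>)\<^sup>2 + s * ((norm (\<xi> + v))\<^sup>2 - (norm \<xi>)\<^sup>2)) has_real_derivative
      (norm (\<xi> + v))\<^sup>2 - (norm \<xi>)\<^sup>2) (at 0)"
    by (auto intro!: derivative_eq_intros)
  ultimately have "(?h has_real_derivative ((norm (\<xi> + v))\<^sup>2 - (norm \<xi>)\<^sup>2 - dsq \<xi> v)) (at 0)"
    by (intro DERIV_diff)
  from DERIV_neg_dec_right[OF this] * obtain d where d: "d > 0" "\<And>s. s > 0 \<Longrightarrow> s < d \<Longrightarrow> ?h (0 + s) < ?h 0"
    by (auto simp: not_le)
  define s where "s = min (d / 2) 1"
  have s: "s > 0" "s < d" "s \<le> 1" using d(1) by (auto simp: s_def)
  have "norm (\<xi> + s *\<^sub>R v) = norm ((1 - s) *\<^sub>R \<xi> + s *\<^sub>R (\<xi> + v))" by (simp add: algebra_simps)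
  also have "\<dots> \<le> norm ((1 - s) *\<^sub>R \<xi>) + norm (s *\<^sub>R (\<xi> + v))" by (rule norm_triangle_ineq)
  also have "\<dots> = (1 - s) * norm \<xi> + s * norm (\<xi> + v)" using s by simp
  finally have "(norm (\<xi> + s *\<^sub>R v))\<^sup>2 \<le> ((1 - s) * norm \<xi> + s * norm (\<xi> + v))\<^sup>2"
    by (intro power_mono) auto
  also have "\<dots> = (1 - s) * (norm \<xi>)\<^sup>2 + s * (norm (\<xi> + v))\<^sup>2 - s * (1 - s) * (norm \<xi> - norm (\<xi> + v))\<^sup>2"
    by (simp add: power2_eq_square algebra_simps)
  also have "\<dots> \<le> (1 - s) * (norm \<xi>)\<^sup>2 + s * (norm (\<xi> + v))\<^sup>2" using s by simp
  finally have "?h (0 + s) \<ge> ?h 0" by (simp add: algebra_simps)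
  with d(2)[OF s(1,2)] show False by simp
qed

lemma dsq_le_quotient:
  assumes "t > 0"
  shows "dsq \<xi> (v :: 'a) \<le> ((norm (\<xi> + t *\<^sub>R v))\<^sup>2 - (norm \<xi>)\<^sup>2) / t"
  using dsq_le_diff[of \<xi> "t *\<^sub>R v"] assms
  by (simp add: linear_cmul[OF dsq_linear] field_simps)

text \<open>The quotient with step \<open>t\<close> is at most
  \<open>2 * norm \<xi> * norm v\<close> plus \<open>t\<close> times the square of
  \<open>norm v\<close>. Small \<open>t\<close> gives the upper bound, and \<open>- v\<close> in
  place of \<open>v\<close> the lower one.\<close>

lemma dsq_bound: "\<bar>dsq \<xi> (v :: 'a)\<bar> \<le> 2 * norm \<xi> * norm v"
proof -
  have *: "dsq \<xi> v \<le> 2 * norm \<xi> * norm v" for v :: 'a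
  proof (rule field_le_epsilon)
    fix e :: real assume "e > 0"
    define t where "t = e / (1 + (norm v)\<^sup>2)"
    have pos: "1 + (norm v)\<^sup>2 > 0" by (simp add: add_pos_nonneg)
    have t: "t > 0" using \<open>e > 0\<close> pos by (simp add: t_def)
    have "(norm (\<xi> + t *\<^sub>R v))\<^sup>2 \<le> (norm \<xi> + t * norm v)\<^sup>2"
      using t norm_triangle_ineq[of \<xi> "t *\<^sub>R v"] by (intro power_mono) auto
    also have "\<dots> = (norm \<xi>)\<^sup>2 + t * (2 * norm \<xi> * norm v + t * (norm v)\<^sup>2)"
      by (simp add: power2_eq_square algebra_simps)
    finally have "((norm (\<xi> + t *\<^sub>R v))\<^sup>2 - (norm \<xi>)\<^sup>2) / t \<le> 2 * norm \<xi> * norm v + t * (norm v)\<^sup>2"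
      using t by (simp add: field_simps)
    moreover have "t * (norm v)\<^sup>2 \<le> e"
      using pos \<open>e > 0\<close> by (simp add: t_def field_simps)
    ultimately show "dsq \<xi> v \<le> 2 * norm \<xi> * norm v + e" using dsq_le_quotient[OF t, of \<xi> v] by linarith
  qed
  show ?thesis using *[of v] *[of "- v"] by (simp add: linear_neg[OF dsq_linear] abs_le_iff)
qed

text \<open>The difference quotients of a convex function decrease to its directional derivatives, which
  are therefore upper semicontinuous, and by linearity continuous.\<close>

lemma tendsto_dsq:
  fixes f v :: "'c \<Rightarrow> 'a"
  assumes f: "(f \<longlongrightarrow> \<xi>) F" and v: "(v \<longlongrightarrow> w) F"
  shows "((\<lambda>y. dsq (f y) (v y)) \<longlongrightarrow> dsq \<xi> w) F"
proof -
  have upper: "\<forall>\<^sub>F y in F. dsq (f y) (v y) < a" if "dsq \<xi> w < a" "(v \<longlongrightarrow> w) F" for a v w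
  proof -
    have "((\<lambda>s :: real. \<xi> + s *\<^sub>R w) has_vector_derivative w) (at 0)"
      by (auto intro!: derivative_eq_intros)
    from vector_derivative_sqnorm[OF this]
    have "((\<lambda>s. ((norm (\<xi> + s *\<^sub>R w))\<^sup>2 - (norm \<xi>)\<^sup>2) / s) \<longlongrightarrow> dsq \<xi> w) (at 0)"
      by (simp add: has_field_derivative_iff)
    then have "((\<lambda>s. ((norm (\<xi> + s *\<^sub>R w))\<^sup>2 - (norm \<xi>)\<^sup>2) / s) \<longlongrightarrow> dsq \<xi> w) (at_right 0)"
      by (rule filterlim_mono) (auto simp: at_le)
    then have "\<forall>\<^sub>F s in at_right 0. ((norm (\<xi> + s *\<^sub>R w))\<^sup>2 - (norm \<xi>)\<^sup>2) / s < a"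
      using that(1) by (rule order_tendstoD)
    moreover have "\<forall>\<^sub>F s :: real in at_right 0. s > 0" by (rule eventually_at_right_less)
    ultimately obtain s :: real where s: "s > 0" "((norm (\<xi> + s *\<^sub>R w))\<^sup>2 - (norm \<xi>)\<^sup>2) / s < a"
      using eventually_happens[OF eventually_conj] by (metis (mono_tags, lifting) trivial_limit_at_right_real)
    have "((\<lambda>y. ((norm (f y + s *\<^sub>R v y))\<^sup>2 - (norm (f y))\<^sup>2) / s) \<longlongrightarrow>
        ((norm (\<xi> + s *\<^sub>R w))\<^sup>2 - (norm \<xi>)\<^sup>2) / s) F"
      using s(1) by (intro tendsto_intros f that(2)) auto
    then have "\<forall>\<^sub>F y in F. ((norm (f y + s *\<^sub>R v y))\<^sup>2 - (norm (f y))\<^sup>2) / s < a"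
      using s(2) by (rule order_tendstoD)
    then show ?thesis
      by eventually_elim (use dsq_le_quotient[OF s(1)] in \<open>auto intro: le_less_trans\<close>)
  qed
  show ?thesis
  proof (rule order_tendstoI)
    fix a assume "dsq \<xi> w < a" then show "\<forall>\<^sub>F y in F. dsq (f y) (v y) < a" using upper v by blast
  next
    fix a assume "a < dsq \<xi> w"
    then have "dsq \<xi> (- w) < - a" by (simp add: linear_neg[OF dsq_linear])
    from upper[OF this tendsto_minus[OF v]]
    show "\<forall>\<^sub>F y in F. a < dsq (f y) (v y)" by (simp add: linear_neg[OF dsq_linear])
  qed
qed

end

subsection \<open>Integrals and power inequalities\<close>

text \<open>Lattice sums are \<open>infsum\<close> over an unordered index set; as integrals over
  the counting measure they become accessible to Tonelli and Jensen.\<close>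

lemma nn_integral_count_space_infsum:
  fixes f :: "'a \<Rightarrow> ennreal"
  shows "(\<integral>\<^sup>+ x. f x \<partial>count_space UNIV) = infsum f UNIV"
proof -
  have "(\<integral>\<^sup>+ x. f x \<partial>count_space UNIV) = (SUP F \<in> {F. finite F \<and> F \<subseteq> UNIV}. sum f F)"
  proof (rule antisym)
    show "(SUP F \<in> {F. finite F \<and> F \<subseteq> UNIV}. sum f F) \<le> (\<integral>\<^sup>+ x. f x \<partial>count_space UNIV)"
    proof (rule SUP_least)
      fix F assume "F \<in> {F :: 'a set. finite F \<and> F \<subseteq> UNIV}"
      then have F: "finite F" by simp
      have "sum f F = (\<integral>\<^sup>+ x. f x * indicator F x \<partial>count_space UNIV)"
        using F by (subst nn_integral_count_space'[of F]) auto
      also have "\<dots> \<le> (\<integral>\<^sup>+ x. f x \<partial>count_space UNIV)"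
        by (intro nn_integral_mono) (auto simp: indicator_def)
      finally show "sum f F \<le> (\<integral>\<^sup>+ x. f x \<partial>count_space UNIV)" .
    qed
    show "(\<integral>\<^sup>+ x. f x \<partial>count_space UNIV) \<le> (SUP F \<in> {F. finite F \<and> F \<subseteq> UNIV}. sum f F)"
      unfolding nn_integral_def_finite
    proof (rule SUP_least)
      fix g assume g: "g \<in> {g. simple_function (count_space UNIV) g \<and> g \<le> f \<and> (\<forall>x. g x < \<top>)}"
      show "integral\<^sup>S (count_space UNIV) g \<le> (SUP F \<in> {F. finite F \<and> F \<subseteq> UNIV}. sum f F)"
      proof (cases "finite {x. g x \<noteq> 0}")
        case True
        have "integral\<^sup>S (count_space UNIV) g = (\<integral>\<^sup>+ x. g x \<partial>count_space UNIV)"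
          using g by (intro nn_integral_eq_simple_integral[symmetric]) auto
        also have "\<dots> = sum g {x. g x \<noteq> 0}"
          using True by (intro nn_integral_count_space') auto
        also have "\<dots> \<le> sum f {x. g x \<noteq> 0}" using g by (intro sum_mono) (auto simp: le_fun_def)
        also have "\<dots> \<le> (SUP F \<in> {F. finite F \<and> F \<subseteq> UNIV}. sum f F)"
          using True by (intro SUP_upper) auto
        finally show ?thesis .
      next
        case False
        \<comment> \<open>A simple function has finitely many values, so an infinite support puts
          infinitely many points on one level \<open>c > 0\<close>, and the finite sums are
          unbounded.\<close>
        have fin: "finite (range g)" using g by (auto simp: simple_function_def)
        have "{x. g x \<noteq> 0} = (\<Union>c \<in> range g - {0}. g -` {c})" by auto
        with False fin obtain c where c: "c \<noteq> 0" "infinite (g -` {c})" by auto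
        have fc: "f x \<ge> c" if "x \<in> g -` {c}" for x using that g by (auto simp: le_fun_def)
        have "(SUP F \<in> {F. finite F \<and> F \<subseteq> UNIV}. sum f F) = \<top>"
        proof (rule ccontr)
          assume "(SUP F \<in> {F. finite F \<and> F \<subseteq> UNIV}. sum f F) \<noteq> \<top>"
          moreover have "of_nat n * c \<le> (SUP F \<in> {F. finite F \<and> F \<subseteq> UNIV}. sum f F)" for n
          proof -
            obtain F where F: "F \<subseteq> g -` {c}" "finite F" "card F = n"
              using infinite_arbitrarily_large[OF c(2)] by metis
            have "of_nat n * c = (\<Sum>x\<in>F. c)" using F by simp
            also have "\<dots> \<le> sum f F" using F fc by (intro sum_mono) auto
            also have "\<dots> \<le> (SUP F \<in> {F. finite F \<and> F \<subseteq> UNIV}. sum f F)" using F by (intro SUP_upper) auto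
            finally show ?thesis .
          qed
          then have "(SUP n. of_nat n * c) \<le> (SUP F \<in> {F. finite F \<and> F \<subseteq> UNIV}. sum f F)"
            by (intro SUP_least) auto
          moreover have "(SUP n. of_nat n * c) = \<top>"
            using c(1) by (simp add: SUP_mult_right_ennreal[symmetric] ennreal_SUP_of_nat_eq_top ennreal_top_mult)
          ultimately show False by (metis top.extremum_uniqueI)
        qed
        then show ?thesis by (metis top_greatest)
      qed
    qed
  qed
  also have "\<dots> = infsum f UNIV" by (rule nonneg_infsum_complete[symmetric]) auto
  finally show ?thesis .
qed

text \<open>Jensen's inequality, by integrating the tangent inequality
  \<open>f\<^sup>N + (N - 1) m\<^sup>N \<ge> N m\<^sup>N\<^sup>-\<^sup>1 f\<close>.\<close>

lemma tangent_power_ineq: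
  fixes x m :: real
  assumes "x \<ge> 0" "m \<ge> 0"
  shows "real (Suc n) * m ^ n * x \<le> x ^ Suc n + real n * m ^ Suc n"
proof (induction n)
  case 0 then show ?case by simp
next
  case (Suc n)
  \<comment> \<open>Rearrangement: the induction hypothesis times \<open>m\<close> leaves the mixed
    product \<open>x ^ Suc n * m\<close>, which this inequality trades for pure powers.\<close>
  have "(x ^ Suc n - m ^ Suc n) * (x - m) \<ge> 0"
  proof (cases "x \<ge> m")
    case True then show ?thesis using assms power_mono[of m x "Suc n"] by (intro mult_nonneg_nonneg) auto
  next
    case False then show ?thesis using assms power_mono[of x m "Suc n"] by (intro mult_nonpos_nonpos) auto
  qed
  then have "x ^ Suc n * m + m ^ Suc n * x \<le> x ^ Suc (Suc n) + m ^ Suc (Suc n)"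
    by (simp add: algebra_simps)
  moreover have "real (Suc n) * m ^ n * x * m \<le> (x ^ Suc n + real n * m ^ Suc n) * m"
    using Suc assms by (intro mult_right_mono) auto
  ultimately show ?case by (simp add: algebra_simps)
qed

lemma tangent_power_ineq_ennreal:
  fixes x :: ennreal and m :: real
  assumes "m \<ge> 0"
  shows "ennreal (real (Suc n) * m ^ n) * x \<le> x ^ Suc n + ennreal (real n * m ^ Suc n)"
proof (cases "x = \<top>")
  case True
  moreover have "(\<top> :: ennreal) ^ Suc n = \<top>" by (induction n) auto
  ultimately show ?thesis by (simp del: power_Suc)
next
  case False
  then obtain y where y: "x = ennreal y" "y \<ge> 0" by (cases x) auto
  show ?thesis using tangent_power_ineq[OF y(2) assms, of n] y assms
    by (simp add: ennreal_power ennreal_mult[symmetric] ennreal_plus[symmetric] ennreal_leI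
        del: ennreal_plus power_Suc)
qed

lemma nn_integral_power_le:
  assumes [measurable]: "f \<in> borel_measurable M" and M: "emeasure M (space M) \<le> ennreal a" and a: "a > 0"
  shows "(\<integral>\<^sup>+ x. f x \<partial>M) ^ Suc n \<le> ennreal (a ^ n) * (\<integral>\<^sup>+ x. f x ^ Suc n \<partial>M)"
proof -
  have *: "ennreal (real (Suc n) * m ^ n) * (\<integral>\<^sup>+ x. f x \<partial>M)
      \<le> (\<integral>\<^sup>+ x. f x ^ Suc n \<partial>M) + ennreal (real n * m ^ Suc n * a)" if "m \<ge> 0" for m
  proof -
    have "ennreal (real (Suc n) * m ^ n) * (\<integral>\<^sup>+ x. f x \<partial>M)
        = (\<integral>\<^sup>+ x. ennreal (real (Suc n) * m ^ n) * f x \<partial>M)"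
      by (simp add: nn_integral_cmult)
    also have "\<dots> \<le> (\<integral>\<^sup>+ x. f x ^ Suc n + ennreal (real n * m ^ Suc n) \<partial>M)"
      by (intro nn_integral_mono tangent_power_ineq_ennreal that)
    also have "\<dots> = (\<integral>\<^sup>+ x. f x ^ Suc n \<partial>M) + ennreal (real n * m ^ Suc n) * emeasure M (space M)"
      by (simp add: nn_integral_add)
    also have "\<dots> \<le> (\<integral>\<^sup>+ x. f x ^ Suc n \<partial>M) + ennreal (real n * m ^ Suc n) * ennreal a"
      by (intro add_mono order_refl mult_left_mono M) auto
    finally show ?thesis using that a by (simp add: ennreal_mult'[symmetric])
  qed
  show ?thesis
  proof (cases "(\<integral>\<^sup>+ x. f x ^ Suc n \<partial>M) = \<top>")
    case True
    then show ?thesis using a by (simp add: ennreal_mult_top)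
  next
    case False
    then obtain r where r: "(\<integral>\<^sup>+ x. f x ^ Suc n \<partial>M) = ennreal r" "r \<ge> 0" by (cases "(\<integral>\<^sup>+ x. f x ^ Suc n \<partial>M)") auto
    have "(\<integral>\<^sup>+ x. f x \<partial>M) \<noteq> \<top>"
      using *[of 1] r a by (auto simp: ennreal_mult_top ennreal_plus[symmetric] top_unique
          simp del: ennreal_plus)
    then obtain s where s: "(\<integral>\<^sup>+ x. f x \<partial>M) = ennreal s" "s \<ge> 0" by (cases "(\<integral>\<^sup>+ x. f x \<partial>M)") auto
    \<comment> \<open>The mean of \<open>f\<close> with respect to the mass bound \<open>a\<close>
      is the tangent point at which the inequality is sharpest.\<close>
    define m where "m = s / a"
    have m: "m \<ge> 0" "s = m * a" using s a by (auto simp: m_def)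
    have "real (Suc n) * m ^ n * s \<le> r + real n * m ^ Suc n * a"
      using *[OF m(1)] r s m(1) a
      by (simp add: ennreal_mult[symmetric] ennreal_plus[symmetric] del: ennreal_plus of_nat_Suc power_Suc)
    then have "m ^ Suc n * a \<le> r" by (simp add: m algebra_simps)
    then have "m ^ Suc n * a * a ^ n \<le> r * a ^ n" using a by (intro mult_right_mono) auto
    then have "s ^ Suc n \<le> a ^ n * r" by (simp add: m(2) power_mult_distrib algebra_simps)
    then show ?thesis using r s a by (simp add: ennreal_power ennreal_mult[symmetric] ennreal_leI del: power_Suc)
  qed
qed

lemma nn_integral_count_space_power_le:
  fixes w f :: "'i \<Rightarrow> ennreal"
  assumes M: "(\<integral>\<^sup>+ i. w i \<partial>count_space UNIV) \<le> ennreal a" and a: "a > 0"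
  shows "(\<integral>\<^sup>+ i. w i * f i \<partial>count_space UNIV) ^ Suc n
    \<le> ennreal (a ^ n) * (\<integral>\<^sup>+ i. w i * f i ^ Suc n \<partial>count_space UNIV)"
  using nn_integral_power_le[of f "density (count_space UNIV) w" a n] M a
  by (simp add: nn_integral_density emeasure_density del: power_Suc)

lemma ennreal_infsum_count_space:
  fixes f :: "'a \<Rightarrow> real"
  assumes "f summable_on UNIV" "\<And>x. f x \<ge> 0"
  shows "(\<integral>\<^sup>+ x. ennreal (f x) \<partial>count_space UNIV) = ennreal (infsum f UNIV)"
  using assms infsum_nonneg_is_SUPREMUM_ennreal[of f UNIV]
  by (simp add: nn_integral_count_space_infsum nonneg_infsum_complete)

lemma summable_on_of_nn_integral:
  fixes f :: "'a \<Rightarrow> real"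
  assumes "(\<integral>\<^sup>+ x. ennreal (f x) \<partial>count_space UNIV) \<le> ennreal c" "\<And>x. f x \<ge> 0" "c \<ge> 0"
  shows "f summable_on UNIV" and "infsum f UNIV \<le> c"
proof -
  have "sum f F \<le> c" if "finite F" for F
  proof -
    have "ennreal (sum f F) = (\<Sum>x\<in>F. ennreal (f x))" using assms by (simp add: sum_ennreal)
    also have "\<dots> \<le> (SUP F \<in> {F. finite F \<and> F \<subseteq> UNIV}. \<Sum>x\<in>F. ennreal (f x))"
      using that by (intro SUP_upper) auto
    also have "\<dots> = (\<integral>\<^sup>+ x. ennreal (f x) \<partial>count_space UNIV)"
      by (simp add: nn_integral_count_space_infsum nonneg_infsum_complete)
    also have "\<dots> \<le> ennreal c" by (rule assms)
    finally show ?thesis using assms by simp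
  qed
  then show s: "f summable_on UNIV" using assms(2)
    by (intro nonneg_bdd_above_summable_on) (auto intro!: bdd_aboveI[of _ c])
  from this \<open>\<And>F. finite F \<Longrightarrow> sum f F \<le> c\<close> show "infsum f UNIV \<le> c" by (rule infsum_le_finite_sums)
qed

lemma borel_measurable_nn_integral_count_space:
  fixes f :: "'i::countable \<Rightarrow> 'a \<Rightarrow> ennreal"
  assumes [measurable]: "\<And>i. f i \<in> borel_measurable M"
  shows "(\<lambda>x. \<integral>\<^sup>+ i. f i x \<partial>count_space UNIV) \<in> borel_measurable M"
proof -
  have "(\<lambda>x. SUP F \<in> {F :: 'i set. finite F \<and> F \<subseteq> UNIV}. \<Sum>i\<in>F. f i x) \<in> borel_measurable M"
    by (intro borel_measurable_SUP) (auto simp: countable_Collect_finite)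
  then show ?thesis by (simp add: nn_integral_count_space_infsum nonneg_infsum_complete)
qed

text \<open>Jensen in the index, then Tonelli. It is applied with the weights \<open>J k j\<close>
  to the moments of \<open>S\<close>, and with the weights \<open>lam n powr (\<alpha> - 1)\<close>
  to the norm of H^\<alpha>.\<close>

lemma nn_integral_weighted_power_le:
  fixes w :: "'i::countable \<Rightarrow> ennreal" and f :: "'i \<Rightarrow> 'a \<Rightarrow> ennreal"
  assumes [measurable]: "\<And>i. f i \<in> borel_measurable M"
    and w: "(\<integral>\<^sup>+ i. w i \<partial>count_space UNIV) \<le> ennreal a" "a > 0"
    and B: "\<And>i. (\<integral>\<^sup>+ x. f i x ^ Suc n \<partial>M) \<le> B"
  shows "(\<integral>\<^sup>+ x. (\<integral>\<^sup>+ i. w i * f i x \<partial>count_space UNIV) ^ Suc n \<partial>M) \<le> ennreal (a ^ Suc n) * B"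
proof -
  have "(\<integral>\<^sup>+ x. (\<integral>\<^sup>+ i. w i * f i x \<partial>count_space UNIV) ^ Suc n \<partial>M)
      \<le> (\<integral>\<^sup>+ x. ennreal (a ^ n) * (\<integral>\<^sup>+ i. w i * f i x ^ Suc n \<partial>count_space UNIV) \<partial>M)"
    by (intro nn_integral_mono nn_integral_count_space_power_le w)
  also have "\<dots> = ennreal (a ^ n) * (\<integral>\<^sup>+ x. (\<integral>\<^sup>+ i. w i * f i x ^ Suc n \<partial>count_space UNIV) \<partial>M)"
    by (intro nn_integral_cmult borel_measurable_nn_integral_count_space) measurable
  also have "\<dots> = ennreal (a ^ n) * (\<integral>\<^sup>+ i. (\<integral>\<^sup>+ x. w i * f i x ^ Suc n \<partial>M) \<partial>count_space UNIV)"
    by (subst nn_integral_count_space_nn_integral) auto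
  also have "\<dots> = ennreal (a ^ n) * (\<integral>\<^sup>+ i. w i * (\<integral>\<^sup>+ x. f i x ^ Suc n \<partial>M) \<partial>count_space UNIV)"
    by (subst nn_integral_cmult) auto
  also have "\<dots> \<le> ennreal (a ^ n) * (\<integral>\<^sup>+ i. w i * B \<partial>count_space UNIV)"
    by (intro mult_left_mono nn_integral_mono B) auto
  also have "\<dots> \<le> ennreal (a ^ n) * (ennreal a * B)"
    using w(1) by (subst nn_integral_multc) (auto intro!: mult_left_mono mult_right_mono)
  also have "\<dots> = ennreal (a ^ Suc n) * B"
    using w(2) by (simp add: ennreal_mult' mult_ac)
  finally show ?thesis .
qed

text \<open>Fatou's lemma in the form in which it removes cutoffs: a bound uniform along the
  approximating sequence passes to the limit.\<close>

lemma nn_integral_le_of_tendsto: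
  fixes u :: "'a \<Rightarrow> ennreal"
  assumes "\<And>n :: nat. f n \<in> borel_measurable M"
    and "\<And>x. x \<in> space M \<Longrightarrow> (\<lambda>n. f n x) \<longlonglongrightarrow> u x"
    and "\<And>n. (\<integral>\<^sup>+ x. f n x \<partial>M) \<le> B"
  shows "(\<integral>\<^sup>+ x. u x \<partial>M) \<le> B"
proof -
  have "(\<integral>\<^sup>+ x. u x \<partial>M) = (\<integral>\<^sup>+ x. liminf (\<lambda>n. f n x) \<partial>M)"
    by (intro nn_integral_cong lim_imp_Liminf[symmetric] assms) auto
  also have "\<dots> \<le> liminf (\<lambda>n. \<integral>\<^sup>+ x. f n x \<partial>M)" using assms(1) by (rule nn_integral_liminf)
  also have "\<dots> \<le> limsup (\<lambda>n. \<integral>\<^sup>+ x. f n x \<partial>M)" by (rule Liminf_le_Limsup) simp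
  also have "\<dots> \<le> B" using assms(3) by (intro Limsup_bounded) auto
  finally show ?thesis .
qed

section \<open>Elementary inequalities between powers\<close>

lemma sum5_sq_le:
  fixes a b c d e :: real
  shows "(a + b + c + d + e)\<^sup>2 \<le> 5 * (a\<^sup>2 + b\<^sup>2 + c\<^sup>2 + d\<^sup>2 + e\<^sup>2)"
proof -
  have "0 \<le> (a-b)\<^sup>2 + (a-c)\<^sup>2 + (a-d)\<^sup>2 + (a-e)\<^sup>2 + (b-c)\<^sup>2 + (b-d)\<^sup>2 + (b-e)\<^sup>2 + (c-d)\<^sup>2 + (c-e)\<^sup>2 + (d-e)\<^sup>2"
    by simp
  then show ?thesis by (simp add: power2_eq_square algebra_simps)
qed

lemma sum3_power_le:
  fixes a b c :: real
  assumes "0 \<le> a" "0 \<le> b" "0 \<le> c"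
  shows "(a + b + c) ^ n \<le> 3 ^ n * (a ^ n + b ^ n + c ^ n)"
proof -
  define m where "m = max a (max b c)"
  have "(a + b + c) ^ n \<le> (3 * m) ^ n" using assms by (intro power_mono) (auto simp: m_def)
  moreover have "m ^ n \<le> a ^ n + b ^ n + c ^ n" using assms by (auto simp: m_def max_def)
  ultimately show ?thesis by (simp add: power_mult_distrib mult_left_mono order_trans)
qed

text \<open>Half of the highest power absorbs the two lower ones. With \<open>v = max u 1\<close>
  the left side is at most \<open>h * v ^ Suc (2 * n)\<close>; either \<open>u > 2 * h\<close>, and
  then \<open>h\<close> is below \<open>u / 2\<close>, or everything is bounded by a power of
  \<open>2 * h\<close>.\<close>

lemma young_power:
  fixes u a b h :: real
  assumes "0 \<le> u" "0 \<le> a" "0 \<le> b" "a + b \<le> h" "1 \<le> h"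
  shows "a * u ^ (2 * n) + b * u ^ Suc (2 * n) \<le> u ^ (2 * Suc n) / 2 + (2 * h) ^ (2 * Suc n)"
proof -
  define v where "v = max u 1"
  have v: "1 \<le> v" "u \<le> v" "0 \<le> v" by (auto simp: v_def)
  have "u ^ (2 * n) \<le> v ^ (2 * n)" using assms v by (intro power_mono) auto
  also have "\<dots> \<le> v ^ Suc (2 * n)" using v by (intro power_increasing) auto
  finally have 1: "u ^ (2 * n) \<le> v ^ Suc (2 * n)" .
  have 2: "u ^ Suc (2 * n) \<le> v ^ Suc (2 * n)" using assms v by (intro power_mono) auto
  have "a * u ^ (2 * n) + b * u ^ Suc (2 * n) \<le> a * v ^ Suc (2 * n) + b * v ^ Suc (2 * n)"
    using 1 2 assms by (intro add_mono mult_left_mono)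
  also have "\<dots> = (a + b) * v ^ Suc (2 * n)" by (simp add: algebra_simps)
  also have "\<dots> \<le> h * v ^ Suc (2 * n)" using assms v by (intro mult_right_mono) auto
  finally have *: "a * u ^ (2 * n) + b * u ^ Suc (2 * n) \<le> h * v ^ Suc (2 * n)" .
  show ?thesis
  proof (cases "u \<le> 2 * h")
    case True
    then have "v \<le> 2 * h" using assms by (simp add: v_def)
    then have "h * v ^ Suc (2 * n) \<le> (2 * h) * (2 * h) ^ Suc (2 * n)"
      using assms v by (intro mult_mono power_mono) auto
    moreover have "0 \<le> u ^ (2 * Suc n)" using assms by simp
    ultimately show ?thesis using * by simp
  next
    case False
    then have vu: "v = u" using assms by (simp add: v_def)
    have "h * u ^ Suc (2 * n) \<le> (u / 2) * u ^ Suc (2 * n)"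
      using False assms by (intro mult_right_mono) auto
    moreover have "0 \<le> (2 * h) ^ (2 * Suc n)" using assms by simp
    moreover have "u ^ (2 * Suc n) = u * u ^ Suc (2 * n)" by simp
    ultimately show ?thesis using *[unfolded vu] by linarith
  qed
qed

text \<open>Passes from the real exponent of the theorem to the integer exponents of the moment
  estimates; the summand 1 accounts for values of \<open>x\<close> below 1.\<close>

lemma ennreal_powr_le:
  assumes "0 \<le> p" "p \<le> real (Suc n)"
  shows "ennreal_powr x p \<le> 1 + x ^ Suc n"
proof (cases "x = \<top>")
  case True
  moreover have "(\<top> :: ennreal) ^ Suc n = \<top>" by (induction n) auto
  ultimately show ?thesis by (simp del: power_Suc)
next
  case False
  then obtain y where y: "x = ennreal y" "y \<ge> 0" by (cases x) auto
  have "y powr p \<le> 1 + y ^ Suc n"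
  proof (cases "y \<le> 1")
    case True
    then have "y powr p \<le> 1" using y assms by (simp add: powr_le1)
    moreover have "0 \<le> y ^ Suc n" using y by simp
    ultimately show ?thesis by linarith
  next
    case False
    then have "y powr p \<le> y powr real (Suc n)" using assms by (intro powr_mono) auto
    also have "\<dots> = y ^ Suc n" using False by (intro powr_realpow) auto
    finally show ?thesis by simp
  qed
  then have "ennreal (y powr p) \<le> ennreal (1 + y ^ Suc n)" by (rule ennreal_leI)
  then show ?thesis using y by (simp add: ennreal_powr_def ennreal_power ennreal_plus[symmetric] del: power_Suc ennreal_plus flip: ennreal_1)
qed

subsection \<open>Truncated powers\<close>

text \<open>A bounded substitute for \<open>s ^ q\<close> that tends to it as \<open>e\<close>
  decreases to 0. Truncating inside the power keeps the function increasing in \<open>s\<close>,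
  hence its primitive convex; multiplication by a cutoff decaying in \<open>s\<close> could destroy
  this.\<close>

definition psi :: "nat \<Rightarrow> real \<Rightarrow> real \<Rightarrow> real" where "psi q e s = (s / (1 + e * s)) ^ q"

lemma psi_nonneg: "s \<ge> 0 \<Longrightarrow> e > 0 \<Longrightarrow> psi q e s \<ge> 0" by (simp add: psi_def)

lemma psi_le: "s \<ge> 0 \<Longrightarrow> e > 0 \<Longrightarrow> psi q e s \<le> inverse e ^ q"
proof -
  assume s: "s \<ge> 0" and e: "e > 0"
  then have p: "1 + e * s > 0" by (intro add_pos_nonneg) auto
  have "inverse e * (1 + e * s) = inverse e + s" using e by (simp add: field_simps)
  moreover have "inverse e > 0" using e by simp
  ultimately have "s \<le> inverse e * (1 + e * s)" by linarith
  then have "s / (1 + e * s) \<le> inverse e" using p by (simp add: pos_divide_le_eq)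
  then show ?thesis unfolding psi_def using s p by (intro power_mono) auto
qed

lemma psi_mono: "0 \<le> s \<Longrightarrow> s \<le> t \<Longrightarrow> e > 0 \<Longrightarrow> psi q e s \<le> psi q e t"
proof -
  assume *: "0 \<le> s" "s \<le> t" "e > 0"
  then have p: "1 + e * s > 0" "1 + e * t > 0" by (auto intro!: add_pos_nonneg)
  have "s / (1 + e * s) \<le> t / (1 + e * t)" using p * by (simp add: divide_simps algebra_simps)
  then show ?thesis unfolding psi_def using * p by (intro power_mono) auto
qed

lemma psi_le_power: "0 \<le> s \<Longrightarrow> e > 0 \<Longrightarrow> psi q e s \<le> s ^ q"
proof -
  assume *: "0 \<le> s" "e > 0"
  then have "1 \<le> 1 + e * s" by simp
  moreover from this have "0 < 1 + e * s" by linarith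
  ultimately have "s / (1 + e * s) \<le> s / 1" using * by (intro divide_left_mono) auto
  then show ?thesis unfolding psi_def using * \<open>1 \<le> 1 + e * s\<close> by (intro power_mono) auto
qed

lemma psi_integrable: "e > 0 \<Longrightarrow> 0 \<le> a \<Longrightarrow> psi q e integrable_on {a..b}"
proof (rule integrable_continuous_real)
  assume e: "e > 0" "0 \<le> a"
  have "1 + e * s \<noteq> 0" if "s \<in> {a..b}" for s
  proof -
    have "1 + e * s > 0" using that e by (intro add_pos_nonneg) auto
    then show ?thesis by simp
  qed
  then show "continuous_on {a..b} (psi q e)"
    unfolding psi_def[abs_def] by (intro continuous_intros) auto
qed

text \<open>A primitive of \<open>psi q e\<close>; it is convex because \<open>psi q e\<close> is increasing.\<close>

definition Psi :: "nat \<Rightarrow> real \<Rightarrow> real \<Rightarrow> real" where "Psi q e s = integral {0..s} (psi q e)"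

lemma Psi_diff_bounds:
  assumes "e > 0" "0 \<le> s" "s \<le> t"
  shows "psi q e s * (t - s) \<le> Psi q e t - Psi q e s" "Psi q e t - Psi q e s \<le> psi q e t * (t - s)"
proof -
  have eq: "Psi q e t - Psi q e s = integral {s..t} (psi q e)"
    unfolding Psi_def using assms Henstock_Kurzweil_Integration.integral_combine[of 0 s t "psi q e"] psi_integrable[of e 0]
    by auto
  have "integral {s..t} (\<lambda>_. psi q e s) \<le> integral {s..t} (psi q e)"
    using assms by (intro integral_le psi_integrable psi_mono) auto
  then show "psi q e s * (t - s) \<le> Psi q e t - Psi q e s" using assms by (simp add: eq mult.commute)
  have "integral {s..t} (psi q e) \<le> integral {s..t} (\<lambda>_. psi q e t)"
    using assms by (intro integral_le psi_integrable psi_mono) auto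
  then show "Psi q e t - Psi q e s \<le> psi q e t * (t - s)" using assms by (simp add: eq mult.commute)
qed

text \<open>The two bounds of \<open>Psi_diff_bounds\<close> place the tangent at \<open>s\<close>
  below \<open>Psi\<close> on either side of \<open>s\<close>. With \<open>s\<close> and
  \<open>t\<close> the values of \<open>Lt\<close> at two sites, a mixed product is traded for terms
  that involve one site each.\<close>

lemma Psi_tangent:
  assumes "e > 0" "0 \<le> s" "0 \<le> t"
  shows "psi q e s * t + Psi q e s \<le> psi q e s * s + Psi q e t"
proof (cases "s \<le> t")
  case True then show ?thesis using Psi_diff_bounds(1)[OF assms(1,2) True, of q] by (simp add: algebra_simps)
next
  case False then show ?thesis using Psi_diff_bounds(2)[OF assms(1,3), of s q] by (simp add: algebra_simps)
qed

lemma Psi_nonneg: "e > 0 \<Longrightarrow> Psi q e s \<ge> 0"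
  unfolding Psi_def by (intro integral_nonneg psi_integrable psi_nonneg) auto

lemma Psi_le: "e > 0 \<Longrightarrow> s \<ge> 0 \<Longrightarrow> Psi q e s \<le> s * psi q e s"
  using Psi_tangent[of e s 0 q] Psi_nonneg[of e q 0] by (simp add: Psi_def mult.commute)

text \<open>\<open>Psi\<close> is monotone on the whole line, because for negative \<open>s\<close>
  it is an integral over an empty interval.\<close>

lemma Psi_measurable: "e > 0 \<Longrightarrow> Psi q e \<in> borel_measurable borel"
proof (intro borel_measurable_mono monoI)
  fix s t :: real assume *: "e > 0" "s \<le> t"
  show "Psi q e s \<le> Psi q e t"
  proof (cases "s \<ge> 0")
    case True
    then have "0 \<le> psi q e s * (t - s)" using * psi_nonneg by (intro mult_nonneg_nonneg) auto
    then show ?thesis using Psi_diff_bounds(1)[OF *(1) True *(2), of q] by linarith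
  next
    case False then show ?thesis using Psi_nonneg[OF *(1)] by (simp add: Psi_def)
  qed
qed

lemma psi_measurable: "psi q e \<in> borel_measurable borel"
  unfolding psi_def[abs_def] by measurable

subsection \<open>Calculus on the configuration space\<close>

locale lattice_setting = single_site jX jB D A lam \<phi>
  for jX :: "'x::{real_vector, polish_space} \<Rightarrow> 'b::banach"
    and jB :: "'b \<Rightarrow>\<^sub>L 'h::{real_inner, polish_space}"
    and D :: "'h set" and A :: "'h \<Rightarrow> 'h"
    and lam :: "nat \<Rightarrow> real" and \<phi> :: "nat \<Rightarrow> 'x" +
  fixes \<gamma> :: "'z::{countable, ab_group_add} \<Rightarrow> real"
  assumes weights: "weight_system \<gamma>"
begin

abbreviation "T \<equiv> conf_top \<gamma> jX"
abbreviation "C \<equiv> conf \<gamma> jX"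
abbreviation "d \<equiv> conf_dist \<gamma> jX"

definition nB :: "'z \<Rightarrow> ('z \<Rightarrow> 'x) \<Rightarrow> real" where "nB k x = norm (jX (x k))"
text \<open>The square of the norm of l^2(B; 1/\<gamma>), the ingredient of the cutoffs that
  involves all sites at once.\<close>

definition W :: "('z \<Rightarrow> 'x) \<Rightarrow> real" where "W x = (\<Sum>\<^sub>\<infinity>k. inverse (\<gamma> k) * (nB k x)\<^sup>2)"

lemma \<gamma>_ge1: "\<gamma> k \<ge> 1" using weights by (auto simp: weight_system_def)

lemma \<gamma>_pos: "\<gamma> k > 0" using \<gamma>_ge1[of k] by linarith

lemma \<gamma>_diff_commute: "\<gamma> (k - j) = \<gamma> (j - k)" using weights unfolding weight_system_def by blast

lemma \<gamma>_diff_le: "\<gamma> (k - j) \<le> \<gamma> k * \<gamma> j" using weights unfolding weight_system_def by blast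

text \<open>The logarithm of \<open>\<gamma> (k - j)\<close> obeys a triangle inequality as a
  distance would; this permits the weights to be centred at any site in
  \<open>weighted_iteration\<close>.\<close>

lemma \<gamma>_triangle: "\<gamma> (k - l) \<le> \<gamma> (k - j) * \<gamma> (j - l)"
  using \<gamma>_diff_le[of "k - j" "l - j"] \<gamma>_diff_commute[of l j] by simp

lemma \<gamma>_le: "\<gamma> j \<le> \<gamma> k * \<gamma> (k - j)"
  using \<gamma>_diff_le[of k "k - j"] by simp

lemma nB_nonneg [simp]: "nB k x \<ge> 0" by (simp add: nB_def)

lemma conf_summable: "x \<in> C \<Longrightarrow> (\<lambda>k. inverse (\<gamma> k) * (nB k x)\<^sup>2) summable_on UNIV"
  by (simp add: conf_def nB_def)

lemma W_nonneg [simp]: "W x \<ge> 0"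
  unfolding W_def using \<gamma>_pos by (intro infsum_nonneg) (simp add: less_imp_le)

lemma nB_le_W: assumes "x \<in> C" shows "(nB k x)\<^sup>2 \<le> \<gamma> k * W x"
proof -
  have "(\<Sum>k\<in>{k}. inverse (\<gamma> k) * (nB k x)\<^sup>2) \<le> W x"
    unfolding W_def using \<gamma>_pos by (intro finite_sum_le_infsum conf_summable assms) (auto simp: less_imp_le)
  then show ?thesis using \<gamma>_pos[of k] by (simp add: field_simps)
qed

section \<open>Convergence in the metric of the configuration space\<close>

lemma metric: "Metric_space C d" by (rule Metric_space_conf[OF weights])

lemma topspace_T [simp]: "topspace T = C"
  unfolding conf_top_def by (rule Metric_space.topspace_mtopology[OF metric])

lemma eventually_atin_conf:
  "x \<in> C \<Longrightarrow> eventually P (atin T x) \<longleftrightarrow> (\<exists>\<delta>>0. \<forall>y. y \<in> C \<and> 0 < d y x \<and> d y x < \<delta> \<longrightarrow> P y)"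
  unfolding conf_top_def by (simp add: Metric_space.eventually_atin_metric[OF metric])

text \<open>The configuration space is a set and not a type; limits along \<open>atin T x\<close>
  express continuity on it and keep the limit rules for filters available.\<close>

lemma continuous_map_iff_tendsto:
  fixes f :: "('z \<Rightarrow> 'x) \<Rightarrow> 'c::topological_space"
  shows "continuous_map T euclidean f \<longleftrightarrow> (\<forall>x\<in>C. (f \<longlongrightarrow> f x) (atin T x))"
  by (simp add: continuous_map_atin)

lemma eventually_in_C: "x \<in> C \<Longrightarrow> \<forall>\<^sub>F y in atin T x. y \<in> C"
  by (auto simp: eventually_atin_conf intro: exI[of _ 1])

lemma tendsto_d: "x \<in> C \<Longrightarrow> ((\<lambda>y. d x y) \<longlongrightarrow> 0) (atin T x)"
proof -
  assume x: "x \<in> C"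
  have "\<forall>\<^sub>F y in atin T x. dist (d x y) 0 < e" if "e > 0" for e
    unfolding eventually_atin_conf[OF x] using that Metric_space.commute[OF metric] Metric_space.nonneg[OF metric]
    by (intro exI[of _ e]) (auto simp: dist_real_def)
  then show ?thesis by (auto simp: tendsto_iff)
qed

abbreviation dterm :: "('z \<Rightarrow> 'x) \<Rightarrow> ('z \<Rightarrow> 'x) \<Rightarrow> 'z \<Rightarrow> real" where
  "dterm x y k \<equiv> (norm (jX (x k) - jX (y k)))\<^sup>2 + (dist (x k) (y k))\<^sup>2 / (1 + (dist (x k) (y k))\<^sup>2)"

lemma dterm_nonneg: "dterm x y k \<ge> 0" by (simp add: add_nonneg_nonneg)

lemma dterm_summable:
  assumes "x \<in> C" "y \<in> C"
  shows "(\<lambda>k. inverse (\<gamma> k) * dterm x y k) summable_on UNIV"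
proof (rule summable_on_comparison_test)
  show "(\<lambda>k. 2 * (inverse (\<gamma> k) * (nB k x)\<^sup>2) + 2 * (inverse (\<gamma> k) * (nB k y)\<^sup>2) + inverse (\<gamma> k))
      summable_on UNIV"
    using assms weights
    by (intro summable_on_add summable_on_cmult_right conf_summable) (auto simp: weight_system_def)
  fix k
  have "(norm (jX (x k) - jX (y k)))\<^sup>2 \<le> (nB k x + nB k y)\<^sup>2"
    unfolding nB_def by (intro power_mono norm_triangle_ineq4) auto
  also have "\<dots> \<le> 2 * (nB k x)\<^sup>2 + 2 * (nB k y)\<^sup>2"
    using sum_squares_bound[of "nB k x" "nB k y"] by (simp add: power2_sum)
  finally have 1: "(norm (jX (x k) - jX (y k)))\<^sup>2 \<le> 2 * (nB k x)\<^sup>2 + 2 * (nB k y)\<^sup>2" .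
  have 2: "(dist (x k) (y k))\<^sup>2 / (1 + (dist (x k) (y k))\<^sup>2) \<le> 1"
    by (simp add: divide_le_eq_1 add_pos_nonneg)
  have "dterm x y k \<le> 2 * (nB k x)\<^sup>2 + 2 * (nB k y)\<^sup>2 + 1" using 1 2 by linarith
  from mult_left_mono[OF this, of "inverse (\<gamma> k)"]
  show "inverse (\<gamma> k) * dterm x y k
      \<le> 2 * (inverse (\<gamma> k) * (nB k x)\<^sup>2) + 2 * (inverse (\<gamma> k) * (nB k y)\<^sup>2) + inverse (\<gamma> k)"
    using \<gamma>_pos[of k] by (simp add: algebra_simps)
  show "0 \<le> inverse (\<gamma> k) * dterm x y k" using \<gamma>_pos[of k] dterm_nonneg by simp
qed

lemma d_nonneg: "d x y \<ge> 0" using Metric_space.nonneg[OF metric] .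

lemma sum_dterm_le:
  assumes "x \<in> C" "y \<in> C" "finite F"
  shows "(\<Sum>k\<in>F. inverse (\<gamma> k) * dterm x y k) \<le> (d x y)\<^sup>2"
proof -
  have *: "0 \<le> inverse (\<gamma> k) * dterm x y k" for k using \<gamma>_pos[of k] dterm_nonneg by simp
  have "(d x y)\<^sup>2 = (\<Sum>\<^sub>\<infinity>k. inverse (\<gamma> k) * dterm x y k)"
    unfolding conf_dist_def using * by (intro real_sqrt_pow2 infsum_nonneg) auto
  also have "\<dots> \<ge> (\<Sum>k\<in>F. inverse (\<gamma> k) * dterm x y k)"
    using * by (intro finite_sum_le_infsum dterm_summable assms) auto
  finally show ?thesis .
qed

lemma dterm_le:
  assumes "x \<in> C" "y \<in> C" shows "dterm x y k \<le> \<gamma> k * (d x y)\<^sup>2"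
  using sum_dterm_le[OF assms, of "{k}"] \<gamma>_pos[of k] by (simp add: field_simps)

text \<open>The map taking t to t^2 / (1 + t^2) is strictly increasing for t >= 0, so a small term
  of the metric forces a small distance in X at its site.\<close>

lemma tendsto_site:
  assumes x: "x \<in> C"
  shows "((\<lambda>y. y k) \<longlongrightarrow> x k) (atin T x)"
proof (rule tendstoI)
  fix e :: real assume e: "e > 0"
  have "((\<lambda>y. \<gamma> k * (d x y)\<^sup>2) \<longlongrightarrow> \<gamma> k * 0\<^sup>2) (atin T x)" by (intro tendsto_intros tendsto_d x)
  moreover have "e\<^sup>2 / (1 + e\<^sup>2) > 0" using e by (simp add: add_pos_pos)
  ultimately have "\<forall>\<^sub>F y in atin T x. \<gamma> k * (d x y)\<^sup>2 < e\<^sup>2 / (1 + e\<^sup>2)" using order_tendstoD(2) by fastforce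
  then show "\<forall>\<^sub>F y in atin T x. dist (y k) (x k) < e"
    using eventually_in_C[OF x]
  proof eventually_elim
    case (elim y)
    have "(dist (x k) (y k))\<^sup>2 / (1 + (dist (x k) (y k))\<^sup>2) < e\<^sup>2 / (1 + e\<^sup>2)"
      using dterm_le[OF x elim(2), of k] elim(1) by (smt (verit) zero_le_power2)
    moreover have "1 + (dist (x k) (y k))\<^sup>2 > 0" "1 + e\<^sup>2 > 0" by (simp_all add: add_pos_nonneg)
    ultimately have "(dist (x k) (y k))\<^sup>2 < e\<^sup>2" by (simp add: field_simps)
    then show ?case using e by (simp add: dist_commute power2_less_imp_less)
  qed
qed

text \<open>Minkowski's inequality: the l^2 norm \<open>sqrt (W x)\<close> is 1-Lipschitz for
  \<open>d\<close>, because each \<open>dterm\<close> dominates the squared distance in B at its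
  site.\<close>

lemma sqrt_W_le:
  assumes xy: "x \<in> C" "y \<in> C"
  shows "sqrt (W x) \<le> d x y + sqrt (W y)"
proof -
  define p where "p k = sqrt (inverse (\<gamma> k))" for k
  have p2: "(p k)\<^sup>2 = inverse (\<gamma> k)" "p k \<ge> 0" for k using \<gamma>_pos[of k] by (auto simp: p_def)
  have "(\<Sum>k\<in>F. inverse (\<gamma> k) * (nB k x)\<^sup>2) \<le> (d x y + sqrt (W y))\<^sup>2" if F: "finite F" for F
  proof -
    have "L2_set (\<lambda>k. p k * nB k x) F \<le> L2_set (\<lambda>k. p k * norm (jX (x k) - jX (y k)) + p k * nB k y) F"
    proof (rule L2_set_mono)
      fix k
      have "nB k x \<le> norm (jX (x k) - jX (y k)) + nB k y"
        unfolding nB_def by (metis add.commute norm_triangle_sub)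
      from mult_left_mono[OF this p2(2)]
      show "p k * nB k x \<le> p k * norm (jX (x k) - jX (y k)) + p k * nB k y" by (simp add: algebra_simps)
    qed (use p2 in auto)
    also have "\<dots> \<le> L2_set (\<lambda>k. p k * norm (jX (x k) - jX (y k))) F + L2_set (\<lambda>k. p k * nB k y) F"
      by (rule L2_set_triangle_ineq)
    also have "\<dots> \<le> d x y + sqrt (W y)"
    proof (rule add_mono)
      have "(\<Sum>k\<in>F. inverse (\<gamma> k) * (norm (jX (x k) - jX (y k)))\<^sup>2) \<le> (\<Sum>k\<in>F. inverse (\<gamma> k) * dterm x y k)"
        using \<gamma>_pos by (intro sum_mono mult_left_mono) (auto simp: less_imp_le)
      also have "\<dots> \<le> (d x y)\<^sup>2" by (rule sum_dterm_le[OF xy F])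
      finally show "L2_set (\<lambda>k. p k * norm (jX (x k) - jX (y k))) F \<le> d x y"
        using d_nonneg by (simp add: L2_set_def power_mult_distrib p2 real_le_lsqrt sum_nonneg)
      show "L2_set (\<lambda>k. p k * nB k y) F \<le> sqrt (W y)"
        unfolding L2_set_def W_def power_mult_distrib p2
        using \<gamma>_pos by (intro real_sqrt_le_mono finite_sum_le_infsum conf_summable xy F) (auto simp: less_imp_le)
    qed
    finally have "(L2_set (\<lambda>k. p k * nB k x) F)\<^sup>2 \<le> (d x y + sqrt (W y))\<^sup>2"
      by (intro power_mono) (auto simp: L2_set_nonneg)
    moreover have "0 \<le> (\<Sum>k\<in>F. inverse (\<gamma> k) * (nB k x)\<^sup>2)" using \<gamma>_pos by (intro sum_nonneg) (simp add: less_imp_le)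
    ultimately show ?thesis by (simp add: L2_set_def power_mult_distrib p2)
  qed
  then have "W x \<le> (d x y + sqrt (W y))\<^sup>2"
    unfolding W_def[of x] by (intro infsum_le_finite_sums conf_summable xy) auto
  then show ?thesis using d_nonneg[of x y] by (simp add: real_le_lsqrt)
qed

lemma tendsto_W:
  assumes x: "x \<in> C"
  shows "(W \<longlongrightarrow> W x) (atin T x)"
proof -
  have "((\<lambda>y. sqrt (W y) - sqrt (W x)) \<longlongrightarrow> 0) (atin T x)"
  proof (rule Lim_null_comparison[OF _ tendsto_d[OF x]])
    show "\<forall>\<^sub>F y in atin T x. norm (sqrt (W y) - sqrt (W x)) \<le> d x y"
      using eventually_in_C[OF x]
    proof eventually_elim
      case (elim y)
      then show ?case using sqrt_W_le[OF x elim] sqrt_W_le[OF elim x] Metric_space.commute[OF metric, of x y]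
        by (simp add: abs_le_iff)
    qed
  qed
  then have "((\<lambda>y. sqrt (W y)) \<longlongrightarrow> sqrt (W x)) (atin T x)" by (simp add: LIM_zero_iff)
  from tendsto_power[OF this, of 2] show ?thesis by simp
qed

text \<open>The class in which the test functions are built. The derivative is an argument, so that
  bounds can be stated for it. Boundedness is required only in \<open>dirC1_C1b\<close>, since the
  factors of a bounded test function may themselves be unbounded.\<close>

definition dirC1 :: "'z \<Rightarrow> nat \<Rightarrow> (('z \<Rightarrow> 'x) \<Rightarrow> 'c::real_normed_vector) \<Rightarrow> (('z \<Rightarrow> 'x) \<Rightarrow> 'c) \<Rightarrow> bool" where
  "dirC1 k n f f' \<longleftrightarrow> (\<forall>x\<in>C. (f \<longlongrightarrow> f x) (atin T x) \<and> (f' \<longlongrightarrow> f' x) (atin T x) \<and>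
     (conf_line f (hdir \<phi> k n) x has_vector_derivative f' x) (at 0))"

lemma conf_line_0 [simp]: "conf_line f h x 0 = f x" by (simp add: conf_line_def)

section \<open>Rules for derivatives along a coordinate direction\<close>

lemma dirC1_const: "dirC1 k n (\<lambda>_. c) (\<lambda>_. 0)"
  by (auto simp: dirC1_def conf_line_def)

lemma dirC1_add:
  assumes "dirC1 k n f f'" "dirC1 k n g g'"
  shows "dirC1 k n (\<lambda>x. f x + g x) (\<lambda>x. f' x + g' x)"
proof -
  have *: "conf_line (\<lambda>x. f x + g x) h x = (\<lambda>t. conf_line f h x t + conf_line g h x t)" for h x
    by (simp add: conf_line_def)
  show ?thesis using assms unfolding dirC1_def * by (auto intro!: tendsto_intros derivative_intros)
qed

lemma dirC1_bilinear:
  assumes p: "bounded_bilinear p" and "dirC1 k n f f'" "dirC1 k n g g'"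
  shows "dirC1 k n (\<lambda>x. p (f x) (g x)) (\<lambda>x. p (f x) (g' x) + p (f' x) (g x))"
proof -
  have *: "conf_line (\<lambda>x. p (f x) (g x)) h x = (\<lambda>t. p (conf_line f h x t) (conf_line g h x t))" for h x
    by (simp add: conf_line_def)
  show ?thesis unfolding dirC1_def *
  proof (intro ballI conjI)
    fix x assume x: "x \<in> C"
    show "((\<lambda>x. p (f x) (g x)) \<longlongrightarrow> p (f x) (g x)) (atin T x)"
      using assms x by (intro bounded_bilinear.tendsto[OF p]) (auto simp: dirC1_def)
    show "((\<lambda>x. p (f x) (g' x) + p (f' x) (g x)) \<longlongrightarrow> p (f x) (g' x) + p (f' x) (g x)) (atin T x)"
      using assms x by (intro tendsto_add bounded_bilinear.tendsto[OF p]) (auto simp: dirC1_def)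
    have "(conf_line f (hdir \<phi> k n) x has_vector_derivative f' x) (at 0)"
      "(conf_line g (hdir \<phi> k n) x has_vector_derivative g' x) (at 0)" using assms x by (auto simp: dirC1_def)
    from bounded_bilinear.has_vector_derivative[OF p this]
    show "((\<lambda>t. p (conf_line f (hdir \<phi> k n) x t) (conf_line g (hdir \<phi> k n) x t)) has_vector_derivative
        p (f x) (g' x) + p (f' x) (g x)) (at 0)" by simp
  qed
qed

lemma dirC1_linear:
  assumes p: "bounded_linear p" and "dirC1 k n f f'"
  shows "dirC1 k n (\<lambda>x. p (f x)) (\<lambda>x. p (f' x))"
proof -
  have *: "conf_line (\<lambda>x. p (f x)) h x = (\<lambda>t. p (conf_line f h x t))" for h x
    by (simp add: conf_line_def)
  show ?thesis using assms unfolding dirC1_def *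
    by (auto intro!: bounded_linear.tendsto[OF p] bounded_linear.has_vector_derivative[OF p])
qed

lemma dirC1_compose:
  fixes f :: "('z \<Rightarrow> 'x) \<Rightarrow> real"
  assumes "dirC1 k n f f'"
    and "\<And>x. x \<in> C \<Longrightarrow> (u has_real_derivative u' (f x)) (at (f x))" "\<And>x. x \<in> C \<Longrightarrow> isCont u' (f x)"
  shows "dirC1 k n (\<lambda>x. u (f x)) (\<lambda>x. u' (f x) * f' x)"
proof -
  have *: "conf_line (\<lambda>x. u (f x)) h x = (\<lambda>t. u (conf_line f h x t))" for h x
    by (simp add: conf_line_def)
  show ?thesis unfolding dirC1_def *
  proof (intro ballI conjI)
    fix x assume x: "x \<in> C"
    show "((\<lambda>x. u (f x)) \<longlongrightarrow> u (f x)) (atin T x)"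
      using assms x by (intro isCont_tendsto_compose[OF DERIV_isCont[OF assms(2)[OF x]]]) (auto simp: dirC1_def)
    show "((\<lambda>x. u' (f x) * f' x) \<longlongrightarrow> u' (f x) * f' x) (atin T x)"
      using assms x by (intro tendsto_mult isCont_tendsto_compose[OF assms(3)[OF x]]) (auto simp: dirC1_def)
    have 1: "(conf_line f (hdir \<phi> k n) x has_real_derivative f' x) (at 0)"
      using assms x by (auto simp: dirC1_def has_real_derivative_iff_has_vector_derivative)
    have 2: "(u has_real_derivative u' (f x)) (at (conf_line f (hdir \<phi> k n) x 0))" using assms x by simp
    show "((\<lambda>t. u (conf_line f (hdir \<phi> k n) x t)) has_vector_derivative u' (f x) * f' x) (at 0)"
      using DERIV_chain2[OF 2 1] by (simp add: has_real_derivative_iff_has_vector_derivative)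
  qed
qed

text \<open>The smoothness of the norms of B and of its dual enters the calculus here;
  \<open>tendsto_dsq\<close> makes the derivative continuous.\<close>

lemma dirC1_sqnorm:
  fixes f :: "('z \<Rightarrow> 'x) \<Rightarrow> 'c::real_normed_vector"
  assumes nd: "\<And>x :: 'c. x \<noteq> 0 \<Longrightarrow> norm differentiable (at x)" and f: "dirC1 k n f f'"
  shows "dirC1 k n (\<lambda>x. (norm (f x))\<^sup>2) (\<lambda>x. dsq (f x) (f' x))"
proof -
  have *: "conf_line (\<lambda>x. (norm (f x))\<^sup>2) h x = (\<lambda>t. (norm (conf_line f h x t))\<^sup>2)" for h x
    by (simp add: conf_line_def)
  show ?thesis unfolding dirC1_def *
  proof (intro ballI conjI)
    fix x assume x: "x \<in> C"
    show "((\<lambda>x. (norm (f x))\<^sup>2) \<longlongrightarrow> (norm (f x))\<^sup>2) (atin T x)"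
      using f x by (intro tendsto_intros) (auto simp: dirC1_def)
    show "((\<lambda>x. dsq (f x) (f' x)) \<longlongrightarrow> dsq (f x) (f' x)) (atin T x)"
      using f x by (intro tendsto_dsq nd) (auto simp: dirC1_def)
    have "(conf_line f (hdir \<phi> k n) x has_vector_derivative f' x) (at 0)" using f x by (auto simp: dirC1_def)
    from vector_derivative_sqnorm[OF nd this]
    show "((\<lambda>t. (norm (conf_line f (hdir \<phi> k n) x t))\<^sup>2) has_vector_derivative dsq (f x) (f' x)) (at 0)"
      by (simp add: has_real_derivative_iff_has_vector_derivative)
  qed
qed

lemma dirC1_mult:
  fixes f g :: "('z \<Rightarrow> 'x) \<Rightarrow> real"
  assumes "dirC1 k n f f'" "dirC1 k n g g'"
  shows "dirC1 k n (\<lambda>x. f x * g x) (\<lambda>x. f x * g' x + f' x * g x)"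
  using dirC1_bilinear[OF bounded_bilinear_mult assms] .

lemma dirC1_site: "dirC1 k n (\<lambda>x. jX (x k)) (\<lambda>x. jX (\<phi> n))"
proof -
  have *: "conf_line (\<lambda>x. jX (x k)) (hdir \<phi> k n) x = (\<lambda>t. jX (x k) + t *\<^sub>R jX (\<phi> n))" for x
    by (simp add: conf_line_def hdir_def linear_add[OF jX(1)] linear_cmul[OF jX(1)])
  have c: "isCont jX y" for y using jX(2) by (simp add: continuous_on_eq_continuous_within)
  have v: "((\<lambda>t. jX (x k) + t *\<^sub>R jX (\<phi> n)) has_vector_derivative jX (\<phi> n)) (at 0)" for x :: "'z \<Rightarrow> 'x"
    by (auto intro!: derivative_eq_intros)
  show ?thesis unfolding dirC1_def * using v by (simp add: isCont_tendsto_compose[OF c] tendsto_site)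
qed

lemma dirC1_site_fun:
  assumes "site_C1 \<phi> f"
  shows "dirC1 k n (\<lambda>x. f (x k)) (\<lambda>x. site_pd f (\<phi> n) (x k))"
proof -
  have *: "conf_line (\<lambda>x. f (x k)) (hdir \<phi> k n) x = site_line f (\<phi> n) (x k)" for x
    by (simp add: conf_line_def hdir_def site_line_def)
  have c: "isCont f y" "isCont (site_pd f (\<phi> n)) y" for y
    using assms by (auto simp: site_C1_def cont_loc_bdd_def continuous_on_eq_continuous_within)
  have v: "(site_line f (\<phi> n) y has_vector_derivative site_pd f (\<phi> n) y) (at 0)" for y
    using assms by (simp add: site_C1_def site_pd_def vector_derivative_works[symmetric])
  show ?thesis unfolding dirC1_def *
    using v by (simp add: isCont_tendsto_compose[OF c(1)] isCont_tendsto_compose[OF c(2)] tendsto_site)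
qed

lemma dirC1_conf_fun:
  assumes "conf_C1 \<gamma> jX \<phi> k f"
  shows "dirC1 k n f (conf_pd f (hdir \<phi> k n))"
  using assms unfolding dirC1_def conf_C1_def cont_loc_bdd_def continuous_map_iff_tendsto
  by (auto simp: conf_pd_def vector_derivative_works[symmetric])

text \<open>A direction supported at the site \<open>k\<close> moves only the \<open>k\<close>-th
  summand of \<open>W\<close>, so the derivative is that of a single squared norm.\<close>

lemma dirC1_W: "dirC1 k n W (\<lambda>x. inverse (\<gamma> k) * dsq (jX (x k)) (jX (\<phi> n)))"
proof -
  have site: "dirC1 k n (\<lambda>x. (norm (jX (x k)))\<^sup>2) (\<lambda>x. dsq (jX (x k)) (jX (\<phi> n)))"
    by (intro dirC1_sqnorm norm_B_diff dirC1_site)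
  have *: "conf_line W (hdir \<phi> k n) x t =
      W x + inverse (\<gamma> k) * (conf_line (\<lambda>x. (norm (jX (x k)))\<^sup>2) (hdir \<phi> k n) x t - (nB k x)\<^sup>2)"
    if x: "x \<in> C" for x t
  proof -
    have split: "W y = inverse (\<gamma> k) * (nB k y)\<^sup>2 + (\<Sum>\<^sub>\<infinity>j\<in>-{k}. inverse (\<gamma> j) * (nB j x)\<^sup>2)"
      if "\<And>j. j \<noteq> k \<Longrightarrow> nB j y = nB j x" for y
    proof -
      have s: "(\<lambda>j. inverse (\<gamma> j) * (nB j x)\<^sup>2) summable_on -{k}"
        using conf_summable[OF x] by (rule summable_on_subset_banach) auto
      have "(\<Sum>\<^sub>\<infinity>j\<in>-{k}. inverse (\<gamma> j) * (nB j x)\<^sup>2) = (\<Sum>\<^sub>\<infinity>j\<in>-{k}. inverse (\<gamma> j) * (nB j y)\<^sup>2)"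
        using that by (intro infsum_cong) auto
      moreover have "(\<lambda>j. inverse (\<gamma> j) * (nB j y)\<^sup>2) summable_on -{k}"
        using s by (rule summable_on_cong[THEN iffD1, rotated]) (use that in auto)
      then have "(\<Sum>\<^sub>\<infinity>j\<in>insert k (-{k}). inverse (\<gamma> j) * (nB j y)\<^sup>2)
          = inverse (\<gamma> k) * (nB k y)\<^sup>2 + (\<Sum>\<^sub>\<infinity>j\<in>-{k}. inverse (\<gamma> j) * (nB j y)\<^sup>2)"
        by (subst infsum_insert) auto
      moreover have "insert k (-{k}) = UNIV" by auto
      ultimately show ?thesis by (simp add: W_def)
    qed
    show ?thesis
      using split[of "\<lambda>j. x j + t *\<^sub>R hdir \<phi> k n j"] split[of x]
      by (simp add: conf_line_def nB_def hdir_def algebra_simps)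
  qed
  show ?thesis unfolding dirC1_def
  proof (intro ballI conjI)
    fix x assume x: "x \<in> C"
    show "(W \<longlongrightarrow> W x) (atin T x)" by (rule tendsto_W[OF x])
    show "((\<lambda>x. inverse (\<gamma> k) * dsq (jX (x k)) (jX (\<phi> n))) \<longlongrightarrow> inverse (\<gamma> k) * dsq (jX (x k)) (jX (\<phi> n))) (atin T x)"
      using site x by (intro tendsto_intros) (auto simp: dirC1_def)
    have "(conf_line (\<lambda>x. (norm (jX (x k)))\<^sup>2) (hdir \<phi> k n) x has_real_derivative dsq (jX (x k)) (jX (\<phi> n))) (at 0)"
      using site x by (auto simp: dirC1_def has_real_derivative_iff_has_vector_derivative)
    then show "(conf_line W (hdir \<phi> k n) x has_vector_derivative inverse (\<gamma> k) * dsq (jX (x k)) (jX (\<phi> n))) (at 0)"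
      unfolding *[OF x, abs_def] has_real_derivative_iff_has_vector_derivative[symmetric]
      by (auto intro!: derivative_eq_intros)
  qed
qed

lemma dirC1_C1b:
  assumes f: "dirC1 k n f f'" and b: "bounded (f ` C)" "bounded (f' ` C)"
  shows "f \<in> C1b \<gamma> jX (hdir \<phi> k n)" and "\<And>x. x \<in> C \<Longrightarrow> conf_pd f (hdir \<phi> k n) x = f' x"
proof -
  show pd: "conf_pd f (hdir \<phi> k n) x = f' x" if "x \<in> C" for x
    unfolding conf_pd_def using f that by (intro vector_derivative_at) (auto simp: dirC1_def)
  have "continuous_map T euclidean f'" using f unfolding continuous_map_iff_tendsto dirC1_def by blast
  then have "continuous_map T euclidean (conf_pd f (hdir \<phi> k n))"
    by (rule continuous_map_eq) (use pd in auto)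
  moreover have "continuous_map T euclidean f" using f unfolding continuous_map_iff_tendsto dirC1_def by blast
  moreover have "conf_pd f (hdir \<phi> k n) ` C = f' ` C" using pd by (intro image_cong) auto
  moreover have "conf_line f (hdir \<phi> k n) x differentiable (at 0)" if "x \<in> C" for x
    using f that unfolding dirC1_def by (metis differentiableI_vector)
  ultimately show "f \<in> C1b \<gamma> jX (hdir \<phi> k n)" using b by (simp add: C1b_def)
qed

lemma measurable_of_tendsto:
  fixes f :: "('z \<Rightarrow> 'x) \<Rightarrow> 'c::topological_space"
  assumes s: "sets \<mu> = sets (conf_borel \<gamma> jX)" and f: "\<And>x. x \<in> C \<Longrightarrow> (f \<longlongrightarrow> f x) (atin T x)"
  shows "f \<in> borel_measurable \<mu>"
proof -
  have sub: "{U. openin T U} \<subseteq> Pow C" using openin_subset[of T] by auto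
  then have sp: "space (conf_borel \<gamma> jX) = C" by (simp add: conf_borel_def)
  have "f \<in> borel_measurable (conf_borel \<gamma> jX)"
  proof (rule borel_measurableI)
    fix S :: "'c set" assume "open S"
    have "continuous_map T euclidean f" using f by (simp add: continuous_map_iff_tendsto)
    then have "openin T {x \<in> C. f x \<in> S}" using \<open>open S\<close> by (auto simp: continuous_map_def)
    moreover have "f -` S \<inter> space (conf_borel \<gamma> jX) = {x \<in> C. f x \<in> S}" using sp by auto
    ultimately show "f -` S \<inter> space (conf_borel \<gamma> jX) \<in> sets (conf_borel \<gamma> jX)"
      using sub by (auto simp: conf_borel_def)
  qed
  then show ?thesis using measurable_cong_sets[OF s refl] by blast
qed

end

subsection \<open>The lattice model\<close>

locale lattice_model = lattice_setting jX jB D A lam \<phi> \<gamma>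
  for jX :: "'x::{real_vector, polish_space} \<Rightarrow> 'b::banach"
    and jB :: "'b \<Rightarrow>\<^sub>L 'h::{real_inner, polish_space}"
    and D :: "'h set" and A :: "'h \<Rightarrow> 'h"
    and lam :: "nat \<Rightarrow> real" and \<phi> :: "nat \<Rightarrow> 'x"
    and \<gamma> :: "'z::{countable, ab_group_add} \<Rightarrow> real" +
  fixes F0 :: "'z \<Rightarrow> 'x \<Rightarrow> ('b \<Rightarrow>\<^sub>L real)"
    and G :: "'z \<Rightarrow> ('z \<Rightarrow> 'x) \<Rightarrow> ('b \<Rightarrow>\<^sub>L real)"
    and J :: "'z \<Rightarrow> 'z \<Rightarrow> real"
    and R K0 K1 K2 K3 M1 M2 L0 L1 L2 L3 N1 N2 :: real
  assumes F0_C1: "\<And>k. site_C1 \<phi> (F0 k)"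
    and G_C1: "\<And>k. conf_C1 \<gamma> jX \<phi> k (G k)"
    and R: "R \<ge> 1"
    and J_nonneg: "\<And>k j. J k j \<ge> 0" and J_fin: "J_norm \<gamma> R J < \<infinity>"
    and pos: "K0 > 0" "K1 > 0" "K2 > 0" "K3 > 0" "M1 > 0" "M2 > 0"
    and nonneg: "L0 \<ge> 0" "L1 \<ge> 0" "L2 \<ge> 0" "L3 \<ge> 0" "N1 \<ge> 0" "N2 \<ge> 0"
    and FF0: "\<And>x k n. x \<in> conf \<gamma> jX \<Longrightarrow>
      norm (site_pd (F0 k) (\<phi> n) (x k)) \<le> K0 * (norm (F0 k (x k)) + norm (jX (x k)) powr R) + L0"
    and GG1: "\<And>x k n. x \<in> conf \<gamma> jX \<Longrightarrow>
      \<bar>G k x (jX (\<phi> n))\<bar> + \<bar>conf_pd (G k) (hdir \<phi> k n) x (jX (\<phi> n))\<bar>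
        \<le> M1 * (\<Sum>\<^sub>\<infinity>j. J k j * norm (jX (x j)) powr R) + N1"
    and GG2: "\<And>x k. x \<in> conf \<gamma> jX \<Longrightarrow>
      norm (G k x) + \<bar>G k x (jX (x k))\<bar> \<le> M2 * (\<Sum>\<^sub>\<infinity>j. J k j * norm (jX (x j)) powr R) + N2"
    and LL1: "\<And>x k n. x \<in> conf \<gamma> jX \<Longrightarrow>
      \<bar>F0 k (x k) (jX (\<phi> n))\<bar> + \<bar>site_pd (F0 k) (\<phi> n) (x k) (jX (\<phi> n))\<bar> \<le> K1 * Lfun jX F0 k (x k) + L1"
    and LL2: "\<And>x k n. x \<in> conf \<gamma> jX \<Longrightarrow>
      \<bar>site_pd (F0 k) (\<phi> n) (x k) (jX (x k))\<bar> \<le> K2 * Lfun jX F0 k (x k) + L2"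
    and LL3: "\<And>x k. x \<in> conf \<gamma> jX \<Longrightarrow>
      norm (jX (x k)) powr R \<le> K3 * Lfun jX F0 k (x k) + L3"
begin

definition \<kappa> :: real where "\<kappa> = (SOME c. \<forall>n. norm (jX (\<phi> n)) \<le> c)"
definition r :: nat where "r = nat \<lceil>R\<rceil>"
definition nF :: "'z \<Rightarrow> ('z \<Rightarrow> 'x) \<Rightarrow> real" where "nF k x = norm (F0 k (x k))"
text \<open>The shift \<open>cL\<close> makes \<open>Lt \<ge> 1\<close> and absorbs the constants \<open>L1\<close>, \<open>L2\<close>, \<open>L3\<close>.\<close>

definition cL :: real where "cL = L1 / K1 + L2 / K2 + L3 / K3 + 1"
definition Lt :: "'z \<Rightarrow> ('z \<Rightarrow> 'x) \<Rightarrow> real" where "Lt k x = Lfun jX F0 k (x k) + cL"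
definition S :: "'z \<Rightarrow> ('z \<Rightarrow> 'x) \<Rightarrow> real" where "S k x = (\<Sum>\<^sub>\<infinity>j. J k j * nB j x powr R)"
text \<open>Combines the squares of the two quantities that bound the derivative of
  \<open>F0\<close> in \<open>FF0\<close>, so that the derivative of \<open>U\<close> is at most a
  multiple of \<open>U\<close>. The term \<open>nB k x powr R\<close> enters through a larger
  polynomial in the squared norm.\<close>

definition U :: "'z \<Rightarrow> ('z \<Rightarrow> 'x) \<Rightarrow> real" where "U k x = (nF k x)\<^sup>2 + (1 + (nB k x)\<^sup>2) ^ r"
definition Jn :: real where "Jn = enn2real (J_norm \<gamma> R J)"
definition Tr :: real where "Tr = tr_inv lam"
definition coef :: "'z \<Rightarrow> nat \<Rightarrow> ('z \<Rightarrow> 'x) \<Rightarrow> real" where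
  "coef k n x = jB (jX (x k)) \<bullet> jB (jX (\<phi> n))"
definition Fn :: "'z \<Rightarrow> nat \<Rightarrow> ('z \<Rightarrow> 'x) \<Rightarrow> real" where "Fn k n x = Fmap F0 G k x (jX (\<phi> n))"

lemma norm_\<phi>_le: "norm (jX (\<phi> n)) \<le> \<kappa>"
  using someI_ex[OF \<phi>_bounded] by (simp add: \<kappa>_def)

lemma \<kappa>_nonneg: "\<kappa> \<ge> 0" using norm_\<phi>_le[of 0] norm_ge_zero order_trans by blast

lemma R_le_r: "R \<le> real r" and r_pos: "r > 0"
  using R by (auto simp: r_def)

lemma lam_pos: "lam n > 0"
proof -
  have 1: "jB (jX (\<phi> n)) \<bullet> jB (jX (\<phi> n)) = 1" using orthonormal[of n n] by simp
  then have "jB (jX (\<phi> n)) \<noteq> 0" by auto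
  then have "A (jB (jX (\<phi> n))) \<bullet> jB (jX (\<phi> n)) > 0"
    using A_positive eigen(1) by (auto simp: positive_op_def)
  then show ?thesis using eigen(2) 1 by simp
qed

lemma sum_inverse_lam_le: "finite N \<Longrightarrow> (\<Sum>n\<in>N. inverse (lam n)) \<le> Tr"
  unfolding Tr_def tr_inv_def by (rule sum_le_suminf[OF trace]) (auto simp: less_imp_le[OF lam_pos])

lemma inverse_lam_le: "inverse (lam n) \<le> Tr" using sum_inverse_lam_le[of "{n}"] by simp

lemma Tr_pos: "Tr > 0" using less_le_trans[OF _ inverse_lam_le[of 0]] lam_pos[of 0] by simp

lemma Jn_nonneg: "Jn \<ge> 0" by (simp add: Jn_def)

section \<open>Convergence of the interaction sums\<close>

lemma J_weighted:
  shows "(\<lambda>j. J k j * \<gamma> (k - j) powr R) summable_on UNIV"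
    and "(\<Sum>\<^sub>\<infinity>j. J k j * \<gamma> (k - j) powr R) \<le> Jn"
proof -
  have "(\<integral>\<^sup>+ j. ennreal (J k j * \<gamma> (k - j) powr R) \<partial>count_space UNIV) \<le> J_norm \<gamma> R J"
    unfolding J_norm_def nn_integral_count_space_infsum by (rule SUP_upper) simp
  also have "\<dots> = ennreal Jn" using J_fin by (simp add: Jn_def)
  finally have *: "(\<integral>\<^sup>+ j. ennreal (J k j * \<gamma> (k - j) powr R) \<partial>count_space UNIV) \<le> ennreal Jn" .
  show "(\<lambda>j. J k j * \<gamma> (k - j) powr R) summable_on UNIV"
    "(\<Sum>\<^sub>\<infinity>j. J k j * \<gamma> (k - j) powr R) \<le> Jn"
    using summable_on_of_nn_integral[OF *] J_nonneg Jn_nonneg by auto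
qed

lemma \<gamma>_powr_ge1: "\<gamma> k powr R \<ge> 1" using \<gamma>_ge1[of k] R by (simp add: ge_one_powr_ge_zero)

lemma J_sum:
  shows "(\<lambda>j. J k j) summable_on UNIV" and "(\<Sum>\<^sub>\<infinity>j. J k j) \<le> Jn"
proof -
  have *: "J k j \<le> J k j * \<gamma> (k - j) powr R" for j
    using \<gamma>_powr_ge1[of "k - j"] J_nonneg[of k j] mult_left_mono by fastforce
  show s: "(\<lambda>j. J k j) summable_on UNIV"
    by (rule summable_on_comparison_test[OF J_weighted(1)[of k]]) (use * J_nonneg in auto)
  have "(\<Sum>\<^sub>\<infinity>j. J k j) \<le> (\<Sum>\<^sub>\<infinity>j. J k j * \<gamma> (k - j) powr R)"
    using * by (intro infsum_mono s J_weighted) auto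
  then show "(\<Sum>\<^sub>\<infinity>j. J k j) \<le> Jn" using J_weighted(2)[of k] by linarith
qed

text \<open>\<open>W\<close> controls the square of \<open>nB j x\<close> up to the factor
  \<open>\<gamma> j\<close>, and \<open>\<gamma> j\<close> is at most
  \<open>\<gamma> k * \<gamma> (k - j)\<close>: the decay of \<open>J k j\<close> compensates the
  growth of a configuration away from \<open>k\<close>.\<close>

lemma nB_powr_le:
  assumes "x \<in> C"
  shows "nB j x powr R \<le> (\<gamma> k * W x) powr (R / 2) * \<gamma> (k - j) powr R"
proof -
  have "(nB j x)\<^sup>2 \<le> \<gamma> j * W x" by (rule nB_le_W[OF assms])
  also have "\<dots> \<le> (\<gamma> k * \<gamma> (k - j)) * W x" by (intro mult_right_mono \<gamma>_le) simp
  finally have "((nB j x)\<^sup>2) powr (R / 2) \<le> (\<gamma> k * W x * \<gamma> (k - j)) powr (R / 2)"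
    using R by (intro powr_mono2) (auto simp: algebra_simps)
  also have "\<dots> = (\<gamma> k * W x) powr (R / 2) * \<gamma> (k - j) powr (R / 2)"
    using \<gamma>_pos by (simp add: powr_mult less_imp_le)
  also have "\<dots> \<le> (\<gamma> k * W x) powr (R / 2) * \<gamma> (k - j) powr R"
    using \<gamma>_ge1[of "k - j"] R by (intro mult_left_mono powr_mono) auto
  also have "((nB j x)\<^sup>2) powr (R / 2) = nB j x powr R"
    by (cases "nB j x = 0") (auto simp: powr_powr simp flip: powr_numeral)
  finally show ?thesis .
qed

lemma S_summable:
  assumes x: "x \<in> C"
  shows "(\<lambda>j. J k j * nB j x powr R) summable_on UNIV"
    and "S k x \<le> (\<gamma> k * W x) powr (R / 2) * Jn"
proof -
  let ?c = "(\<gamma> k * W x) powr (R / 2)"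
  have *: "J k j * nB j x powr R \<le> ?c * (J k j * \<gamma> (k - j) powr R)" for j
    using mult_left_mono[OF nB_powr_le[OF x, of j k] J_nonneg[of k j]] by (simp add: algebra_simps)
  have s: "(\<lambda>j. ?c * (J k j * \<gamma> (k - j) powr R)) summable_on UNIV"
    by (intro summable_on_cmult_right J_weighted)
  show s': "(\<lambda>j. J k j * nB j x powr R) summable_on UNIV"
    by (rule summable_on_comparison_test[OF s]) (use * J_nonneg in auto)
  have "S k x \<le> (\<Sum>\<^sub>\<infinity>j. ?c * (J k j * \<gamma> (k - j) powr R))"
    unfolding S_def using * by (intro infsum_mono s s') auto
  also have "\<dots> = ?c * (\<Sum>\<^sub>\<infinity>j. J k j * \<gamma> (k - j) powr R)" by (rule infsum_cmult_right')
  also have "\<dots> \<le> ?c * Jn" by (intro mult_left_mono J_weighted) auto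
  finally show "S k x \<le> ?c * Jn" .
qed

lemma S_nonneg: "S k x \<ge> 0" unfolding S_def using J_nonneg by (intro infsum_nonneg) auto

lemma S_nn_integral:
  "x \<in> C \<Longrightarrow> ennreal (S k x) = (\<integral>\<^sup>+ j. ennreal (J k j * nB j x powr R) \<partial>count_space UNIV)"
  unfolding S_def using J_nonneg by (intro ennreal_infsum_count_space[symmetric] S_summable) auto

lemma cL_bounds: "cL \<ge> 1" "K1 * cL \<ge> L1 + K1" "K2 * cL \<ge> L2" "K3 * cL \<ge> L3"
proof -
  have q: "L1 / K1 \<ge> 0" "L2 / K2 \<ge> 0" "L3 / K3 \<ge> 0" using pos nonneg by auto
  then show "cL \<ge> 1" by (simp add: cL_def)
  have "K1 * (L1 / K1 + 1) \<le> K1 * cL" using q pos by (intro mult_left_mono) (auto simp: cL_def)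
  moreover have "K2 * (L2 / K2) \<le> K2 * cL" using q pos by (intro mult_left_mono) (auto simp: cL_def)
  moreover have "K3 * (L3 / K3) \<le> K3 * cL" using q pos by (intro mult_left_mono) (auto simp: cL_def)
  moreover have "K1 * (L1 / K1 + 1) = L1 + K1" "K2 * (L2 / K2) = L2" "K3 * (L3 / K3) = L3"
    using pos by (auto simp: field_simps)
  ultimately show "K1 * cL \<ge> L1 + K1" "K2 * cL \<ge> L2" "K3 * cL \<ge> L3" by simp_all
qed

context
  fixes x assumes x: "x \<in> C"
begin

lemma LL1': "\<bar>F0 k (x k) (jX (\<phi> n))\<bar> + \<bar>site_pd (F0 k) (\<phi> n) (x k) (jX (\<phi> n))\<bar> \<le> K1 * Lt k x"
  using LL1[OF x, of k n] cL_bounds pos by (simp add: Lt_def distrib_left)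

text \<open>The left side of \<open>LL1\<close> is nonnegative, so \<open>Lfun\<close> is bounded
  below by \<open>- L1 / K1\<close>; the shift \<open>cL\<close> exceeds \<open>L1 / K1\<close> by
  at least 1.\<close>

lemma Lt_ge1: "Lt k x \<ge> 1"
proof -
  have "K1 * Lt k x \<ge> K1 * 1"
    using LL1[OF x, of k 0] cL_bounds(2) unfolding Lt_def distrib_left by linarith
  then show ?thesis using pos by simp
qed

lemma LL2': "\<bar>site_pd (F0 k) (\<phi> n) (x k) (jX (x k))\<bar> \<le> K2 * Lt k x"
  using LL2[OF x, of k n] cL_bounds pos by (simp add: Lt_def distrib_left)

lemma LL3': "nB k x powr R \<le> K3 * Lt k x"
  using LL3[OF x, of k] cL_bounds pos by (simp add: Lt_def distrib_left nB_def)

lemma Lt_le: "Lt k x \<le> nF k x * nB k x + cL"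
proof -
  have "\<bar>F0 k (x k) (jX (x k))\<bar> \<le> nF k x * nB k x"
    unfolding nF_def nB_def by (metis norm_blinfun real_norm_def)
  then show ?thesis by (simp add: Lt_def Lfun_def)
qed

lemma norm_Fmap_le: "norm (Fmap F0 G k x) \<le> nF k x + M2 * S k x + N2"
  using GG2[OF x, of k] norm_triangle_ineq[of "F0 k (x k)" "G k x"]
  by (simp add: Fmap_def nF_def S_def nB_def)

lemma S_le_Lt: "ennreal (S k x) \<le> (\<integral>\<^sup>+ j. ennreal (J k j) * ennreal (K3 * Lt j x) \<partial>count_space UNIV)"
  unfolding S_nn_integral[OF x]
  using J_nonneg LL3' by (intro nn_integral_mono) (auto simp: ennreal_mult intro!: mult_left_mono ennreal_leI)

end

section \<open>Derivatives of the building blocks and their growth\<close>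

definition dFn :: "'z \<Rightarrow> nat \<Rightarrow> ('z \<Rightarrow> 'x) \<Rightarrow> real" where
  "dFn k n x = (site_pd (F0 k) (\<phi> n) (x k) + conf_pd (G k) (hdir \<phi> k n) x) (jX (\<phi> n))"

lemma dirC1_Fmap:
  "dirC1 k n (Fmap F0 G k) (\<lambda>x. site_pd (F0 k) (\<phi> n) (x k) + conf_pd (G k) (hdir \<phi> k n) x)"
  unfolding Fmap_def[abs_def] by (intro dirC1_add dirC1_site_fun dirC1_conf_fun F0_C1 G_C1)

lemma dirC1_Fn: "dirC1 k n (Fn k n) (dFn k n)"
  unfolding Fn_def[abs_def] dFn_def[abs_def]
  by (rule dirC1_linear[OF blinfun.bounded_linear_left dirC1_Fmap])

lemma dirC1_coef: "dirC1 k n (coef k n) (\<lambda>_. 1)"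
proof -
  have "bounded_linear (\<lambda>v. jB v \<bullet> jB (jX (\<phi> n)))"
    by (rule bounded_linear_compose[OF bounded_linear_inner_left blinfun.bounded_linear_right])
  from dirC1_linear[OF this dirC1_site, of k n] show ?thesis
    using orthonormal[of n n] by (simp add: coef_def[abs_def])
qed

definition dLt :: "'z \<Rightarrow> nat \<Rightarrow> ('z \<Rightarrow> 'x) \<Rightarrow> real" where
  "dLt k n x = F0 k (x k) (jX (\<phi> n)) + site_pd (F0 k) (\<phi> n) (x k) (jX (x k))"

lemma dirC1_Lt: "dirC1 k n (Lt k) (dLt k n)"
  using dirC1_add[OF dirC1_bilinear[OF bounded_bilinear_blinfun_apply dirC1_site_fun[OF F0_C1] dirC1_site] dirC1_const]
  by (simp add: Lt_def[abs_def] dLt_def[abs_def] Lfun_def)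

lemma dLt_le: "x \<in> C \<Longrightarrow> \<bar>dLt k n x\<bar> \<le> (K1 + K2) * Lt k x"
  using LL1'[of x k n] LL2'[of x k n] by (simp add: dLt_def distrib_right)

lemma dFn_le: "x \<in> C \<Longrightarrow> \<bar>dFn k n x\<bar> \<le> K1 * Lt k x + M1 * S k x + N1"
  using LL1'[of x k n] GG1[of x k n] by (simp add: dFn_def S_def nB_def blinfun.add_left)

lemma Fn_le: "x \<in> C \<Longrightarrow> \<bar>Fn k n x\<bar> \<le> K1 * Lt k x + M1 * S k x + N1"
  using LL1'[of x k n] GG1[of x k n] by (simp add: Fn_def Fmap_def S_def nB_def blinfun.add_left)

lemma Fn_le_norm: "\<bar>Fn k n x\<bar> \<le> \<kappa> * norm (Fmap F0 G k x)"
proof -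
  have "\<bar>Fn k n x\<bar> \<le> norm (Fmap F0 G k x) * norm (jX (\<phi> n))"
    unfolding Fn_def by (metis norm_blinfun real_norm_def)
  also have "\<dots> \<le> norm (Fmap F0 G k x) * \<kappa>" by (intro mult_left_mono norm_\<phi>_le) auto
  finally show ?thesis by (simp add: mult.commute)
qed

lemma coef_le: "\<bar>coef k n x\<bar> \<le> norm jB * nB k x"
proof -
  have "\<bar>coef k n x\<bar> \<le> norm (jB (jX (x k))) * norm (jB (jX (\<phi> n)))"
    unfolding coef_def by (rule Cauchy_Schwarz_ineq2)
  moreover have "norm (jB (jX (\<phi> n))) = 1"
    using orthonormal[of n n] by (simp add: norm_eq_sqrt_inner)
  ultimately show ?thesis using norm_blinfun[of jB "jX (x k)"] by (simp add: nB_def)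
qed

lemma h_to_dual_le: "norm (h_to_dual jB (jB (jX (x k)))) \<le> (norm jB)\<^sup>2 * nB k x"
proof -
  have "norm (h_to_dual jB (jB (jX (x k)))) \<le> norm (jB (jX (x k))) * norm jB"
    unfolding h_to_dual_def
  proof (rule norm_blinfun_bound)
    fix v
    have "\<bar>jB (jX (x k)) \<bullet> jB v\<bar> \<le> norm (jB (jX (x k))) * norm (jB v)" by (rule Cauchy_Schwarz_ineq2)
    also have "\<dots> \<le> norm (jB (jX (x k))) * (norm jB * norm v)" by (intro mult_left_mono norm_blinfun) auto
    finally show "norm ((blinfun_inner_right (jB (jX (x k))) o\<^sub>L jB) v) \<le> norm (jB (jX (x k))) * norm jB * norm v"
      by (simp add: algebra_simps)
  qed auto
  also have "\<dots> \<le> (norm jB * nB k x) * norm jB"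
    unfolding nB_def by (intro mult_right_mono norm_blinfun) auto
  finally show ?thesis by (simp add: power2_eq_square algebra_simps)
qed

lemma nB_powr_sq_le: "(nB k x powr R)\<^sup>2 \<le> (1 + (nB k x)\<^sup>2) ^ r"
proof -
  have "(nB k x powr R)\<^sup>2 = (nB k x)\<^sup>2 powr R"
    by (cases "nB k x = 0") (auto simp: powr_powr mult.commute simp flip: powr_numeral)
  also have "\<dots> \<le> (1 + (nB k x)\<^sup>2) powr R" using R by (intro powr_mono2) auto
  also have "\<dots> \<le> (1 + (nB k x)\<^sup>2) powr real r" by (intro powr_mono R_le_r) auto
  also have "\<dots> = (1 + (nB k x)\<^sup>2) ^ r" by (intro powr_realpow add_pos_nonneg) auto
  finally show ?thesis .
qed

lemma U_ge1: "U k x \<ge> 1"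
  unfolding U_def using one_le_power[of "1 + (nB k x)\<^sup>2" r] by (simp add: add_increasing)

definition dU :: "'z \<Rightarrow> nat \<Rightarrow> ('z \<Rightarrow> 'x) \<Rightarrow> real" where
  "dU k n x = dsq (F0 k (x k)) (site_pd (F0 k) (\<phi> n) (x k)) +
     (real r * (1 + (nB k x)\<^sup>2) ^ (r - 1)) * (0 + dsq (jX (x k)) (jX (\<phi> n)))"

lemma dirC1_U: "dirC1 k n (U k) (dU k n)"
  unfolding U_def[abs_def] dU_def[abs_def] nF_def
proof (rule dirC1_add)
  show "dirC1 k n (\<lambda>x. (norm (F0 k (x k)))\<^sup>2) (\<lambda>x. dsq (F0 k (x k)) (site_pd (F0 k) (\<phi> n) (x k)))"
    by (intro dirC1_sqnorm norm_dual_diff dirC1_site_fun F0_C1)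
  have "dirC1 k n (\<lambda>x. 1 + (nB k x)\<^sup>2) (\<lambda>x. 0 + dsq (jX (x k)) (jX (\<phi> n)))"
    unfolding nB_def by (intro dirC1_add dirC1_const dirC1_sqnorm norm_B_diff dirC1_site)
  then show "dirC1 k n (\<lambda>x. (1 + (nB k x)\<^sup>2) ^ r)
      (\<lambda>x. (real r * (1 + (nB k x)\<^sup>2) ^ (r - 1)) * (0 + dsq (jX (x k)) (jX (\<phi> n))))"
    by (rule dirC1_compose) (auto intro!: derivative_eq_intros continuous_intros)
qed

text \<open>The relative growth rates of the two terms of \<open>U\<close>:
  \<open>2 * (K0 + K0 + L0)\<close> comes from \<open>FF0\<close> by splitting products into
  squares, and \<open>2 * real r * \<kappa>\<close> from the power of
  \<open>1 + |x_k|^2\<close>.\<close>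

definition cU :: real where "cU = 2 * (K0 + K0 + L0) + 2 * real r * \<kappa>"

lemma dU_le:
  assumes x: "x \<in> C"
  shows "\<bar>dU k n x\<bar> \<le> cU * U k x"
proof -
  let ?a = "nF k x" and ?p = "nB k x powr R" and ?P = "(1 + (nB k x)\<^sup>2) ^ r"
  let ?d = "site_pd (F0 k) (\<phi> n) (x k)" and ?e = "dsq (jX (x k)) (jX (\<phi> n))"
  have a0: "?a \<ge> 0" by (simp add: nF_def)
  have "\<bar>dsq (F0 k (x k)) ?d\<bar> \<le> 2 * ?a * norm ?d"
    unfolding nF_def by (rule dsq_bound[OF norm_dual_diff])
  also have "\<dots> \<le> 2 * ?a * (K0 * (?a + ?p) + L0)"
    using FF0[OF x, of k n] a0 by (intro mult_left_mono) (auto simp: nF_def nB_def)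
  also have "\<dots> = K0 * (2 * ?a\<^sup>2) + K0 * (2 * ?a * ?p) + L0 * (2 * ?a * 1)"
    by (simp add: power2_eq_square algebra_simps)
  also have "\<dots> \<le> K0 * (2 * U k x) + K0 * (2 * U k x) + L0 * (2 * U k x)"
  proof -
    have 1: "2 * ?a\<^sup>2 \<le> 2 * U k x" by (simp add: U_def)
    have "2 * ?a * ?p \<le> ?a\<^sup>2 + ?p\<^sup>2" by (rule sum_squares_bound)
    also have "\<dots> \<le> U k x" unfolding U_def using nB_powr_sq_le by simp
    finally have 2: "2 * ?a * ?p \<le> 2 * U k x" using U_ge1[of k x] by linarith
    have "2 * ?a * 1 \<le> ?a\<^sup>2 + 1\<^sup>2" by (rule sum_squares_bound)
    also have "?a\<^sup>2 \<le> U k x" by (simp add: U_def)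
    finally have 3: "2 * ?a * 1 \<le> 2 * U k x" using U_ge1[of k x] by simp
    show ?thesis
      using mult_left_mono[OF 1, of K0] mult_left_mono[OF 2, of K0] mult_left_mono[OF 3, of L0] pos nonneg
      by linarith
  qed
  finally have 1: "\<bar>dsq (F0 k (x k)) ?d\<bar> \<le> 2 * (K0 + K0 + L0) * U k x"
    by (simp add: algebra_simps)
  have "\<bar>?e\<bar> \<le> 2 * nB k x * norm (jX (\<phi> n))"
    unfolding nB_def by (rule dsq_bound[OF norm_B_diff])
  also have "\<dots> \<le> 2 * nB k x * \<kappa>" by (intro mult_left_mono norm_\<phi>_le) auto
  also have "\<dots> \<le> 2 * \<kappa> * (1 + (nB k x)\<^sup>2)"
  proof -
    have "nB k x \<le> 1 + (nB k x)\<^sup>2" using sum_squares_bound[of "nB k x" 1] nB_nonneg[of k x] unfolding mult_1_right one_power2 by linarith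
    from mult_left_mono[OF this \<kappa>_nonneg] show ?thesis by (simp add: algebra_simps)
  qed
  finally have "\<bar>(real r * (1 + (nB k x)\<^sup>2) ^ (r - 1)) * (0 + ?e)\<bar>
      \<le> (real r * (1 + (nB k x)\<^sup>2) ^ (r - 1)) * (2 * \<kappa> * (1 + (nB k x)\<^sup>2))"
    by (simp add: abs_mult mult_left_mono)
  also have "\<dots> = 2 * real r * \<kappa> * ?P"
    using r_pos by (cases r) (auto simp: algebra_simps)
  also have "\<dots> \<le> 2 * real r * \<kappa> * U k x"
    using \<kappa>_nonneg by (intro mult_left_mono) (auto simp: U_def)
  finally show ?thesis using 1 unfolding dU_def cU_def by (simp add: distrib_right)
qed

definition dW :: "'z \<Rightarrow> nat \<Rightarrow> ('z \<Rightarrow> 'x) \<Rightarrow> real" where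
  "dW k n x = inverse (\<gamma> k) * dsq (jX (x k)) (jX (\<phi> n))"

text \<open>The factor \<open>inverse (\<gamma> k)\<close> of the derivative cancels the factor
  \<open>\<gamma> k\<close> of \<open>nB_le_W\<close>, so the bound is the same at all
  sites.\<close>

lemma dW_le:
  assumes x: "x \<in> C" shows "\<bar>dW k n x\<bar> \<le> \<kappa> * (1 + W x)"
proof -
  have "\<bar>dsq (jX (x k)) (jX (\<phi> n))\<bar> \<le> 2 * nB k x * norm (jX (\<phi> n))"
    unfolding nB_def by (rule dsq_bound[OF norm_B_diff])
  also have "\<dots> \<le> 2 * nB k x * \<kappa>" by (intro mult_left_mono norm_\<phi>_le) auto
  also have "\<dots> \<le> (1 + (nB k x)\<^sup>2) * \<kappa>"
    using sum_squares_bound[of "nB k x" 1] \<kappa>_nonneg by (intro mult_right_mono) auto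
  also have "\<dots> \<le> (\<gamma> k * (1 + W x)) * \<kappa>"
    using nB_le_W[OF x, of k] \<gamma>_ge1[of k] \<kappa>_nonneg by (intro mult_right_mono) (auto simp: distrib_left)
  finally show ?thesis using \<gamma>_pos[of k] unfolding dW_def
    by (simp add: abs_mult field_simps)
qed

text \<open>The growth that the cutoffs \<open>gW m e\<close> and \<open>gU e' k\<close> together
  absorb for fixed parameters; see \<open>cutoff_Env\<close>.\<close>

definition Env :: "nat \<Rightarrow> 'z \<Rightarrow> ('z \<Rightarrow> 'x) \<Rightarrow> real" where
  "Env m k x = (1 + U k x) * (1 + W x) ^ m"

text \<open>A common majorant of the factors of the integrands. Bounds by \<open>Z\<close> serve
  only the integrability and the admissibility of test functions; the constants of the final
  estimates come from bounds by \<open>Lt\<close> and \<open>S\<close>.\<close>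

definition Z :: "'z \<Rightarrow> ('z \<Rightarrow> 'x) \<Rightarrow> real" where
  "Z k x = 1 + nF k x + nB k x + nB k x powr R + S k x"

lemma nF_nonneg [simp]: "nF k x \<ge> 0" by (simp add: nF_def)

lemma Z_parts:
  "1 \<le> Z k x" "nF k x \<le> Z k x" "nB k x \<le> Z k x" "nB k x powr R \<le> Z k x" "S k x \<le> Z k x"
  using nF_nonneg[of k x] nB_nonneg[of k x] powr_ge_zero[of "nB k x" R] S_nonneg[of k x]
  unfolding Z_def by linarith+

lemma W_power_le: "i \<le> j \<Longrightarrow> (1 + W x) ^ i \<le> (1 + W x) ^ j" by (intro power_increasing) auto

lemma le_Env:
  assumes "m' \<le> m"
  shows "(1 + W x) ^ m' \<le> Env m k x" and "(1 + U k x) * (1 + W x) ^ m' \<le> Env m k x"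
proof -
  have U: "1 \<le> 1 + U k x" using U_ge1[of k x] by linarith
  show *: "(1 + U k x) * (1 + W x) ^ m' \<le> Env m k x"
    unfolding Env_def using W_power_le[OF assms] U by (intro mult_left_mono) auto
  have "1 * (1 + W x) ^ m' \<le> (1 + U k x) * (1 + W x) ^ m'" using U by (intro mult_right_mono) auto
  then show "(1 + W x) ^ m' \<le> Env m k x" using * by simp
qed

lemma S_sq_le: "x \<in> C \<Longrightarrow> (S k x)\<^sup>2 \<le> (\<gamma> k * (1 + W x)) ^ r * Jn\<^sup>2"
proof -
  assume x: "x \<in> C"
  have "(S k x)\<^sup>2 \<le> ((\<gamma> k * W x) powr (R / 2) * Jn)\<^sup>2"
    by (intro power_mono S_summable x S_nonneg)
  also have "\<dots> = (\<gamma> k * W x) powr R * Jn\<^sup>2"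
    using \<gamma>_pos[of k] by (cases "W x = 0") (auto simp: power_mult_distrib powr_powr simp flip: powr_numeral)
  also have "\<dots> \<le> (\<gamma> k * (1 + W x)) powr R * Jn\<^sup>2"
    using R \<gamma>_pos[of k] by (intro mult_right_mono powr_mono2) auto
  also have "\<dots> \<le> (\<gamma> k * (1 + W x)) powr real r * Jn\<^sup>2"
  proof (intro mult_right_mono powr_mono R_le_r)
    show "1 \<le> \<gamma> k * (1 + W x)" using mult_mono[of 1 "\<gamma> k" 1 "1 + W x"] \<gamma>_ge1[of k] by simp
  qed auto
  also have "(\<gamma> k * (1 + W x)) powr real r = (\<gamma> k * (1 + W x)) ^ r"
    using \<gamma>_pos[of k] W_nonneg[of x] by (intro powr_realpow mult_pos_pos add_pos_nonneg) auto
  finally show ?thesis .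
qed

text \<open>\<open>U\<close> majorizes the squares of the local terms \<open>nF k x\<close> and
  \<open>nB k x powr R\<close>, and the power \<open>r\<close> of \<open>1 + W x\<close> takes care
  of the square of \<open>S\<close>. The constant may depend on \<open>k\<close>, as it does not
  enter the final estimates.\<close>

lemma Z_sq_le: "\<exists>c\<ge>0. \<forall>x\<in>C. (Z k x)\<^sup>2 \<le> c * Env r k x"
proof (intro exI conjI ballI)
  let ?c = "5 * (1 + 1 + \<gamma> k + 1 + \<gamma> k ^ r * Jn\<^sup>2)"
  show "0 \<le> ?c" using \<gamma>_pos[of k] by (simp add: add_nonneg_nonneg)
  fix x assume x: "x \<in> C"
  have E: "1 \<le> Env r k x" using le_Env(1)[of 0 r x k] by simp
  have U: "U k x \<le> Env r k x" using le_Env(2)[of 0 r k x] by simp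
  have W1: "1 + W x \<le> Env r k x" using le_Env(1)[of 1 r x k] r_pos by simp
  have 2: "(nF k x)\<^sup>2 \<le> Env r k x" "(nB k x powr R)\<^sup>2 \<le> Env r k x"
  proof -
    have "0 \<le> (1 + (nB k x)\<^sup>2) ^ r" by (intro zero_le_power) (simp add: add_nonneg_nonneg)
    then show "(nF k x)\<^sup>2 \<le> Env r k x" using U unfolding U_def by linarith
    show "(nB k x powr R)\<^sup>2 \<le> Env r k x"
      using nB_powr_sq_le[of k x] U zero_le_power2[of "nF k x"] unfolding U_def by linarith
  qed
  have 3: "(nB k x)\<^sup>2 \<le> \<gamma> k * Env r k x"
    using nB_le_W[OF x, of k] mult_left_mono[OF W1, of "\<gamma> k"] \<gamma>_pos[of k] by (simp add: distrib_left)
  have "(S k x)\<^sup>2 \<le> (\<gamma> k * (1 + W x)) ^ r * Jn\<^sup>2" by (rule S_sq_le[OF x])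
  also have "\<dots> = \<gamma> k ^ r * Jn\<^sup>2 * (1 + W x) ^ r" by (simp add: power_mult_distrib)
  also have "\<dots> \<le> \<gamma> k ^ r * Jn\<^sup>2 * Env r k x"
    using \<gamma>_pos[of k] by (intro mult_left_mono le_Env) auto
  finally have 4: "(S k x)\<^sup>2 \<le> \<gamma> k ^ r * Jn\<^sup>2 * Env r k x" .
  have "(Z k x)\<^sup>2 \<le> 5 * (1\<^sup>2 + (nF k x)\<^sup>2 + (nB k x)\<^sup>2 + (nB k x powr R)\<^sup>2 + (S k x)\<^sup>2)"
    unfolding Z_def by (rule sum5_sq_le)
  also have "\<dots> \<le> ?c * Env r k x"
    using E 2 3 4 by (simp add: algebra_simps)
  finally show "(Z k x)\<^sup>2 \<le> ?c * Env r k x" .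
qed

subsection \<open>Cutoffs and the energy inequality\<close>

text \<open>Nonnegative factors with logarithmic derivative bounded by \<open>K\<close> in all
  directions of the site \<open>k\<close>. As the bound is relative to \<open>g\<close>, the
  derivative of a cutoff in an integration by parts reproduces the cutoff under the
  integral.\<close>

definition adm :: "'z \<Rightarrow> real \<Rightarrow> (('z \<Rightarrow> 'x) \<Rightarrow> real) \<Rightarrow> bool" where
  "adm k K g \<longleftrightarrow> (\<forall>x\<in>C. 0 \<le> g x) \<and> (\<forall>n. \<exists>g'. dirC1 k n g g' \<and> (\<forall>x\<in>C. \<bar>g' x\<bar> \<le> K * g x))"

lemma adm_mult:
  assumes "adm k K g" "adm k K' h"
  shows "adm k (K + K') (\<lambda>x. g x * h x)"
  unfolding adm_def
proof (intro conjI ballI allI)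
  fix x assume "x \<in> C" then show "0 \<le> g x * h x" using assms by (simp add: adm_def)
next
  fix n
  obtain g' where g: "dirC1 k n g g'" "\<And>x. x \<in> C \<Longrightarrow> \<bar>g' x\<bar> \<le> K * g x" using assms(1) unfolding adm_def by blast
  obtain h' where h: "dirC1 k n h h'" "\<And>x. x \<in> C \<Longrightarrow> \<bar>h' x\<bar> \<le> K' * h x" using assms(2) unfolding adm_def by blast
  show "\<exists>f'. dirC1 k n (\<lambda>x. g x * h x) f' \<and> (\<forall>x\<in>C. \<bar>f' x\<bar> \<le> (K + K') * (g x * h x))"
  proof (intro exI conjI ballI)
    show "dirC1 k n (\<lambda>x. g x * h x) (\<lambda>x. g x * h' x + g' x * h x)" by (intro dirC1_mult g h)
    fix x assume x: "x \<in> C"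
    have n: "g x \<ge> 0" "h x \<ge> 0" using assms x by (auto simp: adm_def)
    have "\<bar>g x * h' x + g' x * h x\<bar> \<le> g x * \<bar>h' x\<bar> + \<bar>g' x\<bar> * h x"
      using n abs_triangle_ineq[of "g x * h' x" "g' x * h x"] by (simp add: abs_mult)
    also have "\<dots> \<le> g x * (K' * h x) + (K * g x) * h x"
      using n g(2)[OF x] h(2)[OF x] by (intro add_mono mult_left_mono mult_right_mono) auto
    finally show "\<bar>g x * h' x + g' x * h x\<bar> \<le> (K + K') * (g x * h x)" by (simp add: algebra_simps)
  qed
qed

lemma adm_compose:
  assumes f: "\<And>n. dirC1 k n f (f' n)"
    and u: "\<And>x. x \<in> C \<Longrightarrow> (u has_real_derivative u' (f x)) (at (f x))" "\<And>x. x \<in> C \<Longrightarrow> isCont u' (f x)"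
    and n: "\<And>x. x \<in> C \<Longrightarrow> u (f x) \<ge> 0" "\<And>x n. x \<in> C \<Longrightarrow> \<bar>u' (f x) * f' n x\<bar> \<le> K * u (f x)"
  shows "adm k K (\<lambda>x. u (f x))"
  unfolding adm_def
proof (intro conjI ballI allI)
  fix m
  have "dirC1 k m (\<lambda>x. u (f x)) (\<lambda>x. u' (f x) * f' m x)" by (rule dirC1_compose[OF f u])
  then show "\<exists>g'. dirC1 k m (\<lambda>x. u (f x)) g' \<and> (\<forall>x\<in>C. \<bar>g' x\<bar> \<le> K * u (f x))" using n by blast
qed (use n in auto)

definition gW :: "nat \<Rightarrow> real \<Rightarrow> ('z \<Rightarrow> 'x) \<Rightarrow> real" where "gW m e x = inverse (1 + e * W x) ^ m"
definition gU :: "real \<Rightarrow> 'z \<Rightarrow> ('z \<Rightarrow> 'x) \<Rightarrow> real" where "gU e k x = inverse (1 + e * U k x)"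

text \<open>The quotient \<open>e * U k x / (1 + e * U k x)\<close> is at most 1, so the constant of
  \<open>dU_le\<close> carries over without dependence on \<open>e\<close>.\<close>

lemma adm_gU:
  assumes e: "e > 0" shows "adm k cU (gU e k)"
  unfolding gU_def[abs_def]
proof (rule adm_compose[OF dirC1_U, where u = "\<lambda>s. inverse (1 + e * s)" and u' = "\<lambda>s. - e * (inverse (1 + e * s))\<^sup>2"])
  fix x n assume x: "x \<in> C"
  let ?v = "inverse (1 + e * U k x)"
  have p: "1 + e * U k x > 0" using U_ge1[of k x] e by (intro add_pos_nonneg) auto
  show "((\<lambda>s. inverse (1 + e * s)) has_real_derivative - e * (?v)\<^sup>2) (at (U k x))"
    using p by (auto intro!: derivative_eq_intros simp: power2_eq_square)
  show "isCont (\<lambda>s. - e * (inverse (1 + e * s))\<^sup>2) (U k x)" using p by (auto intro!: continuous_intros)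
  show "?v \<ge> 0" using p by simp
  have c: "cU \<ge> 0" using pos nonneg \<kappa>_nonneg by (simp add: cU_def)
  have "\<bar>- e * (?v)\<^sup>2 * dU k n x\<bar> = ?v * (?v * (e * \<bar>dU k n x\<bar>))"
    using e p by (simp add: abs_mult power2_eq_square)
  also have "\<dots> \<le> ?v * (?v * (e * (cU * U k x)))"
    using e p dU_le[OF x] by (intro mult_left_mono) auto
  also have "\<dots> \<le> ?v * cU"
  proof (rule mult_left_mono)
    have "e * (cU * U k x) \<le> cU * (1 + e * U k x)" using c by (simp add: algebra_simps)
    then show "?v * (e * (cU * U k x)) \<le> cU" using p by (simp add: field_simps)
  qed (use p in auto)
  finally show "\<bar>- e * (?v)\<^sup>2 * dU k n x\<bar> \<le> cU * ?v"
    by (simp add: mult.commute)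
qed

text \<open>Again the constant is free of \<open>e\<close>; the restriction \<open>e \<le> 1\<close>
  gives \<open>e * (1 + W x) \<le> 1 + e * W x\<close>.\<close>

lemma adm_gW:
  assumes e: "e > 0" "e \<le> 1" shows "adm k (real m * \<kappa>) (gW m e)"
  unfolding gW_def[abs_def]
proof (rule adm_compose[OF dirC1_W[folded dW_def], where u = "\<lambda>s. inverse (1 + e * s) ^ m"
      and u' = "\<lambda>s. - e * real m * inverse (1 + e * s) ^ (m + 1)"])
  fix x n assume x: "x \<in> C"
  let ?v = "inverse (1 + e * W x)"
  have p: "1 + e * W x > 0" using e by (intro add_pos_nonneg) auto
  have "((\<lambda>s. inverse (1 + e * s)) has_real_derivative - e * (?v)\<^sup>2) (at (W x))"
    using p by (auto intro!: derivative_eq_intros simp: power2_eq_square)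
  from DERIV_power[OF this, of m]
  show "((\<lambda>s. inverse (1 + e * s) ^ m) has_real_derivative - e * real m * ?v ^ (m + 1)) (at (W x))"
    by (cases m) (auto simp: power2_eq_square mult_ac)
  show "isCont (\<lambda>s. - e * real m * inverse (1 + e * s) ^ (m + 1)) (W x)" using p by (auto intro!: continuous_intros)
  show "?v ^ m \<ge> 0" using p by simp
  have "\<bar>- e * real m * ?v ^ (m + 1) * dW k n x\<bar>
      = (?v ^ m * real m) * (?v * (e * \<bar>dW k n x\<bar>))"
    using e p by (simp add: abs_mult power_abs)
  also have "\<dots> \<le> (?v ^ m * real m) * (?v * (e * (\<kappa> * (1 + W x))))"
    using e p dW_le[OF x] by (intro mult_left_mono) auto
  also have "\<dots> \<le> (?v ^ m * real m) * \<kappa>"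
  proof (rule mult_left_mono)
    have "\<kappa> * (e * (1 + W x)) \<le> \<kappa> * (1 + e * W x)" using e \<kappa>_nonneg by (intro mult_left_mono) (auto simp: distrib_left)
    then show "?v * (e * (\<kappa> * (1 + W x))) \<le> \<kappa>" using p by (simp add: field_simps)
  qed (use p in auto)
  finally show "\<bar>- e * real m * ?v ^ (m + 1) * dW k n x\<bar> \<le> real m * \<kappa> * ?v ^ m"
    by (simp add: mult.commute mult.left_commute)
qed

text \<open>The logarithmic derivative of \<open>psi q e\<close> at \<open>s\<close> is
  \<open>q / (s * (1 + e * s))\<close>; multiplied by the bound \<open>(K1 + K2) * s\<close> of
  \<open>dLt_le\<close> it is at most \<open>q * (K1 + K2)\<close> for every
  \<open>e\<close>.\<close>

lemma adm_psi:
  assumes e: "e > 0" shows "adm k (real q * (K1 + K2)) (\<lambda>x. psi q e (Lt k x))"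
  unfolding psi_def[abs_def]
proof (rule adm_compose[OF dirC1_Lt, where u = "\<lambda>s. (s / (1 + e * s)) ^ q"
      and u' = "\<lambda>s. real q * (s / (1 + e * s)) ^ (q - 1) * (inverse (1 + e * s))\<^sup>2"])
  fix x n assume x: "x \<in> C"
  let ?s = "Lt k x"
  let ?t = "?s / (1 + e * ?s)" and ?v = "inverse (1 + e * ?s)"
  have s: "?s \<ge> 1" by (rule Lt_ge1[OF x])
  have p: "1 + e * ?s > 0" using e s by (intro add_pos_nonneg) auto
  have "((\<lambda>s. s / (1 + e * s)) has_real_derivative
      (1 * (1 + e * ?s) - ?s * e) / ((1 + e * ?s) * (1 + e * ?s))) (at ?s)"
    using p by (intro DERIV_divide) (auto intro!: derivative_eq_intros)
  also have "1 * (1 + e * ?s) - ?s * e = 1" by simp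
  also have "1 / ((1 + e * ?s) * (1 + e * ?s)) = (?v)\<^sup>2"
    by (simp add: power2_eq_square divide_inverse)
  finally have "((\<lambda>s. s / (1 + e * s)) has_real_derivative (?v)\<^sup>2) (at ?s)" .
  from DERIV_power[OF this, of q]
  show "((\<lambda>s. (s / (1 + e * s)) ^ q) has_real_derivative
      real q * ?t ^ (q - 1) * (?v)\<^sup>2) (at ?s)"
    by (simp add: mult_ac)
  show "isCont (\<lambda>s. real q * (s / (1 + e * s)) ^ (q - 1) * (inverse (1 + e * s))\<^sup>2) ?s"
    using p by (auto intro!: continuous_intros)
  show "?t ^ q \<ge> 0" using p s by simp
  have "\<bar>real q * ?t ^ (q - 1) * (?v)\<^sup>2 * dLt k n x\<bar>
      = (real q * ?t ^ (q - 1) * ?v) * (?v * \<bar>dLt k n x\<bar>)"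
    using p s by (simp add: abs_mult power_abs power2_eq_square)
  also have "\<dots> \<le> (real q * ?t ^ (q - 1) * ?v) * (1 * ((K1 + K2) * ?s))"
  proof (intro mult_left_mono mult_mono dLt_le x)
    have "1 \<le> 1 + e * ?s" using e s by simp
    then show "?v \<le> 1" by (rule inverse_le_1_iff[THEN iffD2, OF disjI2])
  qed (use p s in auto)
  also have "\<dots> = real q * (K1 + K2) * (?t ^ (q - 1) * ?t)"
    by (simp add: divide_inverse algebra_simps)
  also have "\<dots> = real q * (K1 + K2) * ?t ^ q"
    by (cases q) (auto simp: algebra_simps)
  finally show "\<bar>real q * ?t ^ (q - 1) * (?v)\<^sup>2 * dLt k n x\<bar>
      \<le> real q * (K1 + K2) * ?t ^ q" .
qed

lemma gW_bounds: "e > 0 \<Longrightarrow> 0 < gW m e x" "e > 0 \<Longrightarrow> gW m e x \<le> 1"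
proof -
  assume "e > 0"
  then have "1 \<le> 1 + e * W x" by simp
  then show "0 < gW m e x" "gW m e x \<le> 1" unfolding gW_def
    by (auto intro!: power_le_one zero_less_power simp: inverse_le_1_iff)
qed

lemma gU_bounds: "e > 0 \<Longrightarrow> 0 < gU e k x" "e > 0 \<Longrightarrow> gU e k x \<le> 1"
proof -
  assume "e > 0"
  then have "1 \<le> 1 + e * U k x" using U_ge1[of k x] by simp
  then show "0 < gU e k x" "gU e k x \<le> 1" unfolding gU_def by (auto simp: inverse_le_1_iff)
qed

lemma gW_W_le: assumes e: "e > 0" "e \<le> 1" shows "gW m e x * (1 + W x) ^ m \<le> inverse e ^ m"
proof -
  have p: "1 + e * W x > 0" using e by (intro add_pos_nonneg) auto
  have "e * (1 + W x) \<le> 1 + e * W x" using e by (simp add: distrib_left)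
  then have "inverse (1 + e * W x) * (1 + W x) \<le> inverse e" using p e by (simp add: field_simps)
  then have "(inverse (1 + e * W x) * (1 + W x)) ^ m \<le> inverse e ^ m" using p by (intro power_mono) auto
  then show ?thesis by (simp add: gW_def power_mult_distrib)
qed

lemma gU_U_le: assumes e: "e > 0" shows "gU e k x * (1 + U k x) \<le> 1 + inverse e"
proof -
  have u: "U k x \<ge> 1" by (rule U_ge1)
  then have p: "1 + e * U k x > 0" using e by (intro add_pos_nonneg) auto
  have "(1 + inverse e) * (1 + e * U k x) = 1 + U k x + (e * U k x + inverse e)" using e by (simp add: field_simps)
  moreover have "0 \<le> e * U k x + inverse e" using e u by (intro add_nonneg_nonneg) auto
  ultimately have "1 + U k x \<le> (1 + inverse e) * (1 + e * U k x)" by linarith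
  then show ?thesis using p unfolding gU_def by (simp add: field_simps)
qed

lemma cutoff_Env:
  assumes e: "e > 0" "e \<le> 1" "e' > 0" and x: "x \<in> C"
  shows "psi q e (Lt k x) * gW m e x * gU e' k x * Env m k x \<le> inverse e ^ q * inverse e ^ m * (1 + inverse e')"
proof -
  have L: "Lt k x \<ge> 0" using Lt_ge1[OF x, of k] by linarith
  have u: "U k x \<ge> 1" by (rule U_ge1)
  have "psi q e (Lt k x) * gW m e x * gU e' k x * Env m k x
      = psi q e (Lt k x) * (gW m e x * (1 + W x) ^ m) * (gU e' k x * (1 + U k x))"
    by (simp add: Env_def algebra_simps)
  also have "\<dots> \<le> inverse e ^ q * inverse e ^ m * (1 + inverse e')"
    using e L u gW_bounds(1)[of e m x] gU_bounds(1)[of e' k x]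
    by (intro mult_mono psi_le gW_W_le gU_U_le mult_nonneg_nonneg psi_nonneg) (auto intro: add_nonneg_nonneg)
  finally show ?thesis .
qed

lemma adm_cutoff:
  assumes "e > 0" "e \<le> 1" "e' > 0"
  shows "adm k (real q * (K1 + K2) + real m * \<kappa> + cU) (\<lambda>x. psi q e (Lt k x) * gW m e x * gU e' k x)"
  using assms by (intro adm_mult adm_psi adm_gW adm_gU)

section \<open>Growth of the logarithmic gradient\<close>

lemma norm_Fmap_le_Z: "x \<in> C \<Longrightarrow> norm (Fmap F0 G k x) \<le> (1 + M2 + N2) * Z k x"
proof -
  assume x: "x \<in> C"
  have "norm (Fmap F0 G k x) \<le> nF k x + M2 * S k x + N2" by (rule norm_Fmap_le[OF x])
  also have "\<dots> \<le> Z k x + M2 * Z k x + N2 * Z k x"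
    using Z_parts[where k = k and x = x] pos nonneg mult_left_mono[of 1 "Z k x" N2] by (intro add_mono mult_left_mono) auto
  finally show ?thesis by (simp add: algebra_simps)
qed

lemma Fn_le_Z: "x \<in> C \<Longrightarrow> \<bar>Fn k n x\<bar> \<le> \<kappa> * (1 + M2 + N2) * Z k x"
  using order_trans[OF Fn_le_norm mult_left_mono[OF norm_Fmap_le_Z \<kappa>_nonneg]] by (simp add: mult.assoc)

lemma dFn_le_Z: "x \<in> C \<Longrightarrow> \<bar>dFn k n x\<bar> \<le> (\<kappa> * (2 * K0 + L0) + M1 + N1) * Z k x"
proof -
  assume x: "x \<in> C"
  let ?p = "site_pd (F0 k) (\<phi> n) (x k)"
  have z: "1 \<le> Z k x" "nF k x \<le> Z k x" "nB k x powr R \<le> Z k x" "S k x \<le> Z k x" using Z_parts by auto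
  have "\<bar>?p (jX (\<phi> n))\<bar> \<le> norm ?p * norm (jX (\<phi> n))" by (metis norm_blinfun real_norm_def)
  also have "\<dots> \<le> norm ?p * \<kappa>" by (intro mult_left_mono norm_\<phi>_le) auto
  also have "\<dots> \<le> (K0 * (nF k x + nB k x powr R) + L0) * \<kappa>"
    using FF0[OF x, of k n] \<kappa>_nonneg by (intro mult_right_mono) (auto simp: nF_def nB_def)
  also have "\<dots> \<le> (K0 * (Z k x + Z k x) + L0 * Z k x) * \<kappa>"
    using z pos nonneg \<kappa>_nonneg mult_left_mono[of 1 "Z k x" L0] by (intro mult_right_mono add_mono mult_left_mono) auto
  finally have 1: "\<bar>?p (jX (\<phi> n))\<bar> \<le> \<kappa> * (2 * K0 + L0) * Z k x" by (simp add: algebra_simps)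
  have "\<bar>conf_pd (G k) (hdir \<phi> k n) x (jX (\<phi> n))\<bar> \<le> M1 * S k x + N1"
    using GG1[OF x, of k n] by (simp add: S_def nB_def)
  also have "\<dots> \<le> M1 * Z k x + N1 * Z k x"
    using z pos nonneg mult_left_mono[of 1 "Z k x" N1] by (intro add_mono mult_left_mono) auto
  finally show ?thesis using 1 unfolding dFn_def blinfun.add_left by (simp add: distrib_right)
qed

lemma Lt_le_Z: "x \<in> C \<Longrightarrow> Lt k x \<le> (1 + cL) * (Z k x)\<^sup>2"
proof -
  assume x: "x \<in> C"
  have z: "1 \<le> Z k x" "nF k x \<le> Z k x" "nB k x \<le> Z k x" using Z_parts by auto
  have "Lt k x \<le> nF k x * nB k x + cL" by (rule Lt_le[OF x])
  also have "nF k x * nB k x \<le> Z k x * Z k x" using z by (intro mult_mono) auto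
  also have "cL \<le> cL * (Z k x)\<^sup>2" using z cL_bounds(1) mult_left_mono[of 1 "(Z k x)\<^sup>2" cL] by simp
  finally show ?thesis by (simp add: power2_eq_square algebra_simps)
qed

lemma coef_le_Z: "\<bar>coef k n x\<bar> \<le> norm jB * Z k x"
  using coef_le[of k n x] mult_left_mono[OF Z_parts(3)[of k x], of "norm jB"] by simp

lemma h_to_dual_le_Z: "norm (h_to_dual jB (jB (jX (x k)))) \<le> (norm jB)\<^sup>2 * Z k x"
  using h_to_dual_le[of x k] mult_left_mono[OF Z_parts(3)[of k x], of "(norm jB)\<^sup>2"] by simp

lemma Z_le_sq: "Z k x \<le> (Z k x)\<^sup>2"
  using Z_parts(1)[of k x] mult_left_mono[of 1 "Z k x" "Z k x"] by (simp add: power2_eq_square)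

lemma S_le_Z_sq: "S k x \<le> (Z k x)\<^sup>2" using Z_parts(5) Z_le_sq order_trans by blast

lemma log_grad_eq: "log_grad jX jB A \<phi> F0 G k n x = - (lam n * coef k n x + Fn k n x)"
  by (simp add: log_grad_def eigen(2) coef_def Fn_def inner_commute)

lemma dirC1_tendsto:
  assumes "dirC1 k n f f'" "x \<in> C"
  shows "(f \<longlongrightarrow> f x) (atin T x)" "(f' \<longlongrightarrow> f' x) (atin T x)"
  using assms by (auto simp: dirC1_def)

text \<open>As \<open>jB\<close> is continuous, pairing the Schauder expansion with the orthonormal
  eigenvectors identifies its coefficients with those of the expansion in H. The latter therefore
  converges in the norm of B.\<close>

lemma tendsto_projection:
  "(\<lambda>N. \<Sum>n<N. coef k n x *\<^sub>R jX (\<phi> n)) \<longlonglongrightarrow> jX (x k)"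
proof -
  obtain a where a: "(\<lambda>n. a n *\<^sub>R jX (\<phi> n)) sums jX (x k)"
    using basis unfolding schauder_basis_def by blast
  have "a m = coef k m x" for m
  proof -
    have bl: "bounded_linear (\<lambda>v. jB v \<bullet> jB (jX (\<phi> m)))"
      by (rule bounded_linear_compose[OF bounded_linear_inner_left blinfun.bounded_linear_right])
    have "(\<lambda>n. jB (a n *\<^sub>R jX (\<phi> n)) \<bullet> jB (jX (\<phi> m))) sums coef k m x"
      unfolding coef_def by (rule bounded_linear.sums[OF bl a])
    moreover have "(\<lambda>n. jB (a n *\<^sub>R jX (\<phi> n)) \<bullet> jB (jX (\<phi> m))) = (\<lambda>n. if n = m then a n else 0)"
      by (auto simp: blinfun.scaleR_right orthonormal)
    moreover have "(\<lambda>n. if n = m then a n else 0) sums a m" by (rule sums_single)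
    ultimately show ?thesis by (simp add: sums_unique2)
  qed
  then show ?thesis using a by (simp add: sums_def)
qed

section \<open>Integration by parts against a fixed measure\<close>

context
  fixes \<mu> assumes \<mu>: "\<mu> \<in> Mb \<gamma> jX jB A \<phi> F0 G"
begin

lemma prob: "prob_space \<mu>" and space_\<mu>: "space \<mu> = C" and sets_\<mu>: "sets \<mu> = sets (conf_borel \<gamma> jX)"
  using \<mu> by (auto simp: Mb_def)

lemma dirC1_measurable:
  fixes f :: "('z \<Rightarrow> 'x) \<Rightarrow> 'c::real_normed_vector"
  assumes "dirC1 k n f f'"
  shows "f \<in> borel_measurable \<mu>" "f' \<in> borel_measurable \<mu>"
  using measurable_of_tendsto[OF sets_\<mu>] dirC1_tendsto[OF assms] by blast+

lemma adm_measurable: "adm k K g \<Longrightarrow> g \<in> borel_measurable \<mu>"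
  unfolding adm_def using dirC1_measurable(1) by blast

lemma Lt_measurable: "Lt k \<in> borel_measurable \<mu>" by (rule dirC1_measurable(1)[OF dirC1_Lt])

lemma nB_measurable: "nB k \<in> borel_measurable \<mu>"
  unfolding nB_def[abs_def] by (intro measurable_of_tendsto[OF sets_\<mu>] tendsto_norm dirC1_tendsto(1)[OF dirC1_site])

lemma W_measurable: "W \<in> borel_measurable \<mu>" by (rule dirC1_measurable(1)[OF dirC1_W])

lemma Fn_measurable: "Fn k n \<in> borel_measurable \<mu>" by (rule dirC1_measurable(1)[OF dirC1_Fn])

lemma coef_measurable: "coef k n \<in> borel_measurable \<mu>" by (rule dirC1_measurable(1)[OF dirC1_coef])

lemma S_measurable: "S k \<in> borel_measurable \<mu>"
proof -
  have "(\<lambda>x. enn2real (\<integral>\<^sup>+ j. ennreal (J k j * nB j x powr R) \<partial>count_space UNIV)) \<in> borel_measurable \<mu>"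
    by (intro borel_measurable_enn2real borel_measurable_nn_integral_count_space measurable_compose[OF _ measurable_ennreal]
        borel_measurable_times borel_measurable_const powr_real_measurable nB_measurable)
  then show ?thesis
    by (rule measurable_cong[THEN iffD1, rotated]) (simp add: space_\<mu> S_nonneg flip: S_nn_integral)
qed

lemma integrable_bounded:
  fixes f :: "('z \<Rightarrow> 'x) \<Rightarrow> real"
  assumes "f \<in> borel_measurable \<mu>" "\<And>x. x \<in> C \<Longrightarrow> \<bar>f x\<bar> \<le> c"
  shows "integrable \<mu> f"
proof -
  interpret prob_space \<mu> by (rule prob)
  show ?thesis using assms by (intro integrable_const_bound[of _ c]) (auto simp: space_\<mu> intro!: AE_I2)
qed

context
  fixes k K g m c'
  assumes adm: "adm k K g" and K: "K \<ge> 0" and m: "r \<le> m" and g_Env: "\<And>x. x \<in> C \<Longrightarrow> g x * Env m k x \<le> c'"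
begin

lemma g_nonneg: "x \<in> C \<Longrightarrow> g x \<ge> 0" using adm by (simp add: adm_def)

lemma integrable_Z_sq:
  assumes "f \<in> borel_measurable \<mu>" "c \<ge> 0" "\<And>x. x \<in> C \<Longrightarrow> \<bar>f x\<bar> \<le> c * (Z k x)\<^sup>2"
  shows "integrable \<mu> (\<lambda>x. f x * g x)"
proof -
  obtain cz where cz: "cz \<ge> 0" "\<And>x. x \<in> C \<Longrightarrow> (Z k x)\<^sup>2 \<le> cz * Env r k x" using Z_sq_le by blast
  show ?thesis
  proof (rule integrable_bounded)
    show "(\<lambda>x. f x * g x) \<in> borel_measurable \<mu>" by (intro borel_measurable_times assms adm_measurable[OF adm])
    fix x assume x: "x \<in> C"
    have "Env r k x \<le> Env m k x" using le_Env(2)[OF m] by (simp add: Env_def)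
    then have "(Z k x)\<^sup>2 \<le> cz * Env m k x" using cz(2)[OF x] cz(1) mult_left_mono order_trans by blast
    then have "\<bar>f x\<bar> \<le> c * (cz * Env m k x)" using assms(2) assms(3)[OF x] mult_left_mono order_trans by blast
    then have "\<bar>f x * g x\<bar> \<le> c * (cz * Env m k x) * g x"
      using g_nonneg[OF x] by (simp add: abs_mult mult_right_mono)
    also have "\<dots> = c * cz * (g x * Env m k x)" by simp
    also have "\<dots> \<le> c * cz * c'" using g_Env[OF x] cz assms(2) by (intro mult_left_mono) auto
    finally show "\<bar>f x * g x\<bar> \<le> c * cz * c'" .
  qed
qed

text \<open>The test function is the product of \<open>h\<close> and \<open>g\<close>. The factor
  \<open>Z k x\<close> in the hypothesis keeps it bounded after multiplication with the weight in
  the definition of \<open>Mb\<close> and with the logarithmic gradient, and \<open>adm\<close>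
  replaces the derivative of \<open>g\<close> by \<open>K * g\<close>.\<close>

lemma integration_by_parts:
  assumes h: "dirC1 k n h h'" and c: "c \<ge> 0"
    and hb: "\<And>x. x \<in> C \<Longrightarrow> (\<bar>h x\<bar> + \<bar>h' x\<bar>) * Z k x \<le> c * Env m k x"
  shows "integrable \<mu> (\<lambda>x. h x * g x * (lam n * coef k n x + Fn k n x))"
    and "integrable \<mu> (\<lambda>x. (\<bar>h' x\<bar> + K * \<bar>h x\<bar>) * g x)"
    and "(\<integral>x. h x * g x * (lam n * coef k n x + Fn k n x) \<partial>\<mu>) \<le> (\<integral>x. (\<bar>h' x\<bar> + K * \<bar>h x\<bar>) * g x \<partial>\<mu>)"
proof -
  obtain g' where g': "dirC1 k n g g'" "\<And>x. x \<in> C \<Longrightarrow> \<bar>g' x\<bar> \<le> K * g x"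
    using adm unfolding adm_def by blast
  define B where "B = c * c'"
  have B: "\<bar>h x\<bar> * g x * Z k x \<le> B" "\<bar>h' x\<bar> * g x * Z k x \<le> B" "\<bar>h x\<bar> * g x \<le> B" "\<bar>h' x\<bar> * g x \<le> B" if x: "x \<in> C" for x
  proof -
    have z: "1 \<le> Z k x" by (rule Z_parts)
    have "(\<bar>h x\<bar> + \<bar>h' x\<bar>) * Z k x * g x \<le> c * Env m k x * g x"
      using hb[OF x] g_nonneg[OF x] by (intro mult_right_mono) auto
    also have "\<dots> = c * (g x * Env m k x)" by simp
    also have "\<dots> \<le> B" unfolding B_def using g_Env[OF x] c by (intro mult_left_mono) auto
    finally have *: "\<bar>h x\<bar> * g x * Z k x + \<bar>h' x\<bar> * g x * Z k x \<le> B" by (simp add: algebra_simps)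
    have n: "0 \<le> \<bar>h x\<bar> * g x" "0 \<le> \<bar>h' x\<bar> * g x" using g_nonneg[OF x] by auto
    then have n': "0 \<le> \<bar>h x\<bar> * g x * Z k x" "0 \<le> \<bar>h' x\<bar> * g x * Z k x" using z by auto
    show 1: "\<bar>h x\<bar> * g x * Z k x \<le> B" "\<bar>h' x\<bar> * g x * Z k x \<le> B" using * n' by linarith+
    show "\<bar>h x\<bar> * g x \<le> B" "\<bar>h' x\<bar> * g x \<le> B"
      using 1 mult_left_mono[OF z n(1)] mult_left_mono[OF z n(2)] by linarith+
  qed
  define f f' where "f x = h x * g x" and "f' x = h x * g' x + h' x * g x" for x
  have f: "dirC1 k n f f'" unfolding f_def[abs_def] f'_def[abs_def] by (intro dirC1_mult h g')
  have hg': "\<bar>h x * g' x\<bar> \<le> K * (\<bar>h x\<bar> * g x)" if "x \<in> C" for x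
    using mult_left_mono[OF g'(2)[OF that], of "\<bar>h x\<bar>"] by (simp add: abs_mult algebra_simps)
  have f'b: "\<bar>f' x\<bar> \<le> K * B + B" if x: "x \<in> C" for x
  proof -
    have "\<bar>f' x\<bar> \<le> \<bar>h x * g' x\<bar> + \<bar>h' x\<bar> * g x"
      unfolding f'_def using abs_triangle_ineq[of "h x * g' x" "h' x * g x"] g_nonneg[OF x] by (simp add: abs_mult)
    also have "\<dots> \<le> K * (\<bar>h x\<bar> * g x) + \<bar>h' x\<bar> * g x" using hg'[OF x] by simp
    also have "\<dots> \<le> K * B + B" using B[OF x] K by (intro add_mono mult_left_mono) auto
    finally show ?thesis .
  qed
  have fb: "\<bar>f x\<bar> \<le> B" if x: "x \<in> C" for x
    using B(3)[OF x] g_nonneg[OF x] by (simp add: f_def abs_mult)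
  have bdd: "bounded (f ` C)" "bounded (f' ` C)"
    using fb f'b by (auto intro!: boundedI)
  let ?c = "1 + (norm jB)\<^sup>2 + (1 + M2 + N2)"
  have "bdd_above ((\<lambda>x. \<bar>f x\<bar> * (1 + norm (h_to_dual jB (jB (jX (x k)))) + norm (Fmap F0 G k x))) ` C)"
  proof (rule bdd_aboveI2)
    fix x assume x: "x \<in> C"
    have "1 + norm (h_to_dual jB (jB (jX (x k)))) + norm (Fmap F0 G k x)
        \<le> Z k x + (norm jB)\<^sup>2 * Z k x + (1 + M2 + N2) * Z k x"
      using Z_parts(1,3)[where k = k and x = x] h_to_dual_le_Z[of x k]
      by (intro add_mono norm_Fmap_le_Z x) auto
    also have "\<dots> = ?c * Z k x" by (simp add: algebra_simps)
    finally have "\<bar>f x\<bar> * (1 + norm (h_to_dual jB (jB (jX (x k)))) + norm (Fmap F0 G k x)) \<le> \<bar>f x\<bar> * (?c * Z k x)"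
      by (intro mult_left_mono) auto
    also have "\<dots> = ?c * (\<bar>h x\<bar> * g x * Z k x)" using g_nonneg[OF x] by (simp add: f_def abs_mult)
    also have "\<dots> \<le> ?c * B" using B(1)[OF x] pos nonneg by (intro mult_left_mono) auto
    finally show "\<bar>f x\<bar> * (1 + norm (h_to_dual jB (jB (jX (x k)))) + norm (Fmap F0 G k x)) \<le> ?c * B" .
  qed
  then have eq: "(\<integral>x. conf_pd f (hdir \<phi> k n) x \<partial>\<mu>) = - (\<integral>x. f x * log_grad jX jB A \<phi> F0 G k n x \<partial>\<mu>)"
    using \<mu> dirC1_C1b(1)[OF f bdd] by (auto simp: Mb_def)
  have "(\<integral>x. conf_pd f (hdir \<phi> k n) x \<partial>\<mu>) = (\<integral>x. f' x \<partial>\<mu>)"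
    by (intro Bochner_Integration.integral_cong) (auto simp: space_\<mu> dirC1_C1b(2)[OF f bdd])
  with eq have eq': "(\<integral>x. f x * (lam n * coef k n x + Fn k n x) \<partial>\<mu>) = (\<integral>x. f' x \<partial>\<mu>)"
    unfolding log_grad_eq mult_minus_right Bochner_Integration.integral_minus by simp
  let ?d = "lam n * norm jB + \<kappa> * (1 + M2 + N2)"
  have "\<bar>f x * (lam n * coef k n x + Fn k n x)\<bar> \<le> ?d * B" if x: "x \<in> C" for x
  proof -
    have "\<bar>lam n * coef k n x + Fn k n x\<bar> \<le> lam n * \<bar>coef k n x\<bar> + \<bar>Fn k n x\<bar>"
      using lam_pos[of n] abs_triangle_ineq[of "lam n * coef k n x" "Fn k n x"] by (simp add: abs_mult)
    also have "\<dots> \<le> lam n * (norm jB * Z k x) + \<kappa> * (1 + M2 + N2) * Z k x"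
      using lam_pos[of n] coef_le_Z[of k n x]
      by (intro add_mono mult_left_mono Fn_le_Z x) auto
    also have "\<dots> = ?d * Z k x" by (simp add: algebra_simps)
    finally have "\<bar>f x * (lam n * coef k n x + Fn k n x)\<bar> \<le> \<bar>f x\<bar> * (?d * Z k x)"
      by (simp add: abs_mult mult_left_mono)
    also have "\<dots> = ?d * (\<bar>h x\<bar> * g x * Z k x)" using g_nonneg[OF x] by (simp add: f_def abs_mult)
    also have "\<dots> \<le> ?d * B"
      using B(1)[OF x] pos nonneg lam_pos[of n] \<kappa>_nonneg by (intro mult_left_mono add_nonneg_nonneg mult_nonneg_nonneg) auto
    finally show ?thesis .
  qed
  then have "integrable \<mu> (\<lambda>x. f x * (lam n * coef k n x + Fn k n x))"
    by (intro integrable_bounded[of _ "?d * B"] borel_measurable_times borel_measurable_add borel_measurable_const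
        coef_measurable Fn_measurable dirC1_measurable(1)[OF f])
  then show "integrable \<mu> (\<lambda>x. h x * g x * (lam n * coef k n x + Fn k n x))" by (simp add: f_def)
  have int_f': "integrable \<mu> f'" using f'b by (intro integrable_bounded dirC1_measurable(2)[OF f])
  have "\<bar>(\<bar>h' x\<bar> + K * \<bar>h x\<bar>) * g x\<bar> \<le> B + K * B" if x: "x \<in> C" for x
  proof -
    have "\<bar>(\<bar>h' x\<bar> + K * \<bar>h x\<bar>) * g x\<bar> = \<bar>h' x\<bar> * g x + K * (\<bar>h x\<bar> * g x)"
      using g_nonneg[OF x] K by (simp add: abs_mult algebra_simps)
    also have "\<dots> \<le> B + K * B" using B[OF x] K by (intro add_mono mult_left_mono) auto
    finally show ?thesis .
  qed
  then show int2: "integrable \<mu> (\<lambda>x. (\<bar>h' x\<bar> + K * \<bar>h x\<bar>) * g x)"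
    by (intro integrable_bounded borel_measurable_times borel_measurable_add borel_measurable_const borel_measurable_abs
        dirC1_measurable[OF h] dirC1_measurable(1)[OF g'(1)])
  have "(\<integral>x. f' x \<partial>\<mu>) \<le> (\<integral>x. (\<bar>h' x\<bar> + K * \<bar>h x\<bar>) * g x \<partial>\<mu>)"
  proof (rule integral_mono[OF int_f' int2])
    fix x assume "x \<in> space \<mu>"
    then have x: "x \<in> C" by (simp add: space_\<mu>)
    have "f' x \<le> \<bar>h x * g' x\<bar> + \<bar>h' x\<bar> * g x"
      unfolding f'_def using g_nonneg[OF x] by (intro add_mono mult_right_mono) auto
    then show "f' x \<le> (\<bar>h' x\<bar> + K * \<bar>h x\<bar>) * g x" using hg'[OF x] by (simp add: algebra_simps)
  qed
  with eq' show "(\<integral>x. h x * g x * (lam n * coef k n x + Fn k n x) \<partial>\<mu>) \<le> (\<integral>x. (\<bar>h' x\<bar> + K * \<bar>h x\<bar>) * g x \<partial>\<mu>)"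
    by (simp add: f_def)
qed


lemma integrable_energy:
  shows "integrable \<mu> (\<lambda>x. Lt k x * g x)" and "integrable \<mu> (\<lambda>x. S k x * g x)" and "integrable \<mu> g"
proof -
  show "integrable \<mu> (\<lambda>x. Lt k x * g x)"
  proof (rule integrable_Z_sq[OF Lt_measurable])
    fix x assume x: "x \<in> C"
    then show "\<bar>Lt k x\<bar> \<le> (1 + cL) * (Z k x)\<^sup>2" using Lt_le_Z[OF x] Lt_ge1[OF x, of k] by simp
  qed (use cL_bounds(1) in auto)
  show "integrable \<mu> (\<lambda>x. S k x * g x)"
    by (rule integrable_Z_sq[OF S_measurable, of 1]) (auto simp: S_nonneg S_le_Z_sq)
  have "integrable \<mu> (\<lambda>x. 1 * g x)"
    by (rule integrable_Z_sq[where c = 1]) (use Z_parts(1) in \<open>auto simp: one_le_power\<close>)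
  then show "integrable \<mu> g" by simp
qed

lemma integrable_Fn:
  shows "integrable \<mu> (\<lambda>x. Fn k n x * coef k n x * g x)" and "integrable \<mu> (\<lambda>x. (Fn k n x)\<^sup>2 * g x)"
proof -
  let ?c = "\<kappa> * (1 + M2 + N2)"
  have c: "?c \<ge> 0" using \<kappa>_nonneg pos nonneg by (intro mult_nonneg_nonneg) auto
  show "integrable \<mu> (\<lambda>x. Fn k n x * coef k n x * g x)"
  proof (rule integrable_Z_sq)
    fix x assume x: "x \<in> C"
    have "\<bar>Fn k n x\<bar> * \<bar>coef k n x\<bar> \<le> (?c * Z k x) * (norm jB * Z k x)"
      using c Z_parts(1)[of k x] by (intro mult_mono Fn_le_Z coef_le_Z x) auto
    then show "\<bar>Fn k n x * coef k n x\<bar> \<le> ?c * norm jB * (Z k x)\<^sup>2"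
      by (simp add: abs_mult power2_eq_square algebra_simps)
  qed (use c in \<open>auto intro!: borel_measurable_times Fn_measurable coef_measurable\<close>)
  show "integrable \<mu> (\<lambda>x. (Fn k n x)\<^sup>2 * g x)"
  proof (rule integrable_Z_sq)
    fix x assume x: "x \<in> C"
    have "\<bar>Fn k n x\<bar> * \<bar>Fn k n x\<bar> \<le> (?c * Z k x) * (?c * Z k x)"
      using c Z_parts(1)[of k x] by (intro mult_mono Fn_le_Z x) auto
    then show "\<bar>(Fn k n x)\<^sup>2\<bar> \<le> ?c\<^sup>2 * (Z k x)\<^sup>2"
      by (simp add: power2_eq_square algebra_simps)
  qed (auto intro!: borel_measurable_power Fn_measurable)
qed

abbreviation "Y x \<equiv> K1 * Lt k x + M1 * S k x + (N1 + K\<^sup>2)"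

lemma Y_nonneg: "x \<in> C \<Longrightarrow> Y x \<ge> 0"
  using Lt_ge1[of x k] S_nonneg[of k x] pos nonneg by (intro add_nonneg_nonneg mult_nonneg_nonneg) auto

lemma integrable_Y: "integrable \<mu> (\<lambda>x. Y x * g x)"
proof -
  have "integrable \<mu> (\<lambda>x. K1 * (Lt k x * g x) + M1 * (S k x * g x) + (N1 + K\<^sup>2) * g x)"
    by (intro Bochner_Integration.integrable_add integrable_mult_right integrable_energy)
  then show ?thesis by (simp add: algebra_simps)
qed

text \<open>The term \<open>K |F\<^sub>n| g\<close> coming from the derivative of the cutoff is absorbed by \<open>F\<^sub>n\<^sup>2 g\<close>.\<close>

lemma integral_Fn_coef_le:
  "(\<integral>x. Fn k n x * coef k n x * g x \<partial>\<mu>) \<le> inverse (lam n) * (\<integral>x. Y x * g x \<partial>\<mu>)"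
proof -
  obtain cz where cz: "cz \<ge> 0" "\<And>x. x \<in> C \<Longrightarrow> (Z k x)\<^sup>2 \<le> cz * Env r k x" using Z_sq_le by blast
  let ?c = "\<kappa> * (1 + M2 + N2) + (\<kappa> * (2 * K0 + L0) + M1 + N1)"
  have c: "?c \<ge> 0" using \<kappa>_nonneg pos nonneg by (intro add_nonneg_nonneg mult_nonneg_nonneg) auto
  have hb: "(\<bar>Fn k n x\<bar> + \<bar>dFn k n x\<bar>) * Z k x \<le> ?c * cz * Env m k x" if x: "x \<in> C" for x
  proof -
    have "(\<bar>Fn k n x\<bar> + \<bar>dFn k n x\<bar>) * Z k x \<le> (?c * Z k x) * Z k x"
      using Fn_le_Z[OF x, of k n] dFn_le_Z[OF x, of k n] Z_parts(1)[of k x]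
      by (intro mult_right_mono) (auto simp: algebra_simps)
    also have "\<dots> = ?c * (Z k x)\<^sup>2" by (simp add: power2_eq_square)
    also have "\<dots> \<le> ?c * (cz * Env m k x)"
    proof (rule mult_left_mono[OF _ c])
      have "Env r k x \<le> Env m k x" using le_Env(2)[OF m] by (simp add: Env_def)
      then show "(Z k x)\<^sup>2 \<le> cz * Env m k x" using cz(2)[OF x] cz(1) mult_left_mono order_trans by blast
    qed
    finally show ?thesis by simp
  qed
  have i2: "integrable \<mu> (\<lambda>x. (\<bar>dFn k n x\<bar> + K * \<bar>Fn k n x\<bar>) * g x)"
    and le: "(\<integral>x. Fn k n x * g x * (lam n * coef k n x + Fn k n x) \<partial>\<mu>)
      \<le> (\<integral>x. (\<bar>dFn k n x\<bar> + K * \<bar>Fn k n x\<bar>) * g x \<partial>\<mu>)"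
    using integration_by_parts[OF dirC1_Fn _ hb] c cz by auto
  have "lam n * (\<integral>x. Fn k n x * coef k n x * g x \<partial>\<mu>) + (\<integral>x. (Fn k n x)\<^sup>2 * g x \<partial>\<mu>)
      = (\<integral>x. lam n * (Fn k n x * coef k n x * g x) + (Fn k n x)\<^sup>2 * g x \<partial>\<mu>)"
    using integrable_Fn[of n] by simp
  also have "\<dots> = (\<integral>x. Fn k n x * g x * (lam n * coef k n x + Fn k n x) \<partial>\<mu>)"
    by (simp add: algebra_simps power2_eq_square)
  also have "\<dots> \<le> (\<integral>x. (\<bar>dFn k n x\<bar> + K * \<bar>Fn k n x\<bar>) * g x \<partial>\<mu>)" by (rule le)
  also have "\<dots> \<le> (\<integral>x. Y x * g x + (Fn k n x)\<^sup>2 * g x \<partial>\<mu>)"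
  proof (rule integral_mono[OF i2])
    show "integrable \<mu> (\<lambda>x. Y x * g x + (Fn k n x)\<^sup>2 * g x)"
      by (intro Bochner_Integration.integrable_add integrable_Y integrable_Fn)
    fix x assume "x \<in> space \<mu>"
    then have x: "x \<in> C" by (simp add: space_\<mu>)
    have "2 * K * \<bar>Fn k n x\<bar> \<le> K\<^sup>2 + \<bar>Fn k n x\<bar>\<^sup>2" by (rule sum_squares_bound)
    moreover have "0 \<le> K * \<bar>Fn k n x\<bar>" using K by simp
    ultimately have "\<bar>dFn k n x\<bar> + K * \<bar>Fn k n x\<bar> \<le> Y x + (Fn k n x)\<^sup>2"
      using dFn_le[OF x, of k n] by simp
    from mult_right_mono[OF this g_nonneg[OF x]]
    show "(\<bar>dFn k n x\<bar> + K * \<bar>Fn k n x\<bar>) * g x \<le> Y x * g x + (Fn k n x)\<^sup>2 * g x"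
      by (simp add: distrib_right)
  qed
  also have "\<dots> = (\<integral>x. Y x * g x \<partial>\<mu>) + (\<integral>x. (Fn k n x)\<^sup>2 * g x \<partial>\<mu>)"
    by (intro Bochner_Integration.integral_add integrable_Y integrable_Fn)
  finally have "lam n * (\<integral>x. Fn k n x * coef k n x * g x \<partial>\<mu>) \<le> (\<integral>x. Y x * g x \<partial>\<mu>)" by simp
  then show ?thesis using lam_pos[of n] by (simp add: field_simps)
qed

text \<open>The pairing of \<open>Fmap\<close> with \<open>x k\<close> is the limit of its pairings
  with the spectral projections of \<open>x k\<close>. These are bounded in B uniformly in
  \<open>N\<close> by \<open>proj_bounded\<close>, which gives domination, and the estimates of the
  single modes add up to the trace.\<close>

lemma integral_Fmap_le:
  shows "integrable \<mu> (\<lambda>x. Fmap F0 G k x (jX (x k)) * g x)"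
    and "(\<integral>x. Fmap F0 G k x (jX (x k)) * g x \<partial>\<mu>) \<le> Tr * (\<integral>x. Y x * g x \<partial>\<mu>)"
proof -
  let ?F = "Fmap F0 G k"
  obtain \<sigma> where \<sigma>: "\<And>N x. norm (\<Sum>n<N. (jB x \<bullet> jB (jX (\<phi> n))) *\<^sub>R jX (\<phi> n)) \<le> \<sigma> * norm x"
    using proj_bounded by blast
  define P where "P N x = (\<Sum>n<N. coef k n x *\<^sub>R jX (\<phi> n))" for N x
  have P: "norm (P N x) \<le> \<bar>\<sigma>\<bar> * nB k x" for N x
    using order_trans[OF \<sigma>[of "jX (x k)" N] mult_right_mono[of \<sigma> "\<bar>\<sigma>\<bar>" "norm (jX (x k))"]]
    by (simp add: P_def coef_def nB_def)
  have FP: "?F x (P N x) = (\<Sum>n<N. Fn k n x * coef k n x)" for N x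
    by (simp add: P_def blinfun.sum_right blinfun.scaleR_right Fn_def mult.commute)
  let ?b = "\<lambda>x. (1 + M2 + N2) * \<bar>\<sigma>\<bar> * ((Z k x)\<^sup>2 * g x)"
  have Z: "integrable \<mu> (\<lambda>x. (Z k x)\<^sup>2 * g x)"
  proof (rule integrable_Z_sq[where c = 1])
    have "Z k \<in> borel_measurable \<mu>"
      unfolding Z_def[abs_def] nF_def
      by (intro borel_measurable_add borel_measurable_const nB_measurable powr_real_measurable S_measurable
          measurable_of_tendsto[OF sets_\<mu>] tendsto_norm dirC1_tendsto(1)[OF dirC1_site_fun[OF F0_C1]])
    then show "(\<lambda>x. (Z k x)\<^sup>2) \<in> borel_measurable \<mu>" by (intro borel_measurable_power)
  qed auto
  have bound: "norm (?F x (P N x) * g x) \<le> ?b x" if x: "x \<in> C" for N x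
  proof -
    have "\<bar>?F x (P N x)\<bar> \<le> norm (?F x) * norm (P N x)" by (metis norm_blinfun real_norm_def)
    also have "\<dots> \<le> ((1 + M2 + N2) * Z k x) * (\<bar>\<sigma>\<bar> * Z k x)"
      using P[of N x] Z_parts(1)[of k x] Z_parts(3)[of k x] pos nonneg
      by (intro mult_mono norm_Fmap_le_Z x order_trans[OF P mult_left_mono]) auto
    also have "\<dots> = (1 + M2 + N2) * \<bar>\<sigma>\<bar> * (Z k x)\<^sup>2" by (simp add: power2_eq_square algebra_simps)
    finally have "\<bar>?F x (P N x)\<bar> * g x \<le> (1 + M2 + N2) * \<bar>\<sigma>\<bar> * (Z k x)\<^sup>2 * g x"
      by (rule mult_right_mono) (rule g_nonneg[OF x])
    then show ?thesis using g_nonneg[OF x] by (simp add: abs_mult mult.assoc)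
  qed
  have meas: "(\<lambda>x. ?F x (P N x) * g x) \<in> borel_measurable \<mu>" for N
    unfolding FP by (intro borel_measurable_times borel_measurable_sum Fn_measurable coef_measurable
        adm_measurable[OF adm])
  have lim: "(\<lambda>N. ?F x (P N x) * g x) \<longlonglongrightarrow> ?F x (jX (x k)) * g x" for x
    unfolding P_def by (intro tendsto_mult tendsto_const bounded_linear.tendsto[OF blinfun.bounded_linear_right] tendsto_projection)
  have meas': "(\<lambda>x. ?F x (jX (x k)) * g x) \<in> borel_measurable \<mu>"
    by (rule borel_measurable_LIMSEQ_real[OF lim meas])
  have b: "AE x in \<mu>. norm (?F x (P N x) * g x) \<le> ?b x" for N
    using bound by (intro AE_I2) (simp add: space_\<mu>)
  have int_b: "integrable \<mu> ?b" using Z by (rule integrable_mult_right)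
  show "integrable \<mu> (\<lambda>x. ?F x (jX (x k)) * g x)"
    by (rule integrable_dominated_convergence[where s = "\<lambda>N x. ?F x (P N x) * g x", OF meas' meas int_b _ b]) (intro AE_I2 lim)
  have "(\<lambda>N. \<integral>x. ?F x (P N x) * g x \<partial>\<mu>) \<longlonglongrightarrow> (\<integral>x. ?F x (jX (x k)) * g x \<partial>\<mu>)"
    by (rule integral_dominated_convergence[OF meas' meas int_b _ b]) (intro AE_I2 lim)
  moreover have "(\<integral>x. ?F x (P N x) * g x \<partial>\<mu>) \<le> Tr * (\<integral>x. Y x * g x \<partial>\<mu>)" for N
  proof -
    have "(\<integral>x. ?F x (P N x) * g x \<partial>\<mu>) = (\<Sum>n<N. \<integral>x. Fn k n x * coef k n x * g x \<partial>\<mu>)"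
      unfolding FP sum_distrib_right by (intro Bochner_Integration.integral_sum integrable_Fn)
    also have "\<dots> \<le> (\<Sum>n<N. inverse (lam n) * (\<integral>x. Y x * g x \<partial>\<mu>))"
      by (intro sum_mono integral_Fn_coef_le)
    also have "\<dots> = (\<Sum>n<N. inverse (lam n)) * (\<integral>x. Y x * g x \<partial>\<mu>)" by (simp add: sum_distrib_right)
    \<comment> \<open>The integral of \<open>Y x * g x\<close> is nonnegative, so the partial sums
      of \<open>inverse (lam n)\<close> may be enlarged to \<open>Tr\<close>.\<close>
    also have "\<dots> \<le> Tr * (\<integral>x. Y x * g x \<partial>\<mu>)"
      using Y_nonneg g_nonneg by (intro mult_right_mono sum_inverse_lam_le integral_nonneg_AE AE_I2)
        (auto simp: space_\<mu>)
    finally show ?thesis .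
  qed
  ultimately show "(\<integral>x. ?F x (jX (x k)) * g x \<partial>\<mu>) \<le> Tr * (\<integral>x. Y x * g x \<partial>\<mu>)"
    by (intro LIMSEQ_le_const2) auto
qed

text \<open>The pairing of \<open>F0\<close> with \<open>x k\<close> is \<open>Lt - cL\<close>, and
  \<open>GG2\<close> controls that of \<open>G\<close>. The cutoff constant \<open>K\<close> occurs
  only in the coefficient of the integral of \<open>g\<close>; hence a higher power of
  \<open>Lt\<close> in the cutoff leaves the smallness condition unchanged.\<close>

lemma energy_inequality:
  "(1 - K1 * Tr) * (\<integral>x. Lt k x * g x \<partial>\<mu>)
    \<le> (M2 + M1 * Tr) * (\<integral>x. S k x * g x \<partial>\<mu>) + (cL + N2 + Tr * (N1 + K\<^sup>2)) * (\<integral>x. g x \<partial>\<mu>)"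
proof -
  have "(\<integral>x. Lt k x * g x - M2 * (S k x * g x) - (cL + N2) * g x \<partial>\<mu>) \<le> (\<integral>x. Fmap F0 G k x (jX (x k)) * g x \<partial>\<mu>)"
  proof (rule integral_mono[OF _ integral_Fmap_le(1)])
    show "integrable \<mu> (\<lambda>x. Lt k x * g x - M2 * (S k x * g x) - (cL + N2) * g x)"
      by (intro Bochner_Integration.integrable_diff integrable_mult_right integrable_energy)
    fix x assume "x \<in> space \<mu>"
    then have x: "x \<in> C" by (simp add: space_\<mu>)
    have "Lt k x - M2 * S k x - (cL + N2) \<le> Fmap F0 G k x (jX (x k))"
      using GG2[OF x, of k] norm_ge_zero[of "G k x"] abs_ge_minus_self[of "G k x (jX (x k))"]
      unfolding Fmap_def blinfun.add_left Lt_def Lfun_def S_def nB_def by linarith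
    from mult_right_mono[OF this g_nonneg[OF x]]
    show "Lt k x * g x - M2 * (S k x * g x) - (cL + N2) * g x \<le> Fmap F0 G k x (jX (x k)) * g x"
      by (simp add: algebra_simps)
  qed
  also have "\<dots> \<le> Tr * (\<integral>x. Y x * g x \<partial>\<mu>)" by (rule integral_Fmap_le)
  also have "(\<integral>x. Y x * g x \<partial>\<mu>) = (\<integral>x. K1 * (Lt k x * g x) + M1 * (S k x * g x) + (N1 + K\<^sup>2) * g x \<partial>\<mu>)"
    by (simp add: algebra_simps)
  finally show ?thesis using integrable_energy by (simp add: algebra_simps)
qed

end

end

subsection \<open>Iteration over the lattice\<close>

lemma weighted_sum:
  fixes c :: "'z \<Rightarrow> real"
  assumes c0: "\<And>k. c k \<ge> 0" and s: "\<And>j. c j \<le> s * \<gamma> (k - j) powr R" "s \<ge> 0"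
  shows "(\<lambda>j. J k j * c j) summable_on UNIV" and "(\<Sum>\<^sub>\<infinity>j. J k j * c j) \<le> s * Jn"
proof -
  have *: "J k j * c j \<le> s * (J k j * \<gamma> (k - j) powr R)" for j
    using mult_left_mono[OF s(1) J_nonneg[of k j]] by (simp add: algebra_simps)
  have sm: "(\<lambda>j. s * (J k j * \<gamma> (k - j) powr R)) summable_on UNIV"
    by (intro summable_on_cmult_right J_weighted)
  show 1: "(\<lambda>j. J k j * c j) summable_on UNIV"
    by (rule summable_on_comparison_test[OF sm]) (use * J_nonneg c0 in auto)
  have "(\<Sum>\<^sub>\<infinity>j. J k j * c j) \<le> (\<Sum>\<^sub>\<infinity>j. s * (J k j * \<gamma> (k - j) powr R))"
    using * by (intro infsum_mono 1 sm) auto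
  also have "\<dots> = s * (\<Sum>\<^sub>\<infinity>j. J k j * \<gamma> (k - j) powr R)" by (rule infsum_cmult_right')
  also have "\<dots> \<le> s * Jn" using s(2) by (intro mult_left_mono J_weighted) auto
  finally show "(\<Sum>\<^sub>\<infinity>j. J k j * c j) \<le> s * Jn" .
qed

lemma \<gamma>_powr_le: "\<gamma> j powr R \<le> \<gamma> k powr R * \<gamma> (k - j) powr R"
  using powr_mono2[OF _ _ \<gamma>_le[of j k], of R] R \<gamma>_pos[of j] \<gamma>_pos[of k] \<gamma>_pos[of "k - j"]
  by (simp add: powr_mult)

lemma weighted_summable:
  fixes c :: "'z \<Rightarrow> real"
  assumes c0: "\<And>k. c k \<ge> 0" and c_le: "\<And>k. c k \<le> v * \<gamma> k powr R"
  shows "(\<lambda>j. J k j * c j) summable_on UNIV"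
proof (rule weighted_sum(1)[where s = "v * \<gamma> k powr R", OF c0])
  have "0 \<le> v * \<gamma> 0 powr R" by (rule order_trans[OF c0 c_le])
  then have v: "v \<ge> 0" using \<gamma>_pos[of 0] by (auto simp: zero_le_mult_iff)
  then show "v * \<gamma> k powr R \<ge> 0" by simp
  show "c j \<le> v * \<gamma> k powr R * \<gamma> (k - j) powr R" for j
    using c_le[of j] mult_left_mono[OF \<gamma>_powr_le[of j k] v] by (simp add: algebra_simps)
qed

text \<open>Division by \<open>\<gamma> (l - k) powr R\<close> makes the sequence bounded, and
  submultiplicativity turns the hypothesis into an inequality for its supremum \<open>m\<close>,
  which is finite and can be moved to the left side. Centring the weights at the site
  \<open>k\<close> under consideration makes the result independent of \<open>k\<close>. The a
  priori constant \<open>v\<close> yields the finiteness of \<open>m\<close> and does not appear in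
  the conclusion.\<close>

lemma weighted_iteration:
  fixes c :: "'z \<Rightarrow> real"
  assumes c0: "\<And>k. c k \<ge> 0" and c_le: "\<And>k. c k \<le> v * \<gamma> k powr R"
    and b: "b \<ge> 0" "b * Jn < a" and e: "e \<ge> 0"
    and c: "\<And>k. a * c k \<le> b * (\<Sum>\<^sub>\<infinity>j. J k j * c j) + e"
  shows "c k \<le> \<gamma> 0 powr R * (e / (a - b * Jn))"
proof -
  have "0 \<le> v * \<gamma> 0 powr R" by (rule order_trans[OF c0 c_le])
  then have v: "v \<ge> 0" using \<gamma>_pos[of 0] by (auto simp: zero_le_mult_iff)
  define u where "u l = c l / \<gamma> (l - k) powr R" for l
  have p: "\<gamma> l powr R > 0" for l using \<gamma>_powr_ge1[of l] by linarith
  have u_le: "u l \<le> v * \<gamma> k powr R" for l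
  proof -
    have "c l \<le> v * (\<gamma> k powr R * \<gamma> (k - l) powr R)"
      using c_le[of l] mult_left_mono[OF \<gamma>_powr_le[of l k] v] by linarith
    then show ?thesis using p[of "l - k"] \<gamma>_diff_commute[of k l]
      by (simp add: u_def pos_divide_le_eq mult.assoc)
  qed
  then have bdd: "bdd_above (range u)" by (intro bdd_aboveI2)
  define m where "m = (SUP l. u l)"
  have um: "u l \<le> m" for l unfolding m_def by (rule cSUP_upper[OF _ bdd]) simp
  have m0: "m \<ge> 0" using um[of k] c0[of k] p[of "k - k"] by (smt (verit) u_def divide_nonneg_pos)
  have cm: "c l \<le> m * \<gamma> (l - k) powr R" for l
    using um[of l] p[of "l - k"] by (simp add: u_def pos_divide_le_eq)
  have "a * u l \<le> b * m * Jn + e" for l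
  proof -
    have "c j \<le> m * \<gamma> (l - k) powr R * \<gamma> (l - j) powr R" for j
    proof -
      have "\<gamma> (j - k) \<le> \<gamma> (l - k) * \<gamma> (l - j)" using \<gamma>_triangle[of j k l] \<gamma>_diff_commute[of j l] by (simp add: mult.commute)
      then have "\<gamma> (j - k) powr R \<le> \<gamma> (l - k) powr R * \<gamma> (l - j) powr R"
        using powr_mono2[of R "\<gamma> (j - k)" "\<gamma> (l - k) * \<gamma> (l - j)"] R \<gamma>_pos[of "j - k"] \<gamma>_pos[of "l - k"] \<gamma>_pos[of "l - j"]
        by (simp add: powr_mult)
      from mult_left_mono[OF this m0] cm[of j] show ?thesis by (simp add: mult.assoc)
    qed
    from weighted_sum(2)[OF c0 this] have "(\<Sum>\<^sub>\<infinity>j. J l j * c j) \<le> m * \<gamma> (l - k) powr R * Jn" using m0 by simp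
    from mult_left_mono[OF this b(1)] have "a * c l \<le> b * (m * \<gamma> (l - k) powr R * Jn) + e" using c[of l] by linarith
    also have "\<dots> \<le> b * (m * \<gamma> (l - k) powr R * Jn) + e * \<gamma> (l - k) powr R"
      using mult_left_mono[OF \<gamma>_powr_ge1[of "l - k"] e] by simp
    also have "\<dots> = (b * m * Jn + e) * \<gamma> (l - k) powr R" by (simp add: algebra_simps)
    finally show ?thesis using p[of "l - k"] by (simp add: u_def pos_divide_le_eq)
  qed
  moreover have a: "a > 0" using b Jn_nonneg by (smt (verit) mult_nonneg_nonneg)
  ultimately have "u l \<le> (b * m * Jn + e) / a" for l by (simp add: pos_le_divide_eq mult.commute)
  then have "m \<le> (b * m * Jn + e) / a" unfolding m_def by (intro cSUP_least) auto
  then have "m * (a - b * Jn) \<le> e" using a by (simp add: pos_le_divide_eq algebra_simps)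
  then have m: "m \<le> e / (a - b * Jn)" using b by (simp add: pos_le_divide_eq)
  have "c k \<le> m * \<gamma> 0 powr R" using cm[of k] by simp
  also have "\<dots> \<le> e / (a - b * Jn) * \<gamma> 0 powr R" using m by (intro mult_right_mono) auto
  finally show "c k \<le> \<gamma> 0 powr R * (e / (a - b * Jn))" by (simp add: mult.commute)
qed

text \<open>The coefficient of the integral of \<open>g\<close> in \<open>energy_inequality\<close>,
  with \<open>K\<close> the constant of \<open>adm_cutoff\<close>; neither cutoff parameter occurs
  in it.\<close>

definition cE :: "nat \<Rightarrow> nat \<Rightarrow> real" where
  "cE q m = cL + N2 + Tr * (N1 + (real q * (K1 + K2) + real m * \<kappa> + cU)\<^sup>2)"

lemma cE_pos: "cE q m > 0"
  using cL_bounds(1) nonneg Tr_pos by (auto simp: cE_def intro!: add_pos_nonneg)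

lemma adm_const_nonneg: "real q * (K1 + K2) + real m * \<kappa> + cU \<ge> 0"
  using pos nonneg \<kappa>_nonneg unfolding cU_def by (intro add_nonneg_nonneg mult_nonneg_nonneg) auto

context
  fixes \<mu> assumes \<mu>: "\<mu> \<in> Mb \<gamma> jX jB A \<phi> F0 G"
begin

lemmas [measurable] = Lt_measurable[OF \<mu>] S_measurable[OF \<mu>] W_measurable[OF \<mu>] psi_measurable

lemma gW_measurable [measurable]: "gW m e \<in> borel_measurable \<mu>"
  unfolding gW_def[abs_def] by measurable

text \<open>The energy inequality in nonnegative integrals, which remain meaningful when a cutoff is
  removed before finiteness is known.\<close>

lemma energy_cutoff:
  fixes k q
  assumes e: "0 < e" "e \<le> 1" and e': "0 < e'" and m: "r \<le> m" and Xi: "K1 * Tr < 1"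
  defines "g \<equiv> \<lambda>x. psi q e (Lt k x) * gW m e x * gU e' k x"
  shows "ennreal (1 - K1 * Tr) * (\<integral>\<^sup>+ x. ennreal (Lt k x * g x) \<partial>\<mu>)
    \<le> ennreal (M2 + M1 * Tr) * (\<integral>\<^sup>+ x. ennreal (S k x * g x) \<partial>\<mu>) + ennreal (cE q m) * (\<integral>\<^sup>+ x. ennreal (g x) \<partial>\<mu>)"
proof -
  have Env: "\<And>x. x \<in> C \<Longrightarrow> g x * Env m k x \<le> inverse e ^ q * inverse e ^ m * (1 + inverse e')"
    unfolding g_def by (rule cutoff_Env[OF e e'])
  have adm: "adm k (real q * (K1 + K2) + real m * \<kappa> + cU) g" unfolding g_def by (rule adm_cutoff[OF e e'])
  have g0: "x \<in> space \<mu> \<Longrightarrow> 0 \<le> g x" for x using adm by (simp add: adm_def space_\<mu>[OF \<mu>])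
  have L0: "x \<in> space \<mu> \<Longrightarrow> 0 \<le> Lt k x" for x using Lt_ge1[of x k] by (simp add: space_\<mu>[OF \<mu>])
  note hyps = \<mu> adm adm_const_nonneg m Env
  note I = integrable_energy[OF hyps]
  have eq: "(\<integral>\<^sup>+ x. ennreal (Lt k x * g x) \<partial>\<mu>) = ennreal (\<integral>x. Lt k x * g x \<partial>\<mu>)"
    "(\<integral>\<^sup>+ x. ennreal (S k x * g x) \<partial>\<mu>) = ennreal (\<integral>x. S k x * g x \<partial>\<mu>)"
    "(\<integral>\<^sup>+ x. ennreal (g x) \<partial>\<mu>) = ennreal (\<integral>x. g x \<partial>\<mu>)"
    using g0 L0 S_nonneg by (auto intro!: nn_integral_eq_integral I AE_I2)
  have n: "0 \<le> (\<integral>x. Lt k x * g x \<partial>\<mu>)" "0 \<le> (\<integral>x. S k x * g x \<partial>\<mu>)" "0 \<le> (\<integral>x. g x \<partial>\<mu>)"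
    using g0 L0 S_nonneg by (auto intro!: integral_nonneg_AE AE_I2)
  have T: "0 \<le> M2 + M1 * Tr" using pos Tr_pos by simp
  show ?thesis
    unfolding eq using energy_inequality[OF hyps] n T Xi cE_pos[of q m]
    by (simp add: ennreal_mult[symmetric] ennreal_plus[symmetric] cE_def ennreal_leI del: ennreal_plus)
qed

text \<open>\<open>gU\<close> disappears by Fatou's lemma on the left and by
  \<open>gU \<le> 1\<close> on the right. Apart from \<open>psi\<close>, the remaining cutoff does
  not depend on the site.\<close>

lemma energy_limit:
  fixes k q
  assumes e: "0 < e" "e \<le> 1" and m: "r \<le> m" and Xi: "K1 * Tr < 1"
  defines "g \<equiv> \<lambda>x. psi q e (Lt k x) * gW m e x"
  shows "ennreal (1 - K1 * Tr) * (\<integral>\<^sup>+ x. ennreal (Lt k x * g x) \<partial>\<mu>)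
    \<le> ennreal (M2 + M1 * Tr) * (\<integral>\<^sup>+ x. ennreal (S k x * g x) \<partial>\<mu>) + ennreal (cE q m) * (\<integral>\<^sup>+ x. ennreal (g x) \<partial>\<mu>)"
proof -
  define h where "h i x = gU (inverse (real (Suc i))) k x" for i x
  have h_meas [measurable]: "h i \<in> borel_measurable \<mu>" for i
    unfolding h_def[abs_def] by (rule adm_measurable[OF \<mu> adm_gU]) simp
  have L0: "x \<in> space \<mu> \<Longrightarrow> 0 \<le> Lt k x" for x using Lt_ge1[of x k] by (simp add: space_\<mu>[OF \<mu>])
  have g0: "x \<in> space \<mu> \<Longrightarrow> 0 \<le> g x" for x
    unfolding g_def using L0 e gW_bounds(1)[of e m x] by (intro mult_nonneg_nonneg psi_nonneg) auto
  have h1: "0 \<le> h i x" "h i x \<le> 1" for i x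
    unfolding h_def using gU_bounds[of "inverse (real (Suc i))" k x] by auto
  have [measurable]: "g \<in> borel_measurable \<mu>" unfolding g_def by measurable
  have "(\<integral>\<^sup>+ x. ennreal (1 - K1 * Tr) * ennreal (Lt k x * g x) \<partial>\<mu>)
    \<le> ennreal (M2 + M1 * Tr) * (\<integral>\<^sup>+ x. ennreal (S k x * g x) \<partial>\<mu>) + ennreal (cE q m) * (\<integral>\<^sup>+ x. ennreal (g x) \<partial>\<mu>)"
  proof (rule nn_integral_le_of_tendsto)
    show "(\<lambda>x. ennreal (1 - K1 * Tr) * ennreal (Lt k x * (g x * h i x))) \<in> borel_measurable \<mu>" for i by measurable
    fix x assume x: "x \<in> space \<mu>"
    have "(\<lambda>i. h i x) \<longlonglongrightarrow> inverse (1 + 0 * U k x)"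
      unfolding h_def gU_def by (intro tendsto_intros LIMSEQ_inverse_real_of_nat) auto
    then have "(\<lambda>i. Lt k x * (g x * h i x)) \<longlonglongrightarrow> Lt k x * (g x * 1)" by (intro tendsto_intros) auto
    then show "(\<lambda>i. ennreal (1 - K1 * Tr) * ennreal (Lt k x * (g x * h i x))) \<longlonglongrightarrow> ennreal (1 - K1 * Tr) * ennreal (Lt k x * g x)"
      by (intro ennreal_tendsto_cmult tendsto_ennrealI) auto
  next
    fix i
    have "(\<integral>\<^sup>+ x. ennreal (1 - K1 * Tr) * ennreal (Lt k x * (g x * h i x)) \<partial>\<mu>)
        = ennreal (1 - K1 * Tr) * (\<integral>\<^sup>+ x. ennreal (Lt k x * (g x * h i x)) \<partial>\<mu>)"
      by (intro nn_integral_cmult) measurable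
    also have "\<dots> \<le> ennreal (M2 + M1 * Tr) * (\<integral>\<^sup>+ x. ennreal (S k x * (g x * h i x)) \<partial>\<mu>)
        + ennreal (cE q m) * (\<integral>\<^sup>+ x. ennreal (g x * h i x) \<partial>\<mu>)"
      unfolding g_def h_def by (rule energy_cutoff[OF e _ m Xi]) simp
    also have "\<dots> \<le> ennreal (M2 + M1 * Tr) * (\<integral>\<^sup>+ x. ennreal (S k x * g x) \<partial>\<mu>) + ennreal (cE q m) * (\<integral>\<^sup>+ x. ennreal (g x) \<partial>\<mu>)"
      using g0 h1 S_nonneg
      by (intro add_mono mult_left_mono nn_integral_mono ennreal_leI mult_left_le) auto
    finally show "(\<integral>\<^sup>+ x. ennreal (1 - K1 * Tr) * ennreal (Lt k x * (g x * h i x)) \<partial>\<mu>) \<le> \<dots>" .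
  qed
  then show ?thesis by (subst (asm) nn_integral_cmult) auto
qed

end

definition T1 :: real where "T1 = (M2 + M1 * Tr) * K3"
text \<open>Half of the gap left by the smallness condition: one \<open>\<delta>\<close> absorbs the
  integral of the weight, the other remains after the interaction has been subtracted.\<close>

definition \<delta> :: real where "\<delta> = (1 - K1 * Tr - T1 * Jn) / 2"
text \<open>Where \<open>\<delta> * Lt k x\<close> is below \<open>cE q m\<close>, the weight is at
  most \<open>(cE q m / \<delta>) ^ q\<close>; elsewhere it is absorbed by the term with
  \<open>\<delta>\<close>.\<close>

definition c5 :: "nat \<Rightarrow> nat \<Rightarrow> real" where "c5 q m = cE q m * (cE q m / \<delta>) ^ q"
definition cB :: "nat \<Rightarrow> nat \<Rightarrow> real" where
  "cB q m = (T1 * (Jn * (\<gamma> 0 powr R * (c5 q m / \<delta>))) + c5 q m) / \<delta>"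

lemma T1_pos: "T1 > 0" using pos Tr_pos by (simp add: T1_def add_pos_nonneg)

context
  fixes \<mu> assumes \<mu>: "\<mu> \<in> Mb \<gamma> jX jB A \<phi> F0 G" and small: "T1 * Jn < 1 - K1 * Tr"
begin

lemma \<delta>_pos: "\<delta> > 0" and \<delta>_eq: "1 - K1 * Tr - \<delta> = T1 * Jn + \<delta>"
  using small by (auto simp: \<delta>_def field_simps)

lemma Xi: "K1 * Tr < 1" using small mult_nonneg_nonneg[OF less_imp_le[OF T1_pos] Jn_nonneg] by linarith

lemma c5_nonneg: "c5 q m \<ge> 0" using cE_pos[of q m] \<delta>_pos by (simp add: c5_def)

lemmas [measurable] = Lt_measurable[OF \<mu>] S_measurable[OF \<mu>] W_measurable[OF \<mu>] psi_measurable gW_measurable[OF \<mu>]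

text \<open>Two sequences are estimated together: \<open>b k\<close>, the quantity wanted, and
  \<open>c k\<close>, built from the convex primitive. The tangent inequality bounds the mixed
  integral by \<open>b k - c k + c j\<close>, where the other site enters through \<open>c\<close>
  alone. So \<open>c\<close> is the sequence that can be iterated, and the bound for
  \<open>b\<close> is read off afterwards.\<close>

lemma integral_Lt_psi_le:
  fixes k q m
  assumes e: "0 < e" "e \<le> 1" and m: "r \<le> m"
  shows "(\<integral>\<^sup>+ x. ennreal (Lt k x * (psi q e (Lt k x) * gW m e x)) \<partial>\<mu>) \<le> ennreal (cB q m)"
proof -
  interpret prob_space \<mu> by (rule prob[OF \<mu>])
  note sp = space_\<mu>[OF \<mu>]
  define w where "w k x = psi q e (Lt k x) * gW m e x" for k x
  define P where "P k x = Psi q e (Lt k x) * gW m e x" for k x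
  define b where "b k = (\<integral>x. Lt k x * w k x \<partial>\<mu>)" for k
  define c where "c k = (\<integral>x. P k x \<partial>\<mu>)" for k
  let ?S = "\<lambda>k. \<integral>x. S k x * w k x \<partial>\<mu>" and ?L = "\<lambda>k. \<integral>\<^sup>+ x. ennreal (Lt k x * w k x) \<partial>\<mu>"
  have [measurable]: "Psi q e \<in> borel_measurable borel" by (rule Psi_measurable[OF e(1)])
  have [measurable]: "w k \<in> borel_measurable \<mu>" "P k \<in> borel_measurable \<mu>" for k
    unfolding w_def[abs_def] P_def[abs_def] by measurable
  have gW: "0 < gW m e x" "gW m e x \<le> 1" for x using gW_bounds[OF e(1)] by auto
  have L1: "x \<in> C \<Longrightarrow> 1 \<le> Lt k x" for k x by (rule Lt_ge1)
  then have L0: "x \<in> C \<Longrightarrow> 0 \<le> Lt k x" for k x using order_trans zero_le_one by blast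
  have w0: "0 \<le> w k x" if "x \<in> C" for k x
    unfolding w_def using gW[of x] psi_nonneg[OF L0[OF that] e(1)] by simp
  have w_le: "w k x \<le> inverse e ^ q" if x: "x \<in> C" for k x
    unfolding w_def using mult_mono[OF psi_le[OF L0[OF x] e(1)] gW(2)] gW[of x] e by simp
  have int_w: "integrable \<mu> (w k)" for k
    by (rule integrable_bounded[OF \<mu>, of _ "inverse e ^ q"]) (use w0 w_le in auto)
  define BS where "BS = Jn * inverse e ^ m * inverse e ^ q"
  \<comment> \<open>This bound depends on \<open>e\<close>, but its growth in \<open>k\<close> is
    the one that \<open>weighted_iteration\<close> admits.\<close>
  have Sw_le: "S k x * w k x \<le> \<gamma> k powr R * BS" if x: "x \<in> C" for k x
  proof -
    have "S k x \<le> (\<gamma> k * W x) powr (R / 2) * Jn" by (rule S_summable(2)[OF x])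
    also have "(\<gamma> k * W x) powr (R / 2) = \<gamma> k powr (R / 2) * W x powr (R / 2)"
      using \<gamma>_pos[of k] by (simp add: powr_mult)
    also have "\<gamma> k powr (R / 2) * W x powr (R / 2) * Jn \<le> \<gamma> k powr R * (1 + W x) ^ m * Jn"
    proof (intro mult_right_mono mult_mono Jn_nonneg)
      show "\<gamma> k powr (R / 2) \<le> \<gamma> k powr R" using \<gamma>_ge1[of k] R by (intro powr_mono) auto
      have "W x powr (R / 2) \<le> (1 + W x) powr (R / 2)" using R by (intro powr_mono2) auto
      also have "\<dots> \<le> (1 + W x) powr real m" using R R_le_r m by (intro powr_mono) auto
      also have "\<dots> = (1 + W x) ^ m" by (intro powr_realpow add_pos_nonneg) auto
      finally show "W x powr (R / 2) \<le> (1 + W x) ^ m" .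
    qed auto
    finally have "S k x * w k x \<le> \<gamma> k powr R * (1 + W x) ^ m * Jn * w k x"
      using w0[OF x] by (intro mult_right_mono) auto
    also have "\<dots> = \<gamma> k powr R * (Jn * (gW m e x * (1 + W x) ^ m) * psi q e (Lt k x))"
      by (simp add: w_def algebra_simps)
    also have "\<dots> \<le> \<gamma> k powr R * BS"
      unfolding BS_def using gW[of x] e psi_nonneg[OF L0[OF x] e(1)] Jn_nonneg
      by (intro mult_left_mono mult_mono gW_W_le[OF e] psi_le[OF L0[OF x] e(1)]) auto
    finally show ?thesis .
  qed
  have int_Sw: "integrable \<mu> (\<lambda>x. S k x * w k x)" for k
    by (rule integrable_bounded[OF \<mu>, of _ "\<gamma> k powr R * BS"]) (use Sw_le w0 S_nonneg in auto)
  have nnS: "(\<integral>\<^sup>+ x. ennreal (S k x * w k x) \<partial>\<mu>) = ennreal (?S k)" for k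
    using w0 S_nonneg by (intro nn_integral_eq_integral int_Sw AE_I2) (auto simp: sp)
  have nnw: "(\<integral>\<^sup>+ x. ennreal (w k x) \<partial>\<mu>) = ennreal (\<integral>x. w k x \<partial>\<mu>)" for k
    using w0 by (intro nn_integral_eq_integral int_w AE_I2) (auto simp: sp)
  have Sw0: "0 \<le> ?S k" and w0': "0 \<le> (\<integral>x. w k x \<partial>\<mu>)" for k
    using w0 S_nonneg by (auto intro!: integral_nonneg_AE AE_I2 simp: sp)
  have T0: "0 \<le> M2 + M1 * Tr" using pos Tr_pos by simp
  have lim: "ennreal (1 - K1 * Tr) * ?L k
      \<le> ennreal ((M2 + M1 * Tr) * ?S k + cE q m * (\<integral>x. w k x \<partial>\<mu>))" for k
    using energy_limit[OF \<mu> e m Xi, where k = k and q = q] T0 Sw0[of k] w0'[of k] cE_pos[of q m]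
    unfolding w_def[symmetric] nnS nnw
    by (simp add: ennreal_mult[symmetric] ennreal_plus[symmetric] del: ennreal_plus)
  \<comment> \<open>Integrability comes from the inequality itself, whose right side is finite for
    fixed \<open>e\<close>.\<close>
  have int_Lw: "integrable \<mu> (\<lambda>x. Lt k x * w k x)" for k
  proof (rule integrableI_nonneg)
    have "?L k \<noteq> \<top>"
    proof
      assume "?L k = \<top>"
      with lim[of k] Xi show False by (simp add: ennreal_mult_top top_unique)
    qed
    then show "?L k < \<infinity>" by (simp add: less_top)
  qed (use L0 w0 in \<open>auto intro!: AE_I2 simp: sp\<close>)
  have nnL: "?L k = ennreal (b k)" for k
    unfolding b_def using L0 w0 by (intro nn_integral_eq_integral int_Lw AE_I2) (auto simp: sp)
  have b0: "0 \<le> b k" for k unfolding b_def using L0 w0 by (auto intro!: integral_nonneg_AE AE_I2 simp: sp)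
  have main: "(1 - K1 * Tr) * b k \<le> (M2 + M1 * Tr) * ?S k + cE q m * (\<integral>x. w k x \<partial>\<mu>)" for k
  proof -
    have "0 \<le> (M2 + M1 * Tr) * ?S k + cE q m * (\<integral>x. w k x \<partial>\<mu>)"
      by (rule add_nonneg_nonneg[OF mult_nonneg_nonneg[OF T0 Sw0] mult_nonneg_nonneg[OF less_imp_le[OF cE_pos] w0']])
    then show ?thesis using lim[of k] Xi b0[of k] by (simp add: nnL ennreal_mult[symmetric])
  qed
  have P0: "0 \<le> P k x" for k x unfolding P_def using Psi_nonneg[OF e(1)] gW[of x] by simp
  have P_le: "P k x \<le> Lt k x * w k x" if x: "x \<in> C" for k x
    unfolding P_def w_def using mult_right_mono[OF Psi_le[OF e(1) L0[OF x]], of "gW m e x"] gW[of x]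
    by (simp add: mult.assoc)
  have int_P: "integrable \<mu> (P k)" for k
    by (rule Bochner_Integration.integrable_bound[OF int_Lw]) (use P0 P_le L0 w0 in \<open>auto intro!: AE_I2 simp: sp\<close>)
  have c0: "0 \<le> c k" for k unfolding c_def using P0 by (intro integral_nonneg_AE) auto
  have cb: "c k \<le> b k" for k
    unfolding c_def b_def using P_le by (intro integral_mono int_P int_Lw) (auto simp: sp)
  define v where "v = ((M2 + M1 * Tr) * BS + cE q m * inverse e ^ q) / (1 - K1 * Tr)"
  have c_le: "c k \<le> v * \<gamma> k powr R" for k
  proof -
    have "?S k \<le> \<gamma> k powr R * BS"
      using Sw_le by (intro integral_le_const int_Sw AE_I2) (auto simp: sp)
    moreover have "(\<integral>x. w k x \<partial>\<mu>) \<le> inverse e ^ q * \<gamma> k powr R"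
    proof -
      have "(\<integral>x. w k x \<partial>\<mu>) \<le> inverse e ^ q" using w_le by (intro integral_le_const int_w AE_I2) (auto simp: sp)
      also have "\<dots> \<le> inverse e ^ q * \<gamma> k powr R" using mult_left_mono[OF \<gamma>_powr_ge1[of k], of "inverse e ^ q"] e by simp
      finally show ?thesis .
    qed
    ultimately have "(1 - K1 * Tr) * b k \<le> (M2 + M1 * Tr) * (\<gamma> k powr R * BS) + cE q m * (inverse e ^ q * \<gamma> k powr R)"
      using cE_pos[of q m] by (intro order_trans[OF main[of k]] add_mono mult_left_mono[OF _ T0] mult_left_mono) auto
    also have "\<dots> = ((M2 + M1 * Tr) * BS + cE q m * inverse e ^ q) * \<gamma> k powr R" by (simp add: algebra_simps)
    finally have "b k \<le> v * \<gamma> k powr R" using Xi by (simp add: v_def pos_le_divide_eq mult.commute)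
    then show ?thesis using cb[of k] by linarith
  qed
  have Jc: "(\<lambda>j. J k j * c j) summable_on UNIV" for k by (rule weighted_summable[OF c0 c_le])
  define \<Sigma> where "\<Sigma> k = (\<Sum>\<^sub>\<infinity>j. J k j * c j)" for k
  define s where "s k = (\<Sum>\<^sub>\<infinity>j. J k j)" for k
  have s: "s k \<le> Jn" for k unfolding s_def by (rule J_sum)
  have \<Sigma>0: "0 \<le> \<Sigma> k" for k unfolding \<Sigma>_def using J_nonneg c0 by (intro infsum_nonneg) auto
  \<comment> \<open>\<open>LL3\<close> bounds \<open>S k\<close> by the values of \<open>Lt\<close>
    at the other sites, and \<open>cross\<close> is the tangent inequality of \<open>Psi\<close>
    under the integral.\<close>
  have Sb: "?S k \<le> K3 * (s k * (b k - c k) + \<Sigma> k)" for k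
  proof -
    have cross: "(\<integral>\<^sup>+ x. ennreal (Lt j x * w k x) \<partial>\<mu>) \<le> ennreal (b k - c k + c j)" for j
    proof -
      have le: "Lt j x * w k x \<le> Lt k x * w k x - P k x + P j x" if x: "x \<in> C" for x
      proof -
        have "psi q e (Lt k x) * Lt j x + Psi q e (Lt k x) \<le> psi q e (Lt k x) * Lt k x + Psi q e (Lt j x)"
          by (rule Psi_tangent[OF e(1) L0[OF x] L0[OF x]])
        from mult_right_mono[OF this, of "gW m e x"] gW[of x]
        show ?thesis by (simp add: w_def P_def algebra_simps)
      qed
      have "(\<integral>\<^sup>+ x. ennreal (Lt j x * w k x) \<partial>\<mu>) \<le> (\<integral>\<^sup>+ x. ennreal (Lt k x * w k x - P k x + P j x) \<partial>\<mu>)"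
        using le by (intro nn_integral_mono ennreal_leI) (auto simp: sp)
      also have "\<dots> = ennreal (\<integral>x. Lt k x * w k x - P k x + P j x \<partial>\<mu>)"
      proof (rule nn_integral_eq_integral)
        show "integrable \<mu> (\<lambda>x. Lt k x * w k x - P k x + P j x)"
          by (intro Bochner_Integration.integrable_add Bochner_Integration.integrable_diff int_Lw int_P)
        show "AE x in \<mu>. 0 \<le> Lt k x * w k x - P k x + P j x"
          using P_le P0 by (intro AE_I2) (auto simp: sp intro!: add_nonneg_nonneg)
      qed
      also have "(\<integral>x. Lt k x * w k x - P k x + P j x \<partial>\<mu>) = b k - c k + c j"
        using int_Lw int_P by (simp add: b_def c_def)
      finally show ?thesis .
    qed
    have "ennreal (?S k) = (\<integral>\<^sup>+ x. ennreal (S k x * w k x) \<partial>\<mu>)" by (simp add: nnS)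
    also have "\<dots> \<le> (\<integral>\<^sup>+ x. (\<integral>\<^sup>+ j. ennreal (K3 * J k j) * ennreal (Lt j x * w k x) \<partial>count_space UNIV) \<partial>\<mu>)"
    proof (intro nn_integral_mono)
      fix x assume "x \<in> space \<mu>"
      then have x: "x \<in> C" by (simp add: sp)
      have "ennreal (S k x * w k x) = ennreal (S k x) * ennreal (w k x)"
        using S_nonneg w0[OF x] by (simp add: ennreal_mult)
      also have "\<dots> \<le> (\<integral>\<^sup>+ j. ennreal (J k j) * ennreal (K3 * Lt j x) \<partial>count_space UNIV) * ennreal (w k x)"
        by (intro mult_right_mono S_le_Lt[OF x]) auto
      also have "\<dots> = (\<integral>\<^sup>+ j. ennreal (J k j) * ennreal (K3 * Lt j x) * ennreal (w k x) \<partial>count_space UNIV)"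
        by (subst nn_integral_multc) auto
      also have "\<dots> = (\<integral>\<^sup>+ j. ennreal (K3 * J k j) * ennreal (Lt j x * w k x) \<partial>count_space UNIV)"
        using J_nonneg pos L0[OF x] w0[OF x]
        by (intro nn_integral_cong) (simp add: ennreal_mult[symmetric] mult_ac)
      finally show "ennreal (S k x * w k x) \<le> \<dots>" .
    qed
    also have "\<dots> = (\<integral>\<^sup>+ j. (\<integral>\<^sup>+ x. ennreal (K3 * J k j) * ennreal (Lt j x * w k x) \<partial>\<mu>) \<partial>count_space UNIV)"
      by (intro nn_integral_count_space_nn_integral) auto
    also have "\<dots> = (\<integral>\<^sup>+ j. ennreal (K3 * J k j) * (\<integral>\<^sup>+ x. ennreal (Lt j x * w k x) \<partial>\<mu>) \<partial>count_space UNIV)"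
      by (intro nn_integral_cong nn_integral_cmult) auto
    also have "\<dots> \<le> (\<integral>\<^sup>+ j. ennreal (K3 * J k j) * ennreal (b k - c k + c j) \<partial>count_space UNIV)"
      by (intro nn_integral_mono mult_left_mono cross) auto
    also have "\<dots> = (\<integral>\<^sup>+ j. ennreal (K3 * ((b k - c k) * J k j + J k j * c j)) \<partial>count_space UNIV)"
    proof (intro nn_integral_cong)
      fix j
      have "0 \<le> K3 * J k j" "0 \<le> b k - c k + c j" using J_nonneg pos c0[of j] cb[of k] by auto
      then show "ennreal (K3 * J k j) * ennreal (b k - c k + c j) = ennreal (K3 * ((b k - c k) * J k j + J k j * c j))"
        by (subst ennreal_mult[symmetric]) (auto simp: algebra_simps)
    qed
    also have "\<dots> = ennreal (\<Sum>\<^sub>\<infinity>j. K3 * ((b k - c k) * J k j + J k j * c j))"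
      using J_nonneg pos c0 cb[of k]
      by (intro ennreal_infsum_count_space summable_on_cmult_right summable_on_add J_sum Jc) auto
    also have "(\<Sum>\<^sub>\<infinity>j. K3 * ((b k - c k) * J k j + J k j * c j)) = K3 * ((b k - c k) * s k + \<Sigma> k)"
      unfolding s_def \<Sigma>_def
      by (simp add: infsum_cmult_right' infsum_add summable_on_cmult_right J_sum Jc)
    finally have "ennreal (?S k) \<le> ennreal (K3 * ((b k - c k) * s k + \<Sigma> k))" .
    moreover have "0 \<le> K3 * ((b k - c k) * s k + \<Sigma> k)"
    proof -
      have "0 \<le> s k" unfolding s_def using J_nonneg by (intro infsum_nonneg) auto
      then show ?thesis using pos cb[of k] \<Sigma>0[of k] by simp
    qed
    ultimately show ?thesis by (simp add: mult.commute)
  qed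
  have wb: "cE q m * (\<integral>x. w k x \<partial>\<mu>) \<le> \<delta> * b k + c5 q m" for k
  proof -
    have "(\<integral>x. cE q m * w k x \<partial>\<mu>) \<le> (\<integral>x. \<delta> * (Lt k x * w k x) + c5 q m \<partial>\<mu>)"
    proof (intro integral_mono)
      fix x assume "x \<in> space \<mu>"
      then have x: "x \<in> C" by (simp add: sp)
      show "cE q m * w k x \<le> \<delta> * (Lt k x * w k x) + c5 q m"
      proof (cases "cE q m \<le> \<delta> * Lt k x")
        case True
        then show ?thesis using mult_right_mono[OF True w0[OF x], of k] c5_nonneg[of q m] by (simp add: mult.assoc)
      next
        case False
        then have l: "Lt k x \<le> cE q m / \<delta>" using \<delta>_pos by (simp add: pos_le_divide_eq mult.commute)
        have "w k x \<le> psi q e (Lt k x)"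
          unfolding w_def using gW[of x] psi_nonneg[OF L0[OF x] e(1)] mult_left_mono[of "gW m e x" 1] by fastforce
        also have "\<dots> \<le> Lt k x ^ q" by (rule psi_le_power[OF L0[OF x] e(1)])
        also have "\<dots> \<le> (cE q m / \<delta>) ^ q" using l L0[OF x] by (intro power_mono)
        finally have "cE q m * w k x \<le> c5 q m"
          unfolding c5_def using cE_pos[of q m] by (intro mult_left_mono) auto
        moreover have "0 \<le> \<delta> * (Lt k x * w k x)" using \<delta>_pos L0[OF x] w0[OF x] by simp
        ultimately show ?thesis by linarith
      qed
    qed (use int_w int_Lw in auto)
    then show ?thesis using int_Lw[of k] by (simp add: b_def prob_space)
  qed
  have ineq: "(1 - K1 * Tr - \<delta> - T1 * s k) * b k + T1 * s k * c k \<le> T1 * \<Sigma> k + c5 q m" for k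
  proof -
    have "(M2 + M1 * Tr) * ?S k \<le> (M2 + M1 * Tr) * (K3 * (s k * (b k - c k) + \<Sigma> k))"
      by (intro mult_left_mono Sb T0)
    then have "(1 - K1 * Tr) * b k \<le> T1 * (s k * (b k - c k) + \<Sigma> k) + (\<delta> * b k + c5 q m)"
      using main[of k] wb[of k] by (simp add: T1_def mult.assoc)
    then show ?thesis by (simp add: algebra_simps)
  qed
  have coef: "\<delta> \<le> 1 - K1 * Tr - \<delta> - T1 * s k" for k
    unfolding \<delta>_eq using mult_left_mono[OF s[of k], of T1] T1_pos by simp
  have "c k \<le> \<gamma> 0 powr R * (c5 q m / (1 - K1 * Tr - \<delta> - T1 * Jn))" for k
  proof (rule weighted_iteration[OF c0 c_le])
    show "0 \<le> T1" "T1 * Jn < 1 - K1 * Tr - \<delta>" using T1_pos \<delta>_pos \<delta>_eq by auto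
    show "0 \<le> c5 q m" by (rule c5_nonneg)
    fix k
    \<comment> \<open>As \<open>c k \<le> b k\<close> and the coefficient of \<open>b k\<close> is
      positive, \<open>b k\<close> may be replaced by \<open>c k\<close>; the terms with
      \<open>s k\<close> then cancel.\<close>
    have "(1 - K1 * Tr - \<delta> - T1 * s k) * c k \<le> (1 - K1 * Tr - \<delta> - T1 * s k) * b k"
      using coef[of k] \<delta>_pos by (intro mult_left_mono cb) auto
    then show "(1 - K1 * Tr - \<delta>) * c k \<le> T1 * (\<Sum>\<^sub>\<infinity>j. J k j * c j) + c5 q m"
      using ineq[of k] by (simp add: \<Sigma>_def algebra_simps)
  qed
  then have c_bound: "c k \<le> \<gamma> 0 powr R * (c5 q m / \<delta>)" for k by (simp add: \<delta>_eq)
  define B where "B = \<gamma> 0 powr R * (c5 q m / \<delta>)"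
  have B0: "B \<ge> 0" using c0[of k] c_bound[of k] by (simp add: B_def)
  have "\<Sigma> k \<le> B * Jn"
  proof -
    have "c j \<le> B * \<gamma> (k - j) powr R" for j
      using c_bound[of j] mult_left_mono[OF \<gamma>_powr_ge1[of "k - j"] B0] by (simp add: B_def)
    from weighted_sum(2)[OF c0 this B0] show ?thesis by (simp add: \<Sigma>_def)
  qed
  then have "T1 * \<Sigma> k \<le> T1 * (Jn * B)" using T1_pos by (simp add: mult.commute)
  moreover have "\<delta> * b k \<le> (1 - K1 * Tr - \<delta> - T1 * s k) * b k" by (intro mult_right_mono coef b0)
  moreover have "0 \<le> T1 * s k * c k"
  proof -
    have "0 \<le> s k" unfolding s_def using J_nonneg by (intro infsum_nonneg) auto
    then show ?thesis using T1_pos c0[of k] by simp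
  qed
  \<comment> \<open>Second use of \<open>ineq\<close>: now \<open>b k\<close> is kept and the
    nonnegative term with \<open>c k\<close> is dropped.\<close>
  ultimately have "\<delta> * b k \<le> T1 * (Jn * B) + c5 q m" using ineq[of k] by linarith
  then have "b k \<le> cB q m" using \<delta>_pos by (simp add: cB_def B_def pos_le_divide_eq mult.commute)
  then show ?thesis unfolding w_def[symmetric] nnL by (rule ennreal_leI)
qed

text \<open>The parameters of the two remaining cutoffs tend to 0 together; the bound
  \<open>cB q r\<close> contains neither.\<close>

lemma Lt_moment_le: "(\<integral>\<^sup>+ x. ennreal (Lt k x ^ Suc q) \<partial>\<mu>) \<le> ennreal (cB q r)"
proof (rule nn_integral_le_of_tendsto)
  let ?e = "\<lambda>i. inverse (real (Suc i))"
  show "(\<lambda>x. ennreal (Lt k x * (psi q (?e i) (Lt k x) * gW r (?e i) x))) \<in> borel_measurable \<mu>" for i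
    by measurable
  show "(\<integral>\<^sup>+ x. ennreal (Lt k x * (psi q (?e i) (Lt k x) * gW r (?e i) x)) \<partial>\<mu>) \<le> ennreal (cB q r)" for i
    by (rule integral_Lt_psi_le) (auto simp: inverse_le_1_iff)
  fix x
  have "(\<lambda>i. Lt k x * (psi q (?e i) (Lt k x) * gW r (?e i) x))
      \<longlonglongrightarrow> Lt k x * ((Lt k x / (1 + 0 * Lt k x)) ^ q * inverse (1 + 0 * W x) ^ r)"
    unfolding psi_def gW_def by (intro tendsto_intros LIMSEQ_inverse_real_of_nat) auto
  then show "(\<lambda>i. ennreal (Lt k x * (psi q (?e i) (Lt k x) * gW r (?e i) x))) \<longlonglongrightarrow> ennreal (Lt k x ^ Suc q)"
    by (intro tendsto_ennrealI) simp
qed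

end

subsection \<open>Moments of the coordinates\<close>

text \<open>The mass bound in Jensen's inequality has to be positive, hence \<open>Jn + 1\<close>,
  as \<open>Jn\<close> may vanish.\<close>

definition hS :: "nat \<Rightarrow> real" where "hS n = (Jn + 1) ^ Suc n * (K3 ^ Suc n * cB n r)"
text \<open>\<open>r\<close> is the power required by \<open>Z_sq_le\<close>;
  \<open>Suc (2 * n)\<close> further powers of \<open>1 + W\<close> bound the square of the test
  function \<open>coef ^ Suc (2 * n)\<close>.\<close>

definition mC :: "nat \<Rightarrow> nat" where "mC n = r + Suc (2 * n)"
text \<open>The constant of \<open>adm_cutoff\<close> for \<open>q = 0\<close>: here the cutoff
  contains no power of \<open>Lt\<close>.\<close>

definition KC :: "nat \<Rightarrow> real" where "KC n = real 0 * (K1 + K2) + real (mC n) * \<kappa> + cU"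
definition a0 :: "nat \<Rightarrow> real" where "a0 n = real (Suc (2 * n)) + (1 + Tr) * (KC n + N1)"
text \<open>The base 6 is the product of the 2 from \<open>young_power\<close> and the 3 from
  \<open>sum3_power_le\<close>, which splits the majorant \<open>H\<close> in
  \<open>coef_cutoff_le\<close> into its constant, its \<open>Lt\<close> part and its
  \<open>S\<close> part.\<close>

definition hC :: "nat \<Rightarrow> real" where
  "hC n = 6 ^ (2 * Suc n) * (a0 n ^ (2 * Suc n) + ((1 + Tr) * K1) ^ (2 * Suc n) * cB (Suc (2 * n)) r
     + ((1 + Tr) * M1) ^ (2 * Suc n) * hS (Suc (2 * n)))"

lemma KC_nonneg: "KC n \<ge> 0" unfolding KC_def by (rule adm_const_nonneg)

lemma a0_ge1: "a0 n \<ge> 1"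
  using KC_nonneg[of n] nonneg Tr_pos by (simp add: a0_def)

lemma dirC1_coef_power:
  "dirC1 k n (\<lambda>x. coef k n x ^ Suc i) (\<lambda>x. real (Suc i) * coef k n x ^ i)"
proof -
  have "dirC1 k n (\<lambda>x. coef k n x ^ Suc i) (\<lambda>x. (real (Suc i) * coef k n x ^ i) * 1)"
    by (rule dirC1_compose[OF dirC1_coef, where u = "\<lambda>s. s ^ Suc i" and u' = "\<lambda>s. real (Suc i) * s ^ i"])
      (auto intro!: derivative_eq_intros continuous_intros simp del: power_Suc)
  then show ?thesis by simp
qed

lemma coef_power_Env:
  "\<exists>c\<ge>0. \<forall>x\<in>C. (\<bar>coef k n x ^ Suc (2 * i)\<bar> + \<bar>real (Suc (2 * i)) * coef k n x ^ (2 * i)\<bar>) * Z k x \<le> c * Env (mC i) k x"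
proof -
  let ?q = "real (Suc (2 * i))"
  obtain cz where cz: "cz \<ge> 0" "\<And>x. x \<in> C \<Longrightarrow> (Z k x)\<^sup>2 \<le> cz * Env r k x" using Z_sq_le by blast
  define v where "v = (norm jB)\<^sup>2 * \<gamma> k"
  have v0: "v \<ge> 0" using \<gamma>_pos[of k] by (simp add: v_def)
  let ?c = "2 * v ^ Suc (2 * i) + 2 * (?q)\<^sup>2 * v ^ (2 * i) + cz"
  have "(\<bar>coef k n x ^ Suc (2 * i)\<bar> + \<bar>?q * coef k n x ^ (2 * i)\<bar>) * Z k x \<le> ?c * Env (mC i) k x"
    if x: "x \<in> C" for x
  proof -
    have sq: "(coef k n x)\<^sup>2 \<le> v * (1 + W x)"
    proof -
      have "(coef k n x)\<^sup>2 \<le> (norm jB * nB k x)\<^sup>2" using coef_le[of k n x] by (simp add: abs_le_square_iff[symmetric])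
      also have "\<dots> \<le> (norm jB)\<^sup>2 * (\<gamma> k * (1 + W x))"
        unfolding power_mult_distrib using nB_le_W[OF x, of k] \<gamma>_pos[of k] by (intro mult_left_mono) (auto simp: distrib_left)
      finally show ?thesis by (simp add: v_def mult.assoc)
    qed
    have p: "(coef k n x ^ l)\<^sup>2 \<le> v ^ l * Env (mC i) k x" if "l \<le> mC i" for l
    proof -
      have "(coef k n x ^ l)\<^sup>2 = ((coef k n x)\<^sup>2) ^ l" by (simp flip: power_mult add: mult.commute)
      also have "\<dots> \<le> (v * (1 + W x)) ^ l" using sq by (intro power_mono) auto
      also have "\<dots> \<le> v ^ l * Env (mC i) k x"
        unfolding power_mult_distrib using v0 by (intro mult_left_mono le_Env that) auto
      finally show ?thesis .
    qed
    let ?a = "coef k n x ^ Suc (2 * i)" and ?b = "?q * coef k n x ^ (2 * i)"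
    have "(\<bar>?a\<bar> + \<bar>?b\<bar>) * Z k x \<le> (\<bar>?a\<bar> + \<bar>?b\<bar>)\<^sup>2 + (Z k x)\<^sup>2"
      using sum_squares_bound[of "\<bar>?a\<bar> + \<bar>?b\<bar>" "Z k x"] mult_nonneg_nonneg[of "\<bar>?a\<bar> + \<bar>?b\<bar>" "Z k x"] Z_parts(1)[of k x]
      by linarith
    also have "(\<bar>?a\<bar> + \<bar>?b\<bar>)\<^sup>2 \<le> 2 * ?a\<^sup>2 + 2 * ?b\<^sup>2"
      using sum_squares_bound[of "\<bar>?a\<bar>" "\<bar>?b\<bar>"] by (simp add: power2_sum del: power_Suc)
    also have "?b\<^sup>2 = (?q)\<^sup>2 * (coef k n x ^ (2 * i))\<^sup>2" by (rule power_mult_distrib)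
    also have "2 * ?a\<^sup>2 + 2 * ((?q)\<^sup>2 * (coef k n x ^ (2 * i))\<^sup>2) + (Z k x)\<^sup>2
        \<le> 2 * (v ^ Suc (2 * i) * Env (mC i) k x) + 2 * ((?q)\<^sup>2 * (v ^ (2 * i) * Env (mC i) k x)) + cz * Env (mC i) k x"
    proof (intro add_mono mult_left_mono p)
      have "Env r k x \<le> Env (mC i) k x" using le_Env(2)[of r "mC i" k x] by (simp add: Env_def mC_def)
      then show "(Z k x)\<^sup>2 \<le> cz * Env (mC i) k x" using cz(2)[OF x] cz(1) mult_left_mono order_trans by blast
    qed (auto simp: mC_def)
    finally show ?thesis by (simp add: algebra_simps)
  qed
  moreover have "?c \<ge> 0" using v0 cz by simp
  ultimately show ?thesis by blast
qed

context
  fixes \<mu> assumes \<mu>: "\<mu> \<in> Mb \<gamma> jX jB A \<phi> F0 G" and small: "T1 * Jn < 1 - K1 * Tr"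
begin

lemmas [measurable] = Lt_measurable[OF \<mu>] S_measurable[OF \<mu>] W_measurable[OF \<mu>] coef_measurable[OF \<mu>]
  Fn_measurable[OF \<mu>] gW_measurable[OF \<mu>] psi_measurable

lemma S_moment_le: "(\<integral>\<^sup>+ x. ennreal (S k x ^ Suc n) \<partial>\<mu>) \<le> ennreal (hS n)"
proof -
  have Jsum: "(\<integral>\<^sup>+ j. ennreal (J k j) \<partial>count_space UNIV) \<le> ennreal (Jn + 1)"
    using J_sum[of k] J_nonneg by (subst ennreal_infsum_count_space) (auto intro!: ennreal_leI)
  have Jn1: "Jn + 1 > 0" using Jn_nonneg by linarith
  have "(\<integral>\<^sup>+ x. ennreal (S k x ^ Suc n) \<partial>\<mu>)
      \<le> (\<integral>\<^sup>+ x. (\<integral>\<^sup>+ j. ennreal (J k j) * ennreal (K3 * Lt j x) \<partial>count_space UNIV) ^ Suc n \<partial>\<mu>)"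
  proof (rule nn_integral_mono)
    fix x assume "x \<in> space \<mu>"
    then have x: "x \<in> C" by (simp add: space_\<mu>[OF \<mu>])
    have "ennreal (S k x ^ Suc n) = ennreal (S k x) ^ Suc n" using S_nonneg by (simp add: ennreal_power del: power_Suc)
    also have "\<dots> \<le> (\<integral>\<^sup>+ j. ennreal (J k j) * ennreal (K3 * Lt j x) \<partial>count_space UNIV) ^ Suc n"
      by (intro power_mono S_le_Lt x) auto
    finally show "ennreal (S k x ^ Suc n) \<le> \<dots>" .
  qed
  also have "\<dots> \<le> ennreal ((Jn + 1) ^ Suc n) * ennreal (K3 ^ Suc n * cB n r)"
  proof (intro nn_integral_weighted_power_le Jsum Jn1)
    fix j
    have "(\<integral>\<^sup>+ x. ennreal (K3 * Lt j x) ^ Suc n \<partial>\<mu>) = (\<integral>\<^sup>+ x. ennreal (K3 ^ Suc n) * ennreal (Lt j x ^ Suc n) \<partial>\<mu>)"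
    proof (rule nn_integral_cong)
      fix x assume "x \<in> space \<mu>"
      then have "0 \<le> Lt j x" using Lt_ge1[of x j] by (simp add: space_\<mu>[OF \<mu>])
      then show "ennreal (K3 * Lt j x) ^ Suc n = ennreal (K3 ^ Suc n) * ennreal (Lt j x ^ Suc n)"
        using pos by (simp add: ennreal_power ennreal_mult[symmetric] power_mult_distrib del: power_Suc)
    qed
    also have "\<dots> = ennreal (K3 ^ Suc n) * (\<integral>\<^sup>+ x. ennreal (Lt j x ^ Suc n) \<partial>\<mu>)"
      by (simp add: nn_integral_cmult del: power_Suc)
    also have "\<dots> \<le> ennreal (K3 ^ Suc n) * ennreal (cB n r)"
      by (intro mult_left_mono Lt_moment_le[OF \<mu> small]) auto
    finally show "(\<integral>\<^sup>+ x. ennreal (K3 * Lt j x) ^ Suc n \<partial>\<mu>) \<le> ennreal (K3 ^ Suc n * cB n r)"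
      using pos by (simp add: ennreal_mult' del: power_Suc)
  qed measurable
  also have "\<dots> = ennreal (hS n)" using Jn1 by (simp add: hS_def ennreal_mult'[symmetric] del: power_Suc)
  finally show ?thesis .
qed

text \<open>In the variable \<open>u = sqrt (lam n) * \<bar>coef k n x\<bar>\<close> the linear
  drift yields \<open>u ^ (2 * Suc i)\<close>. The other terms have lower degree in
  \<open>u\<close>, with coefficients bounded by \<open>Lt\<close> and \<open>S\<close> uniformly in
  \<open>n\<close>. Hence \<open>young_power\<close> absorbs them at the cost of moments already
  bounded.\<close>

lemma coef_cutoff_le:
  assumes e: "0 < e" "e \<le> 1"
  shows "(\<integral>\<^sup>+ x. ennreal ((lam n * (coef k n x)\<^sup>2) ^ Suc i / 2 * (gW (mC i) e x * gU e k x)) \<partial>\<mu>) \<le> ennreal (hC i)"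
proof -
  interpret prob_space \<mu> by (rule prob[OF \<mu>])
  note sp = space_\<mu>[OF \<mu>]
  define g where "g x = psi 0 e (Lt k x) * gW (mC i) e x * gU e k x" for x
  define h where "h x = coef k n x ^ Suc (2 * i)" for x
  define h' where "h' x = real (Suc (2 * i)) * coef k n x ^ (2 * i)" for x
  have g_eq: "g x = gW (mC i) e x * gU e k x" for x by (simp add: g_def psi_def)
  have g01: "0 \<le> g x" "g x \<le> 1" for x
    using gW_bounds[OF e(1), of "mC i" x] gU_bounds[OF e(1), of k x] by (auto simp: g_eq mult_le_one)
  obtain c where c: "c \<ge> 0" "\<And>x. x \<in> C \<Longrightarrow> (\<bar>h x\<bar> + \<bar>h' x\<bar>) * Z k x \<le> c * Env (mC i) k x"
    using coef_power_Env[of k n i] unfolding h_def h'_def by blast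
  have adm: "adm k (KC i) g" unfolding g_def KC_def by (rule adm_cutoff[OF e e(1)])
  have Env: "\<And>x. x \<in> C \<Longrightarrow> g x * Env (mC i) k x \<le> inverse e ^ 0 * inverse e ^ mC i * (1 + inverse e)"
    unfolding g_def by (rule cutoff_Env[OF e e(1)])
  have dir: "dirC1 k n h h'" unfolding h_def[abs_def] h'_def[abs_def] by (rule dirC1_coef_power)
  have m: "r \<le> mC i" by (simp add: mC_def)
  note ibp = integration_by_parts[OF \<mu> adm KC_nonneg m Env dir c]
  \<comment> \<open>The power \<open>lam n ^ i\<close> turns the leading term into a power of
    \<open>u\<close>.\<close>
  define f1 where "f1 x = lam n ^ i * (h x * g x * (lam n * coef k n x + Fn k n x))" for x
  define f2 where "f2 x = lam n ^ i * ((\<bar>h' x\<bar> + KC i * \<bar>h x\<bar>) * g x)" for x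
  have int1: "integrable \<mu> f1" unfolding f1_def by (intro integrable_mult_right ibp)
  have int2: "integrable \<mu> f2" unfolding f2_def by (intro integrable_mult_right ibp)
  have le12: "(\<integral>x. f1 x \<partial>\<mu>) \<le> (\<integral>x. f2 x \<partial>\<mu>)"
    unfolding f1_def f2_def using ibp(3) lam_pos[of n] by (simp add: mult_left_mono)
  let ?N = "2 * Suc i"
  let ?q = "real (Suc (2 * i))"
  define H where "H x = a0 i + (1 + Tr) * K1 * Lt k x + (1 + Tr) * M1 * S k x" for x
  have [measurable]: "H \<in> borel_measurable \<mu>" unfolding H_def[abs_def] by measurable
  have pT: "0 \<le> (1 + Tr) * K1" "0 \<le> (1 + Tr) * M1" using pos Tr_pos by auto
  have LS: "0 \<le> Lt k x" "0 \<le> S k x" if "x \<in> C" for x using Lt_ge1[OF that, of k] S_nonneg by auto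
  have H1: "1 \<le> H x" if x: "x \<in> C" for x
  proof -
    have "0 \<le> (1 + Tr) * K1 * Lt k x" "0 \<le> (1 + Tr) * M1 * S k x"
      using LS[OF x] pT by (auto intro: mult_nonneg_nonneg)
    then show ?thesis using a0_ge1[of i] by (simp add: H_def)
  qed
  have pw: "(lam n * (coef k n x)\<^sup>2) ^ Suc i / 2 * g x \<le> (2 * H x) ^ ?N + (f1 x - f2 x)" if x: "x \<in> C" for x
  proof -
    define u where "u = sqrt (lam n) * \<bar>coef k n x\<bar>"
    have l: "0 < lam n" by (rule lam_pos)
    have u0: "0 \<le> u" using l by (simp add: u_def)
    have u2: "u\<^sup>2 = lam n * (coef k n x)\<^sup>2" using l by (simp add: u_def power_mult_distrib)
    have uN: "u ^ ?N = (lam n * (coef k n x)\<^sup>2) ^ Suc i" by (simp only: power_mult u2)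
    have u2i: "u ^ (2 * i) = lam n ^ i * coef k n x ^ (2 * i)" by (simp add: power_mult u2 power_mult_distrib)
    define b where "b = (1 + Tr) * (KC i + \<bar>Fn k n x\<bar>)"
    have b0: "0 \<le> b" using Tr_pos KC_nonneg[of i] by (simp add: b_def)
    have hu: "lam n ^ i * \<bar>h x\<bar> * (KC i + \<bar>Fn k n x\<bar>) \<le> b * u ^ Suc (2 * i)"
    proof -
      have ab: "\<bar>h x\<bar> = \<bar>coef k n x\<bar> * coef k n x ^ (2 * i)"
        by (simp add: h_def abs_mult power_abs[symmetric])
      have "\<bar>coef k n x\<bar> \<le> (1 + Tr) * u"
      proof -
        \<comment> \<open>Every eigenvalue is at least \<open>inverse Tr\<close>, so the factor
          \<open>sqrt (lam n)\<close> that \<open>lam n ^ i * \<bar>h x\<bar>\<close> lacks to be a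
          power of \<open>u\<close> costs at most \<open>1 + Tr\<close>.\<close>
        have "1 \<le> (1 + Tr) * sqrt (lam n)"
        proof -
          have "1 \<le> Tr * lam n" using inverse_lam_le[of n] l by (simp add: field_simps)
          also have "\<dots> \<le> (1 + Tr)\<^sup>2 * lam n" using l Tr_pos by (intro mult_right_mono) (auto simp: power2_eq_square algebra_simps)
          finally have "1 \<le> ((1 + Tr) * sqrt (lam n))\<^sup>2" using l by (simp add: power_mult_distrib)
          then show ?thesis using Tr_pos l by (intro power2_le_imp_le[of 1]) auto
        qed
        from mult_right_mono[OF this, of "\<bar>coef k n x\<bar>"] show ?thesis by (simp add: u_def mult.assoc)
      qed
      moreover have "0 \<le> lam n ^ i * coef k n x ^ (2 * i)" using l by (simp add: zero_le_even_power)
      ultimately have "\<bar>coef k n x\<bar> * (lam n ^ i * coef k n x ^ (2 * i)) \<le> (1 + Tr) * u * (lam n ^ i * coef k n x ^ (2 * i))"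
        by (rule mult_right_mono)
      then have "lam n ^ i * \<bar>h x\<bar> \<le> (1 + Tr) * u * u ^ (2 * i)"
        unfolding ab u2i by (simp add: mult_ac)
      then have "lam n ^ i * \<bar>h x\<bar> * (KC i + \<bar>Fn k n x\<bar>) \<le> (1 + Tr) * u * u ^ (2 * i) * (KC i + \<bar>Fn k n x\<bar>)"
        using KC_nonneg[of i] by (intro mult_right_mono) auto
      then show ?thesis by (simp add: b_def mult_ac)
    qed
    have "?q + b \<le> H x"
    proof -
      have "b \<le> (1 + Tr) * (KC i + (K1 * Lt k x + M1 * S k x + N1))"
        unfolding b_def using Fn_le[OF x, of k n] Tr_pos by (intro mult_left_mono add_left_mono) auto
      then show ?thesis by (simp add: H_def a0_def algebra_simps)
    qed
    from young_power[OF u0 _ b0 this H1[OF x], of i]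
    have Y: "?q * u ^ (2 * i) + b * u ^ Suc (2 * i) \<le> u ^ ?N / 2 + (2 * H x) ^ ?N" by simp
    have "h x * coef k n x = coef k n x ^ ?N" by (simp add: h_def mult.commute)
    then have hc: "h x * coef k n x = ((coef k n x)\<^sup>2) ^ Suc i" by (simp only: power_mult)
    have "f2 x - f1 x = (lam n ^ i * \<bar>h' x\<bar> + lam n ^ i * (KC i * \<bar>h x\<bar>) - lam n ^ i * lam n * (h x * coef k n x) - lam n ^ i * (h x * Fn k n x)) * g x"
      by (simp add: f1_def f2_def algebra_simps)
    also have "lam n ^ i * lam n * (h x * coef k n x) = u ^ ?N"
      unfolding uN hc by (simp add: power_mult_distrib mult_ac)
    also have "\<bar>h' x\<bar> = h' x"
      unfolding h'_def by (intro abs_of_nonneg mult_nonneg_nonneg zero_le_even_power) auto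
    also have "lam n ^ i * h' x = ?q * u ^ (2 * i)"
      unfolding h'_def u2i by (simp only: mult_ac)
    also have "(?q * u ^ (2 * i) + lam n ^ i * (KC i * \<bar>h x\<bar>) - u ^ ?N - lam n ^ i * (h x * Fn k n x)) * g x
        \<le> ((2 * H x) ^ ?N - u ^ ?N / 2) * g x"
    proof (rule mult_right_mono[OF _ g01(1)])
      have "- (h x * Fn k n x) \<le> \<bar>h x\<bar> * \<bar>Fn k n x\<bar>" by (metis abs_ge_minus_self abs_mult)
      from mult_left_mono[OF this, of "lam n ^ i"] l
      have "- (lam n ^ i * (h x * Fn k n x)) \<le> lam n ^ i * (\<bar>h x\<bar> * \<bar>Fn k n x\<bar>)" by simp
      moreover have "lam n ^ i * \<bar>h x\<bar> * (KC i + \<bar>Fn k n x\<bar>) = lam n ^ i * (KC i * \<bar>h x\<bar>) + lam n ^ i * (\<bar>h x\<bar> * \<bar>Fn k n x\<bar>)"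
        by (simp add: algebra_simps)
      ultimately show "?q * u ^ (2 * i) + lam n ^ i * (KC i * \<bar>h x\<bar>) - u ^ ?N - lam n ^ i * (h x * Fn k n x)
          \<le> (2 * H x) ^ ?N - u ^ ?N / 2"
        using Y hu by linarith
    qed
    also have "\<dots> \<le> (2 * H x) ^ ?N - u ^ ?N / 2 * g x"
    proof -
      have "0 \<le> (2 * H x) ^ ?N" using H1[OF x] by simp
      then have "(2 * H x) ^ ?N * g x \<le> (2 * H x) ^ ?N" using g01 by (intro mult_left_le)
      then show ?thesis unfolding left_diff_distrib by linarith
    qed
    finally show ?thesis unfolding uN by linarith
  qed
  have Hle: "(\<integral>\<^sup>+ x. ennreal ((2 * H x) ^ ?N) \<partial>\<mu>) \<le> ennreal (hC i)"
  proof -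
    have "(\<integral>\<^sup>+ x. ennreal ((2 * H x) ^ ?N) \<partial>\<mu>)
        \<le> (\<integral>\<^sup>+ x. ennreal (6 ^ ?N) * (ennreal (a0 i ^ ?N) + ennreal (((1 + Tr) * K1) ^ ?N) * ennreal (Lt k x ^ ?N)
            + ennreal (((1 + Tr) * M1) ^ ?N) * ennreal (S k x ^ ?N)) \<partial>\<mu>)"
    proof (rule nn_integral_mono)
      fix x assume "x \<in> space \<mu>"
      then have x: "x \<in> C" by (simp add: sp)
      have "(2 * H x) ^ ?N = 2 ^ ?N * (a0 i + (1 + Tr) * K1 * Lt k x + (1 + Tr) * M1 * S k x) ^ ?N"
        by (simp only: power_mult_distrib H_def)
      also have "\<dots> \<le> 2 ^ ?N * (3 ^ ?N * (a0 i ^ ?N + ((1 + Tr) * K1 * Lt k x) ^ ?N + ((1 + Tr) * M1 * S k x) ^ ?N))"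
        using a0_ge1[of i] mult_nonneg_nonneg[OF pT(1) LS(1)[OF x]] mult_nonneg_nonneg[OF pT(2) LS(2)[OF x]]
        by (intro mult_left_mono sum3_power_le) auto
      also have "\<dots> = 6 ^ ?N * (a0 i ^ ?N + ((1 + Tr) * K1) ^ ?N * Lt k x ^ ?N + ((1 + Tr) * M1) ^ ?N * S k x ^ ?N)"
        by (simp only: power_mult_distrib[symmetric] mult.assoc[symmetric]) simp
      finally have "(2 * H x) ^ ?N \<le> \<dots>" .
      then show "ennreal ((2 * H x) ^ ?N) \<le> ennreal (6 ^ ?N) * (ennreal (a0 i ^ ?N) + ennreal (((1 + Tr) * K1) ^ ?N) * ennreal (Lt k x ^ ?N)
            + ennreal (((1 + Tr) * M1) ^ ?N) * ennreal (S k x ^ ?N))"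
        using a0_ge1[of i] LS[OF x] pT
        by (simp add: ennreal_mult[symmetric] ennreal_plus[symmetric] ennreal_leI del: ennreal_plus power_Suc mult_Suc_right)
    qed
    also have "\<dots> = ennreal (6 ^ ?N) * (ennreal (a0 i ^ ?N) + ennreal (((1 + Tr) * K1) ^ ?N) * (\<integral>\<^sup>+ x. ennreal (Lt k x ^ ?N) \<partial>\<mu>)
            + ennreal (((1 + Tr) * M1) ^ ?N) * (\<integral>\<^sup>+ x. ennreal (S k x ^ ?N) \<partial>\<mu>))"
      by (simp add: nn_integral_cmult nn_integral_add emeasure_space_1 del: power_Suc mult_Suc_right)
    also have "\<dots> \<le> ennreal (6 ^ ?N) * (ennreal (a0 i ^ ?N) + ennreal (((1 + Tr) * K1) ^ ?N) * ennreal (cB (Suc (2 * i)) r)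
            + ennreal (((1 + Tr) * M1) ^ ?N) * ennreal (hS (Suc (2 * i))))"
      using Lt_moment_le[OF \<mu> small, of k "Suc (2 * i)"] S_moment_le[of k "Suc (2 * i)"]
      by (intro mult_left_mono add_mono) auto
    also have "\<dots> = ennreal (hC i)"
    proof -
      have cBn: "0 \<le> cB q r" for q
        unfolding cB_def using T1_pos Jn_nonneg c5_nonneg[OF \<mu> small, of q r] \<delta>_pos[OF \<mu> small]
        by (intro divide_nonneg_nonneg add_nonneg_nonneg mult_nonneg_nonneg) auto
      have hSn: "0 \<le> hS q" for q unfolding hS_def using Jn_nonneg pos cBn[of q] by simp
      show ?thesis using a0_ge1[of i] pT cBn hSn unfolding hC_def
        by (simp add: ennreal_mult[symmetric] ennreal_plus[symmetric] del: ennreal_plus power_Suc mult_Suc_right)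
    qed
    finally show ?thesis .
  qed
  have intH: "integrable \<mu> (\<lambda>x. (2 * H x) ^ ?N)"
  proof (rule integrableI_nonneg)
    show "(\<integral>\<^sup>+ x. ennreal ((2 * H x) ^ ?N) \<partial>\<mu>) < \<infinity>" using le_less_trans[OF Hle] by simp
    show "AE x in \<mu>. 0 \<le> (2 * H x) ^ ?N" by (intro AE_I2 zero_le_even_power) simp
  qed measurable
  have "(\<integral>\<^sup>+ x. ennreal ((lam n * (coef k n x)\<^sup>2) ^ Suc i / 2 * g x) \<partial>\<mu>)
      \<le> (\<integral>\<^sup>+ x. ennreal ((2 * H x) ^ ?N + (f1 x - f2 x)) \<partial>\<mu>)"
    using pw by (intro nn_integral_mono ennreal_leI) (auto simp: sp)
  also have "\<dots> = ennreal (\<integral>x. (2 * H x) ^ ?N + (f1 x - f2 x) \<partial>\<mu>)"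
  proof (rule nn_integral_eq_integral)
    show "integrable \<mu> (\<lambda>x. (2 * H x) ^ ?N + (f1 x - f2 x))" using intH int1 int2 by auto
    show "AE x in \<mu>. 0 \<le> (2 * H x) ^ ?N + (f1 x - f2 x)"
    proof (rule AE_I2)
      fix x assume "x \<in> space \<mu>"
      then have x: "x \<in> C" by (simp add: sp)
      have "0 \<le> (lam n * (coef k n x)\<^sup>2) ^ Suc i / 2 * g x" using lam_pos[of n] g01(1)[of x] by simp
      then show "0 \<le> (2 * H x) ^ ?N + (f1 x - f2 x)" using pw[OF x] by linarith
    qed
  qed
  also have "(\<integral>x. (2 * H x) ^ ?N + (f1 x - f2 x) \<partial>\<mu>) = (\<integral>x. (2 * H x) ^ ?N \<partial>\<mu>) + ((\<integral>x. f1 x \<partial>\<mu>) - (\<integral>x. f2 x \<partial>\<mu>))"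
    using intH int1 int2 by simp
  \<comment> \<open>The pointwise bound contains \<open>f1 - f2\<close>, whose integral is
    nonpositive by the integration by parts.\<close>
  also have "ennreal \<dots> \<le> ennreal (\<integral>x. (2 * H x) ^ ?N \<partial>\<mu>)" using le12 by (intro ennreal_leI) linarith
  also have "\<dots> = (\<integral>\<^sup>+ x. ennreal ((2 * H x) ^ ?N) \<partial>\<mu>)"
    by (rule nn_integral_eq_integral[symmetric, OF intH]) (intro AE_I2 zero_le_even_power, simp)
  also have "\<dots> \<le> ennreal (hC i)" by (rule Hle)
  finally show ?thesis by (simp add: g_eq)
qed

lemma coef_moment_le: "(\<integral>\<^sup>+ x. ennreal (lam n * (coef k n x)\<^sup>2) ^ Suc i \<partial>\<mu>) \<le> ennreal (2 * hC i)"
proof -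
  let ?e = "\<lambda>l. inverse (real (Suc l))"
  have [measurable]: "gU (?e l) k \<in> borel_measurable \<mu>" for l by (rule adm_measurable[OF \<mu> adm_gU]) simp
  have *: "(\<integral>\<^sup>+ x. ennreal ((lam n * (coef k n x)\<^sup>2) ^ Suc i / 2) \<partial>\<mu>) \<le> ennreal (hC i)"
  proof (rule nn_integral_le_of_tendsto)
    let ?f = "\<lambda>l x. (lam n * (coef k n x)\<^sup>2) ^ Suc i / 2 * (gW (mC i) (?e l) x * gU (?e l) k x)"
    show "(\<lambda>x. ennreal (?f l x)) \<in> borel_measurable \<mu>" for l by measurable
    show "(\<integral>\<^sup>+ x. ennreal (?f l x) \<partial>\<mu>) \<le> ennreal (hC i)" for l
      by (rule coef_cutoff_le) (auto simp: inverse_le_1_iff)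
    fix x
    have "(\<lambda>l. ?f l x) \<longlonglongrightarrow> (lam n * (coef k n x)\<^sup>2) ^ Suc i / 2 * (inverse (1 + 0 * W x) ^ mC i * inverse (1 + 0 * U k x))"
      unfolding gW_def gU_def by (intro tendsto_intros LIMSEQ_inverse_real_of_nat) auto
    then show "(\<lambda>l. ennreal (?f l x)) \<longlonglongrightarrow> ennreal ((lam n * (coef k n x)\<^sup>2) ^ Suc i / 2)"
      by (intro tendsto_ennrealI) simp
  qed
  have "(\<integral>\<^sup>+ x. ennreal (lam n * (coef k n x)\<^sup>2) ^ Suc i \<partial>\<mu>)
      = (\<integral>\<^sup>+ x. ennreal 2 * ennreal ((lam n * (coef k n x)\<^sup>2) ^ Suc i / 2) \<partial>\<mu>)"
    using lam_pos[of n]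
    by (intro nn_integral_cong) (simp add: ennreal_power ennreal_mult'[symmetric] del: power_Suc ennreal_numeral)
  also have "\<dots> = ennreal 2 * (\<integral>\<^sup>+ x. ennreal ((lam n * (coef k n x)\<^sup>2) ^ Suc i / 2) \<partial>\<mu>)"
    by (intro nn_integral_cmult) measurable
  also have "\<dots> \<le> ennreal 2 * ennreal (hC i)" by (intro mult_left_mono *) auto
  finally show ?thesis by (simp add: ennreal_mult' del: ennreal_numeral)
qed

section \<open>The norm of H^\<alpha>\<close>

lemma Hnorm2_eq:
  "Hnorm2 jX jB lam \<phi> \<alpha> (jB (jX (x k)))
    = (\<integral>\<^sup>+ n. ennreal (lam n powr (\<alpha> - 1)) * ennreal (lam n * (coef k n x)\<^sup>2) \<partial>count_space UNIV)"
  unfolding Hnorm2_def nn_integral_count_space_nat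
proof (intro suminf_cong)
  fix n
  have "lam n powr \<alpha> = lam n powr (\<alpha> - 1) * lam n" using lam_pos[of n] by (simp add: powr_diff)
  then show "ennreal (lam n powr \<alpha> * (jB (jX (x k)) \<bullet> jB (jX (\<phi> n)))\<^sup>2)
      = ennreal (lam n powr (\<alpha> - 1)) * ennreal (lam n * (coef k n x)\<^sup>2)"
    using lam_pos[of n] by (simp add: coef_def ennreal_mult'[symmetric] mult.assoc)
qed

lemma Hnorm2_measurable [measurable]: "(\<lambda>x. Hnorm2 jX jB lam \<phi> \<alpha> (jB (jX (x k)))) \<in> borel_measurable \<mu>"
  unfolding Hnorm2_eq by (intro borel_measurable_nn_integral_count_space) measurable

lemma Hnorm2_moment_le:
  assumes \<alpha>: "summable (\<lambda>n. lam n powr (\<alpha> - 1))"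
  defines "a \<equiv> (\<Sum>n. lam n powr (\<alpha> - 1)) + 1"
  shows "(\<integral>\<^sup>+ x. Hnorm2 jX jB lam \<phi> \<alpha> (jB (jX (x k))) ^ Suc i \<partial>\<mu>) \<le> ennreal (a ^ Suc i * (2 * hC i))"
proof -
  have a: "a > 0" using suminf_nonneg[OF \<alpha>] by (simp add: a_def add_nonneg_pos)
  have w: "(\<integral>\<^sup>+ n. ennreal (lam n powr (\<alpha> - 1)) \<partial>count_space UNIV) \<le> ennreal a"
    unfolding nn_integral_count_space_nat using \<alpha> by (subst suminf_ennreal2) (auto simp: a_def intro!: ennreal_leI)
  have "(\<integral>\<^sup>+ x. Hnorm2 jX jB lam \<phi> \<alpha> (jB (jX (x k))) ^ Suc i \<partial>\<mu>) \<le> ennreal (a ^ Suc i) * ennreal (2 * hC i)"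
    unfolding Hnorm2_eq by (intro nn_integral_weighted_power_le w a coef_moment_le) measurable
  then show ?thesis using a by (simp add: ennreal_mult'[symmetric])
qed

text \<open>The first moments of the squared norms are bounded uniformly over the sites and the
  weights are summable, so the weighted sum has finite expectation and is finite almost
  everywhere.\<close>

lemma conf_H_full:
  assumes \<alpha>: "summable (\<lambda>n. lam n powr (\<alpha> - 1))"
  shows "emeasure \<mu> (C \<inter> conf_H \<gamma> jX jB lam \<phi> \<alpha>) = 1"
proof -
  interpret prob_space \<mu> by (rule prob[OF \<mu>])
  note sp = space_\<mu>[OF \<mu>]
  let ?H = "\<lambda>k x. Hnorm2 jX jB lam \<phi> \<alpha> (jB (jX (x k)))"
  define B where "B = ((\<Sum>n. lam n powr (\<alpha> - 1)) + 1) ^ Suc 0 * (2 * hC 0)"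
  have B: "(\<integral>\<^sup>+ x. ?H k x \<partial>\<mu>) \<le> ennreal B" for k
    using Hnorm2_moment_le[OF \<alpha>, of k 0] by (simp add: B_def)
  let ?f = "\<lambda>x. \<integral>\<^sup>+ k. ennreal (inverse (\<gamma> k)) * ?H k x \<partial>count_space UNIV"
  have [measurable]: "?f \<in> borel_measurable \<mu>"
    by (intro borel_measurable_nn_integral_count_space) measurable
  have "(\<integral>\<^sup>+ x. ?f x \<partial>\<mu>) = (\<integral>\<^sup>+ k. (\<integral>\<^sup>+ x. ennreal (inverse (\<gamma> k)) * ?H k x \<partial>\<mu>) \<partial>count_space UNIV)"
    by (intro nn_integral_count_space_nn_integral) auto
  also have "\<dots> = (\<integral>\<^sup>+ k. ennreal (inverse (\<gamma> k)) * (\<integral>\<^sup>+ x. ?H k x \<partial>\<mu>) \<partial>count_space UNIV)"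
    by (intro nn_integral_cong nn_integral_cmult) measurable
  also have "\<dots> \<le> (\<integral>\<^sup>+ k. ennreal (inverse (\<gamma> k)) * ennreal B \<partial>count_space UNIV)"
    by (intro nn_integral_mono mult_left_mono B) auto
  also have "\<dots> = ennreal (\<Sum>\<^sub>\<infinity>k. inverse (\<gamma> k)) * ennreal B"
    using weights \<gamma>_pos
    by (subst nn_integral_multc) (auto simp: ennreal_infsum_count_space weight_system_def less_imp_le)
  also have "\<dots> < \<infinity>" by (simp add: ennreal_mult_less_top)
  finally have "(\<integral>\<^sup>+ x. ?f x \<partial>\<mu>) \<noteq> \<infinity>" by simp
  from nn_integral_PInf_AE[OF _ this] have "AE x in \<mu>. ?f x \<noteq> \<infinity>" by simp
  moreover have eq: "C \<inter> conf_H \<gamma> jX jB lam \<phi> \<alpha> = {x \<in> space \<mu>. ?f x \<noteq> \<infinity>}"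
    by (auto simp: conf_H_def sp nn_integral_count_space_infsum less_top)
  ultimately show ?thesis unfolding eq by (subst emeasure_eq_1_AE) auto
qed

end

end

theorem theorem7p3:
  fixes jX :: "'x::{real_vector, polish_space} \<Rightarrow> 'b::banach"
    and jB :: "'b \<Rightarrow>\<^sub>L 'h::{real_inner, polish_space}"
    and D :: "'h set" and A :: "'h \<Rightarrow> 'h"
    and lam :: "nat \<Rightarrow> real" and \<phi> :: "nat \<Rightarrow> 'x"
    and \<gamma> :: "'z::{countable, ab_group_add} \<Rightarrow> real"
    and F0 :: "'z \<Rightarrow> 'x \<Rightarrow> ('b \<Rightarrow>\<^sub>L real)"
    and G :: "'z \<Rightarrow> ('z \<Rightarrow> 'x) \<Rightarrow> ('b \<Rightarrow>\<^sub>L real)"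
    and J :: "'z \<Rightarrow> 'z \<Rightarrow> real"
    and R Q \<alpha> K0 K1 K2 K3 M1 M2 L0 L1 L2 L3 N1 N2 :: real
  assumes setting: "single_site jX jB D A lam \<phi>"
    and weights: "weight_system \<gamma>"
    and F0_C1: "\<And>k. site_C1 \<phi> (F0 k)"
    and G_C1: "\<And>k. conf_C1 \<gamma> jX \<phi> k (G k)"
    and R: "R \<ge> 1"
    and J: "\<And>k j. J k j = J j k" "\<And>k j. J k j \<ge> 0" "J_norm \<gamma> R J < \<infinity>"
    and pos: "K0 > 0" "K1 > 0" "K2 > 0" "K3 > 0" "M1 > 0" "M2 > 0"
    and nonneg: "L0 \<ge> 0" "L1 \<ge> 0" "L2 \<ge> 0" "L3 \<ge> 0" "N1 \<ge> 0" "N2 \<ge> 0"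
    and FF0: "\<And>x k n. x \<in> conf \<gamma> jX \<Longrightarrow>
      norm (site_pd (F0 k) (\<phi> n) (x k)) \<le> K0 * (norm (F0 k (x k)) + norm (jX (x k)) powr R) + L0"
    and GG1: "\<And>x k n. x \<in> conf \<gamma> jX \<Longrightarrow>
      \<bar>G k x (jX (\<phi> n))\<bar> + \<bar>conf_pd (G k) (hdir \<phi> k n) x (jX (\<phi> n))\<bar>
        \<le> M1 * (\<Sum>\<^sub>\<infinity>j. J k j * norm (jX (x j)) powr R) + N1"
    and GG2: "\<And>x k n. x \<in> conf \<gamma> jX \<Longrightarrow>
      norm (G k x) + \<bar>G k x (jX (x k))\<bar> + \<bar>conf_pd (G k) (hdir \<phi> k n) x (jX (x k))\<bar>
        \<le> M2 * (\<Sum>\<^sub>\<infinity>j. J k j * norm (jX (x j)) powr R) + N2"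
    and LL1: "\<And>x k n. x \<in> conf \<gamma> jX \<Longrightarrow>
      \<bar>F0 k (x k) (jX (\<phi> n))\<bar> + \<bar>site_pd (F0 k) (\<phi> n) (x k) (jX (\<phi> n))\<bar> \<le> K1 * Lfun jX F0 k (x k) + L1"
    and LL2: "\<And>x k n. x \<in> conf \<gamma> jX \<Longrightarrow>
      \<bar>site_pd (F0 k) (\<phi> n) (x k) (jX (x k))\<bar> \<le> K2 * Lfun jX F0 k (x k) + L2"
    and LL3: "\<And>x k. x \<in> conf \<gamma> jX \<Longrightarrow>
      norm (jX (x k)) powr R \<le> K3 * Lfun jX F0 k (x k) + L3"
    and Xi0: "K1 * tr_inv lam < 1"
    and Theta0: "enn2real (J_norm \<gamma> R J) * K3 * ((M2 + M1 * tr_inv lam) / (1 - K1 * tr_inv lam)) < 1"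
    and Q: "Q \<ge> 1"
    and XiQ: "tr_inv lam * K1 * (1 + (2 * Q - 1) * K2) < 1"
    and \<alpha>: "\<alpha> \<ge> 0" "summable (\<lambda>n. lam n powr (\<alpha> - 1))"
  shows "(\<forall>\<mu> \<in> Mb \<gamma> jX jB A \<phi> F0 G. emeasure \<mu> (conf \<gamma> jX \<inter> conf_H \<gamma> jX jB lam \<phi> \<alpha>) = 1) \<and>
    (SUP \<mu> \<in> Mb \<gamma> jX jB A \<phi> F0 G. SUP k.
       \<integral>\<^sup>+ x. ennreal_powr (Hnorm2 jX jB lam \<phi> \<alpha> (jB (jX (x k)))) ((Q + 1) / 2) \<partial>\<mu>) < \<infinity>"
proof -
  let ?H = "\<lambda>x k. Hnorm2 jX jB lam \<phi> \<alpha> (jB (jX (x k)))"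
  interpret lattice_model jX jB D A lam \<phi> \<gamma> F0 G J R K0 K1 K2 K3 M1 M2 L0 L1 L2 L3 N1 N2
  proof (intro lattice_model.intro lattice_setting.intro lattice_setting_axioms.intro lattice_model_axioms.intro)
    show "norm (G k x) + \<bar>G k x (jX (x k))\<bar> \<le> M2 * (\<Sum>\<^sub>\<infinity>j. J k j * norm (jX (x j)) powr R) + N2"
      if "x \<in> conf \<gamma> jX" for x k
      using GG2[OF that, of k 0] by linarith
  qed (fact setting weights F0_C1 G_C1 R J pos nonneg FF0 GG1 LL1 LL2 LL3)+
  \<comment> \<open>The smallness condition \<open>Theta0\<close>, multiplied by its positive
    denominator.\<close>
  have small: "T1 * Jn < 1 - K1 * Tr"
    using Theta0 Xi0 by (simp add: T1_def Jn_def Tr_def field_simps)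
  define a where "a = (\<Sum>n. lam n powr (\<alpha> - 1)) + 1"
  \<comment> \<open>\<open>Hnorm2\<close> is a squared norm, so the moment of order Q + 1 has the
    exponent \<open>(Q + 1) / 2\<close>, which is rounded up to an integer.\<close>
  define N where "N = nat \<lceil>(Q + 1) / 2\<rceil>"
  have N: "(Q + 1) / 2 \<le> real (Suc N)" unfolding N_def by linarith
  have bound: "(\<integral>\<^sup>+ x. ennreal_powr (?H x k) ((Q + 1) / 2) \<partial>\<mu>)
      \<le> 1 + ennreal (a ^ Suc N * (2 * hC N))" if \<mu>: "\<mu> \<in> Mb \<gamma> jX jB A \<phi> F0 G" for \<mu> k
  proof -
    interpret prob_space \<mu> by (rule prob[OF \<mu>])
    have [measurable]: "(\<lambda>x. ?H x k) \<in> borel_measurable \<mu>"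
      by (rule Hnorm2_measurable[OF \<mu> small])
    have "(\<integral>\<^sup>+ x. ennreal_powr (?H x k) ((Q + 1) / 2) \<partial>\<mu>)
        \<le> (\<integral>\<^sup>+ x. 1 + ?H x k ^ Suc N \<partial>\<mu>)"
      using Q N by (intro nn_integral_mono ennreal_powr_le) auto
    also have "\<dots> = 1 + (\<integral>\<^sup>+ x. ?H x k ^ Suc N \<partial>\<mu>)"
      by (subst nn_integral_add) (auto simp: emeasure_space_1)
    also have "\<dots> \<le> 1 + ennreal (a ^ Suc N * (2 * hC N))"
      unfolding a_def by (intro add_left_mono Hnorm2_moment_le[OF \<mu> small \<alpha>(2)])
    finally show ?thesis .
  qed
  show ?thesis
  proof (intro conjI ballI)
    show "emeasure \<mu> (conf \<gamma> jX \<inter> conf_H \<gamma> jX jB lam \<phi> \<alpha>) = 1" if "\<mu> \<in> Mb \<gamma> jX jB A \<phi> F0 G" for \<mu>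
      by (rule conf_H_full[OF that small \<alpha>(2)])
    have "(SUP \<mu> \<in> Mb \<gamma> jX jB A \<phi> F0 G. SUP k.
        \<integral>\<^sup>+ x. ennreal_powr (?H x k) ((Q + 1) / 2) \<partial>\<mu>)
        \<le> 1 + ennreal (a ^ Suc N * (2 * hC N))"
      by (intro SUP_least bound)
    also have "\<dots> < \<infinity>" by simp
    finally show "(SUP \<mu> \<in> Mb \<gamma> jX jB A \<phi> F0 G. SUP k.
        \<integral>\<^sup>+ x. ennreal_powr (?H x k) ((Q + 1) / 2) \<partial>\<mu>) < \<infinity>" .
  qed
qed

end
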